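(* Let $n\ge 1$ be an integer and $0<\alpha\le 2$. Suppose $f\colon[0,\infty)\to[0,\infty)$ satisfies all of the following: (M) $f$ is locally Lipschitz continuous, non-decreasing and $f(0)=0$; (C) $f$ is convex on $(0,\infty)$; (B) $\displaystyle\int_1^\infty \frac{1}{f(u)}\,du<\infty$; (S) there exist $c_0,\mu_0>0$ and $g\colon(\mu_0,\infty)\to(0,\infty)$ such that $\int_{\mu_0}^\infty \frac{1}{g(s)}\,ds<\infty$ and $f(\lambda\mu)\ge g(\mu)f(\lambda)$ for all $\lambda>0$ and $\mu\ge\mu_0$ with $\lambda\mu\in(0,c_0)$. Then the following are equivalent: (a) the PDE $u_t=\Delta_\alpha u+f(u)$, $u(0)=\phi$, on $\mathbb{R}^n$ has the blow-up property; (b) the ODE $x'=f(x)-\frac{n}{\alpha t}x$, $x(t_0)=x_0$, has the blow-up property; (c) $\displaystyle\int_{0^+}\frac{f(u)}{u^{2+\alpha/n}}\,du=\infty$.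
   Context: $\Delta_\alpha=-(-\Delta)^{\alpha/2}$ denotes the fractional Laplacian on $\mathbb{R}^n$, and $K_\alpha(x,t)$ is the (positive) fractional heat kernel, i.e. $K_\alpha(\cdot,t)$ is the function whose Fourier transform is $e^{-t|\xi|^\alpha}$, normalized so that $\int_{\mathbb{R}^n}K_\alpha(x,t)\,dx=1$. The fractional heat semigroup is $[S_\alpha(t)\phi](x)=\int_{\mathbb{R}^n}K_\alpha(x-y,t)\phi(y)\,dy$. Solutions of the PDE are understood via the variation of constants formula $$u(t)=S_\alpha(t)\phi+\int_0^tS_\alpha(t-s)f(u(s))\,ds.$$ It is well known that, when $f$ satisfies (M), for any non-negative $\phi\in L^\infty(\mathbb{R}^n)$ there is a maximal existence time $T_\phi\in(0,\infty]$ such that the PDE has a unique non-negative solution $u$ on $[0,T_\phi)$ that is bounded on $\mathbb{R}^n\times[0,T]$ for every $T\in(0,T_\phi)$, and if $T_\phi<\infty$ then $\|u(t)\|_\infty\to\infty$ as $t\to T_\phi$. The PDE has the blow-up property if $T_\phi<\infty$ for every non-trivial, non-negative $\phi\in L^\infty(\mathbb{R}^n)$. The ODE has the blow-up property if for every $x_0>0$ and every $t_0>0$ the solution of $x'=f(x)-\frac{n}{\alpha t}x$, $x(t_0)=x_0$, blows up in finite time (forward in time from $t_0$). In (B), $1/f(u)$ is taken to be $+\infty$ where $f(u)=0$. The notation $\int_{0^+}h(u)\,du=\infty$ means $\int_0^\delta h(u)\,du=\infty$ for (all) small $\delta>0$. *)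

theory Defs
  imports "HOL-Analysis.Analysis"
begin

definition fourier :: "(real^'n \<Rightarrow> real) \<Rightarrow> real^'n \<Rightarrow> complex" where
  "fourier k \<xi> = (LINT x|lebesgue. exp (- \<i> * of_real (x \<bullet> \<xi>)) * of_real (k x))"

(* Among integrable functions the Fourier transform determines k only almost everywhere;
   continuity selects the usual representative.  Only meaningful for t > 0.  The
   normalization (total integral 1) is the case \<xi> = 0, as 0 powr \<alpha> = 0. *)
definition heat_kernel :: "real \<Rightarrow> real \<Rightarrow> real^'n \<Rightarrow> real" where
  "heat_kernel \<alpha> t = (THE k. continuous_on UNIV k \<and> integrable lebesgue k \<and>
     (\<forall>\<xi>. fourier k \<xi> = of_real (exp (- t * norm \<xi> powr \<alpha>))))"

definition heat_semigroup :: "real \<Rightarrow> real \<Rightarrow> (real^'n \<Rightarrow> real) \<Rightarrow> real^'n \<Rightarrow> real" where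
  "heat_semigroup \<alpha> t \<phi> x =
     (if t = 0 then \<phi> x else LINT y|lebesgue. heat_kernel \<alpha> t (x - y) * \<phi> y)"

(* Elements of L^\<infinity> are represented by functions; "non-negative", "equal" and
   "non-trivial" for such data are meant almost everywhere. *)
definition Linfty :: "(real^'n \<Rightarrow> real) set" where
  "Linfty = {\<phi>. \<phi> \<in> borel_measurable lebesgue \<and> (\<exists>C. AE x in lebesgue. \<bar>\<phi> x\<bar> \<le> C)}"

(* A non-negative solution on [0,T), written u t x, of the variation of constants formula, bounded
   on R^n x [0,T'] for every T' in (0,T).  Measurability and non-negativity are required of the
   representative u itself (not just almost everywhere), since f (u s y) makes sense only for
   u s y \<ge> 0; together with boundedness this makes the integrals below genuine ones. *)
definition mild_solution ::
    "real \<Rightarrow> (real \<Rightarrow> real) \<Rightarrow> (real^'n \<Rightarrow> real) \<Rightarrow> ereal \<Rightarrow> (real \<Rightarrow> real^'n \<Rightarrow> real) \<Rightarrow> bool" where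
  "mild_solution \<alpha> f \<phi> T u \<longleftrightarrow>
     (\<lambda>(t, x). u t x) \<in> borel_measurable (restrict_space borel ({t. 0 \<le> t \<and> ereal t < T} \<times> UNIV)) \<and>
     (\<forall>t x. 0 \<le> t \<and> ereal t < T \<longrightarrow> 0 \<le> u t x) \<and>
     (\<forall>T'. 0 < T' \<and> ereal T' < T \<longrightarrow> bounded ((\<lambda>(t, x). u t x) ` ({0..T'} \<times> UNIV))) \<and>
     (\<forall>t. 0 \<le> t \<and> ereal t < T \<longrightarrow> (AE x in lebesgue.
        u t x = heat_semigroup \<alpha> t \<phi> x
                + (LINT s:{0..t}|lebesgue. heat_semigroup \<alpha> (t - s) (\<lambda>y. f (u s y)) x)))"

definition max_existence_time :: "real \<Rightarrow> (real \<Rightarrow> real) \<Rightarrow> (real^'n \<Rightarrow> real) \<Rightarrow> ereal" where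
  "max_existence_time \<alpha> f \<phi> = Sup {T. 0 < T \<and> (\<exists>u. mild_solution \<alpha> f \<phi> T u)}"

definition pde_blowup_property :: "'n::finite itself \<Rightarrow> real \<Rightarrow> (real \<Rightarrow> real) \<Rightarrow> bool" where
  "pde_blowup_property _ \<alpha> f \<longleftrightarrow>
     (\<forall>\<phi> :: real^'n \<Rightarrow> real. \<phi> \<in> Linfty \<and> (AE x in lebesgue. 0 \<le> \<phi> x) \<and> \<not> (AE x in lebesgue. \<phi> x = 0)
        \<longrightarrow> max_existence_time \<alpha> f \<phi> < \<infinity>)"

(* The condition 0 \<le> x t only keeps the solution in the domain [0,\<infinity>) of f. *)
definition ode_blowup_property :: "nat \<Rightarrow> real \<Rightarrow> (real \<Rightarrow> real) \<Rightarrow> bool" where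
  "ode_blowup_property n \<alpha> f \<longleftrightarrow>
     (\<forall>x0>0. \<forall>t0>0. \<exists>T>t0. \<exists>x :: real \<Rightarrow> real.
        x t0 = x0 \<and>
        (\<forall>t\<in>{t0..<T}. 0 \<le> x t \<and>
           (x has_real_derivative (f (x t) - real n / (\<alpha> * t) * x t)) (at t within {t0..<T})) \<and>
        filterlim x at_top (at_left T))"

(* local_lipschitz allows a time-dependent family of functions; here it is constant in time. *)
definition condM :: "(real \<Rightarrow> real) \<Rightarrow> bool" where
  "condM f \<longleftrightarrow> local_lipschitz (UNIV :: real set) {0..} (\<lambda>_. f) \<and> mono_on {0..} f \<and> f 0 = 0"

(* Division in ennreal, where 1 / 0 = \<infinity>. *)
definition condB :: "(real \<Rightarrow> real) \<Rightarrow> bool" where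
  "condB f \<longleftrightarrow> (\<integral>\<^sup>+u\<in>{1..}. 1 / ennreal (f u) \<partial>lborel) < \<infinity>"

(* g is a function on (\<mu>0,\<infinity>), yet the inequality is stated from \<mu>0 on.  The value g \<mu>0 is left
   unconstrained here, so \<mu> = \<mu>0 adds nothing; as \<mu>0 may be enlarged, asking in addition for
   g \<mu>0 > 0 would give an equivalent condition. *)
definition condS :: "(real \<Rightarrow> real) \<Rightarrow> bool" where
  "condS f \<longleftrightarrow> (\<exists>c0>0. \<exists>\<mu>0>0. \<exists>g :: real \<Rightarrow> real.
     (\<forall>\<mu>>\<mu>0. 0 < g \<mu>) \<and>
     set_integrable lebesgue {\<mu>0<..} (\<lambda>s. 1 / g s) \<and>
     (\<forall>l>0. \<forall>\<mu>\<ge>\<mu>0. l * \<mu> \<in> {0<..<c0} \<longrightarrow> f (l * \<mu>) \<ge> g \<mu> * f l))"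

end

theory Submission
  imports Defs "HOL-Probability.Probability" "HOL-Real_Asymp.Real_Asymp"
begin

text \<open>
  Write p = n/\<alpha> and y(t) = t^p x(t).  The ODE becomes y' = t^p f(t^{-p} y), and the substitution
  u = A t^{-p} turns the integral of t^p f(A t^{-p}) near infinity into that of f(u)/u^{2+1/p} near 0.
  If the latter diverges, y is unbounded; then either x exceeds c0 at a late time and (B) forces blow-up,
  or (S) gives y' \<ge> t^p g(y) f(t^{-p}), whose left-over integral of 1/g converges.  If it converges, a small
  y never doubles.

  For the PDE, the kernel K is a mixture of Gaussians: this yields positivity and radial monotonicity,
  hence K(2t-s) \<ge> (s/2t)^p K(s).  With Jensen's inequality the mean m(t) of a mild solution u(t) against
  K(t) satisfies t^p m(t) \<ge> c + 2^{-p} \<integral> s^p f(m(s)) ds, so it dominates a solution of the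
  same ODE with 2^{-p} f in place of f.  Conversely, in the convergent case 2 \<epsilon> K(1+t) is a
  supersolution for small \<epsilon>, and monotone iteration below it gives a global solution.
\<close>

section \<open>Gaussian integrals\<close>

text \<open>\<open>heat_kernel\<close> is given only through its Fourier transform, so positivity,
  monotonicity and even integrability of K must be extracted from the symbol exp (- t
  |xi|^\<alpha>). No subordinator density is built: mixtures of Gaussians appear as limits of
  nonnegative combinations of exp (- s |xi|^2), and nonnegativity and decay along rays survive such
  limits. The factor 2^-p arises because the Duhamel term from time s, paired with K(t), sees a
  kernel at a time between t and 2t; for this reason the blow-up argument for the similarity
  equation carries an arbitrary factor kappa > 0. The mean of a mild solution obeys only an integral
  inequality and is known only to be measurable and locally bounded, so comparison is phrased with
  continuous supersolutions of Volterra equations and with minimal solutions. Convexity acts in two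
  ways: through Jensen's inequality, and through f(u)/u being nondecreasing, which lets f beat the
  damping p x / t at late times and bounds f linearly below the supersolution.\<close>

lemma gaussian_1d:
  fixes e a :: real
  assumes "0 < e"
  shows "integrable lborel (\<lambda>s. complex_of_real (exp (- e * s\<^sup>2)) * iexp (a * s))" (is ?I)
    and "(\<integral>s. complex_of_real (exp (- e * s\<^sup>2)) * iexp (a * s) \<partial>lborel)
      = complex_of_real (sqrt (pi / e) * exp (- a\<^sup>2 / (4 * e)))" (is ?E)
proof -
  \<comment> \<open>With this scale e (c x)^2 = x^2 / 2, so the integral becomes the characteristic
    function of the standard normal distribution at \<open>a * c\<close>.\<close>
  define c where "c = 1 / sqrt (2 * e)"
  have c: "c > 0" using assms by (simp add: c_def)
  have c2: "c\<^sup>2 = 1 / (2 * e)" using assms by (simp add: c_def power_divide)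
  have eq: "complex_of_real (std_normal_density x) * iexp (a * c * x) =
     complex_of_real (1 / sqrt (2 * pi)) * (complex_of_real (exp (- e * (c * x)\<^sup>2)) * iexp (a * (c * x)))" for x
    using assms by (simp add: normal_density_def power_mult_distrib c2 algebra_simps)
  have dens: "integrable lborel (\<lambda>x. std_normal_density x *\<^sub>R iexp (a * c * x))"
  proof -
    have "integrable std_normal_distribution (\<lambda>x. iexp (a * c * x))"
      by (rule prob_space.integrable_iexp[OF prob_space_normal_density]) auto
    then show ?thesis
      by (subst (asm) integrable_density) (auto simp: normal_density_nonneg)
  qed
  have int0: "integrable lborel (\<lambda>x. complex_of_real (exp (- e * (c * x)\<^sup>2)) * iexp (a * (c * x)))"
    using integrable_mult_right[OF dens[unfolded scaleR_conv_of_real eq], of "complex_of_real (sqrt (2 * pi))"]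
    unfolding mult.assoc[symmetric] of_real_mult[symmetric] by simp
  show ?I
    using int0 lborel_integrable_real_affine_iff[of c "\<lambda>s. complex_of_real (exp (- e * s\<^sup>2)) * iexp (a * s)" 0] c
    by simp
  have "char std_normal_distribution (a * c) = (\<integral>x. std_normal_density x *\<^sub>R iexp (a * c * x) \<partial>lborel)"
    unfolding char_def by (subst integral_density) (auto simp: normal_density_nonneg)
  also have "\<dots> = complex_of_real (1 / sqrt (2 * pi)) * (\<integral>x. complex_of_real (exp (- e * (c * x)\<^sup>2)) * iexp (a * (c * x)) \<partial>lborel)"
    unfolding scaleR_conv_of_real eq by simp
  finally have "(\<integral>x. complex_of_real (exp (- e * (c * x)\<^sup>2)) * iexp (a * (c * x)) \<partial>lborel)
     = complex_of_real (sqrt (2 * pi)) * complex_of_real (exp (- (a * c)\<^sup>2 / 2))"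
    by (simp add: char_std_normal_distribution field_simps)
  moreover have "(\<integral>s. complex_of_real (exp (- e * s\<^sup>2)) * iexp (a * s) \<partial>lborel) =
     \<bar>c\<bar> *\<^sub>R (\<integral>x. complex_of_real (exp (- e * (c * x)\<^sup>2)) * iexp (a * (c * x)) \<partial>lborel)"
    using lborel_integral_real_affine[of c "\<lambda>s. complex_of_real (exp (- e * s\<^sup>2)) * iexp (a * s)" 0] c by simp
  moreover have "c * sqrt (2 * pi) = sqrt (pi / e)"
    using assms by (simp add: c_def real_sqrt_divide real_sqrt_mult)
  moreover have "(a * c)\<^sup>2 / 2 = a\<^sup>2 / (4 * e)"
    by (simp add: power_mult_distrib c2)
  ultimately show ?E
    using c by (simp add: scaleR_conv_of_real flip: of_real_mult) 
qed

text \<open>Lebesgue measure is the image of a finite product of one-dimensional ones, so Fubini for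
  product measures reduces coordinatewise products to the line.\<close>

lemma lborel_integral_prod:
  fixes f :: "'a::euclidean_space \<Rightarrow> real \<Rightarrow> 'b::{real_normed_field,banach,second_countable_topology}"
  assumes "\<And>b. b \<in> Basis \<Longrightarrow> integrable lborel (f b)"
  shows "integrable lborel (\<lambda>x::'a. \<Prod>b\<in>Basis. f b (x \<bullet> b))"
    and "(\<integral>x. (\<Prod>b\<in>Basis. f b (x \<bullet> b)) \<partial>(lborel :: 'a measure)) = (\<Prod>b\<in>Basis. (\<integral>s. f b s \<partial>lborel))"
proof -
  interpret product_sigma_finite "\<lambda>_::'a. lborel :: real measure" by standard
  have [measurable]: "\<And>b. b \<in> Basis \<Longrightarrow> f b \<in> borel_measurable borel"
    using assms borel_measurable_integrable by force
  have m: "(\<lambda>f. \<Sum>b\<in>Basis. f b *\<^sub>R b) \<in> measurable (\<Pi>\<^sub>M b\<in>Basis. lborel) (borel :: 'a measure)"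
    by measurable
  have eq: "(\<Prod>b\<in>Basis. f b ((\<Sum>b\<in>Basis. x b *\<^sub>R b) \<bullet> b)) = (\<Prod>b\<in>Basis. f b (x b))" for x
    by (intro prod.cong) (simp_all add: )
  show "integrable lborel (\<lambda>x::'a. \<Prod>b\<in>Basis. f b (x \<bullet> b))"
    unfolding lborel_eq[where 'a='a]
    by (subst integrable_distr_eq[OF m]) (simp_all add: eq product_integrable_prod assms)
  show "(\<integral>x. (\<Prod>b\<in>Basis. f b (x \<bullet> b)) \<partial>(lborel :: 'a measure)) = (\<Prod>b\<in>Basis. (\<integral>s. f b s \<partial>lborel))"
    unfolding lborel_eq[where 'a='a]
    by (subst integral_distr[OF m]) (simp_all add: eq product_integral_prod assms)
qed

text \<open>For even \<open>h\<close> this is the full Fourier transform; keeping it real-valued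
  lets inequalities be stated directly.\<close>

definition cos_transform :: "('a::euclidean_space \<Rightarrow> real) \<Rightarrow> 'a \<Rightarrow> real" where
  "cos_transform h x = (\<integral>\<xi>. cos (x \<bullet> \<xi>) * h \<xi> \<partial>lborel)"

lemma gaussian_cos_transform:
  fixes x :: "'a::euclidean_space"
  assumes "0 < e"
  shows "integrable lborel (\<lambda>\<xi>::'a. exp (- e * (norm \<xi>)\<^sup>2))"
    and "cos_transform (\<lambda>\<xi>. exp (- e * (norm \<xi>)\<^sup>2)) x
       = sqrt (pi / e) ^ DIM('a) * exp (- (norm x)\<^sup>2 / (4 * e))"
proof -
  have nrm: "(norm \<xi>)\<^sup>2 = (\<Sum>b\<in>Basis. (\<xi> \<bullet> b)\<^sup>2)" for \<xi> :: 'a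
    unfolding power2_norm_eq_inner by (subst euclidean_inner) (simp add: power2_eq_square)
  have prod: "complex_of_real (exp (- e * (norm \<xi>)\<^sup>2)) * iexp (x \<bullet> \<xi>)
     = (\<Prod>b\<in>Basis. complex_of_real (exp (- e * (\<xi> \<bullet> b)\<^sup>2)) * iexp ((x \<bullet> b) * (\<xi> \<bullet> b)))" for x \<xi> :: 'a
    by (subst euclidean_inner[of x])
       (simp add: nrm prod.distrib sum_distrib_left exp_sum of_real_prod flip: of_real_exp)
  have int: "integrable lborel (\<lambda>\<xi>. complex_of_real (exp (- e * (norm \<xi>)\<^sup>2)) * iexp (x \<bullet> \<xi>))" for x :: 'a
    unfolding prod by (intro lborel_integral_prod gaussian_1d assms)
  have "(\<integral>\<xi>. complex_of_real (exp (- e * (norm \<xi>)\<^sup>2)) * iexp (x \<bullet> \<xi>) \<partial>lborel)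
      = complex_of_real (sqrt (pi / e) ^ DIM('a) * exp (- (norm x)\<^sup>2 / (4 * e)))"
    unfolding prod
  proof (subst lborel_integral_prod(2))
    show "(\<Prod>b\<in>Basis. (\<integral>s. complex_of_real (exp (- e * s\<^sup>2)) * iexp ((x \<bullet> b) * s) \<partial>lborel))
        = complex_of_real (sqrt (pi / e) ^ DIM('a) * exp (- (norm x)\<^sup>2 / (4 * e)))"
      unfolding gaussian_1d(2)[OF assms]
      by (simp add: prod.distrib nrm sum_divide_distrib exp_sum
          flip: of_real_prod of_real_mult of_real_power sum_negf)
  qed (intro gaussian_1d assms)
  then have "Re (\<integral>\<xi>. complex_of_real (exp (- e * (norm \<xi>)\<^sup>2)) * iexp (x \<bullet> \<xi>) \<partial>lborel)
      = sqrt (pi / e) ^ DIM('a) * exp (- (norm x)\<^sup>2 / (4 * e))"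
    by simp
  then show "cos_transform (\<lambda>\<xi>. exp (- e * (norm \<xi>)\<^sup>2)) x
       = sqrt (pi / e) ^ DIM('a) * exp (- (norm x)\<^sup>2 / (4 * e))"
    unfolding cos_transform_def integral_Re[OF int, symmetric] by (simp add: Re_exp mult.commute)
  show "integrable lborel (\<lambda>\<xi>::'a. exp (- e * (norm \<xi>)\<^sup>2))"
    using integrable_Re[OF int[of 0]] by simp
qed

section \<open>Radial multipliers and the positivity of stable kernels\<close>

text \<open>The profile is a function of |xi|^2, so Gaussians become exponentials exp (- s r). The
  extra Gaussian factor makes the transform of every bounded profile an absolutely convergent
  integral.\<close>

definition radial :: "real \<Rightarrow> (real \<Rightarrow> real) \<Rightarrow> 'a::euclidean_space \<Rightarrow> real" where
  "radial e \<phi> \<xi> = exp (- e * (norm \<xi>)\<^sup>2) * \<phi> ((norm \<xi>)\<^sup>2)"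

text \<open>Boundedness concerns only r > 0: exp (- s r) explodes for negative r, and r = 0
  corresponds to the null set xi = 0.\<close>

definition tame :: "(real \<Rightarrow> real) \<Rightarrow> bool" where
  "tame \<phi> \<longleftrightarrow> \<phi> \<in> borel_measurable borel \<and> (\<exists>B. \<forall>r>0. \<bar>\<phi> r\<bar> \<le> B)"

text \<open>All e > 0 are required at once because multiplication by exp (- s r) merely shifts e to
  e + s, which gives closure under Gaussian factors.\<close>

definition radial_decreasing :: "'a::euclidean_space itself \<Rightarrow> (real \<Rightarrow> real) set" where
  "radial_decreasing _ = {\<phi>. tame \<phi> \<and> (\<forall>e>0. \<forall>x::'a. \<forall>a\<ge>1.
      0 \<le> cos_transform (radial e \<phi>) (a *\<^sub>R x) \<and>
      cos_transform (radial e \<phi>) (a *\<^sub>R x) \<le> cos_transform (radial e \<phi>) x)}"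

text \<open>The class of radially decreasing profiles is not visibly closed under products; passing to its
  multipliers gives an algebra for free, which contains the Gaussians and is closed under exp.\<close>

definition radial_multiplier :: "'a::euclidean_space itself \<Rightarrow> (real \<Rightarrow> real) set" where
  "radial_multiplier T = {h. tame h \<and> (\<forall>\<phi>\<in>radial_decreasing T. (\<lambda>r. h r * \<phi> r) \<in> radial_decreasing T)}"

lemma AE_norm_pos: "AE \<xi> in (lborel :: 'a::euclidean_space measure). 0 < (norm \<xi>)\<^sup>2"
  using AE_lborel_singleton[of "0 :: 'a"] by eventually_elim auto

lemma radial_measurable [measurable]:
  "\<phi> \<in> borel_measurable borel \<Longrightarrow> radial e \<phi> \<in> borel_measurable borel"
  unfolding radial_def[abs_def] by (measurable, rule measurable_compose) measurable

lemma radial_integrable: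
  fixes x :: "'a::euclidean_space"
  assumes "0 < e" "tame \<phi>"
  shows "integrable lborel (\<lambda>\<xi>. cos (x \<bullet> \<xi>) * radial e \<phi> \<xi>)"
proof -
  obtain B where B: "\<And>r. 0 < r \<Longrightarrow> \<bar>\<phi> r\<bar> \<le> B" and [measurable]: "\<phi> \<in> borel_measurable borel"
    using assms(2) by (auto simp: tame_def)
  show ?thesis
  proof (rule Bochner_Integration.integrable_bound)
    show "integrable lborel (\<lambda>\<xi>::'a. B * exp (- e * (norm \<xi>)\<^sup>2))"
      by (intro integrable_mult_right gaussian_cos_transform assms)
    show "AE \<xi> in lborel. norm (cos (x \<bullet> \<xi>) * radial e \<phi> \<xi>) \<le> norm (B * exp (- e * (norm \<xi>)\<^sup>2))"
      using AE_norm_pos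
    proof eventually_elim
      case (elim \<xi>)
      have "\<bar>cos (x \<bullet> \<xi>)\<bar> * (exp (- e * (norm \<xi>)\<^sup>2) * \<bar>\<phi> ((norm \<xi>)\<^sup>2)\<bar>) \<le> 1 * (exp (- e * (norm \<xi>)\<^sup>2) * B)"
        using B[OF elim] by (intro mult_mono) auto
      also have "\<dots> \<le> \<bar>B\<bar> * exp (- e * (norm \<xi>)\<^sup>2)" by (simp add: mult.commute)
      finally show ?case by (simp add: radial_def abs_mult)
    qed
  qed measurable
qed

lemma tame_mult: "tame f \<Longrightarrow> tame g \<Longrightarrow> tame (\<lambda>r. f r * g r)"
  unfolding tame_def
proof (elim conjE exE, intro conjI)
  fix A B assume "\<forall>r>0. \<bar>f r\<bar> \<le> A" "\<forall>r>0. \<bar>g r\<bar> \<le> B"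
  then have "\<forall>r>0. \<bar>f r * g r\<bar> \<le> A * B"
    by (auto simp: abs_mult intro!: mult_mono order_trans[OF abs_ge_zero])
  then show "\<exists>C. \<forall>r>0. \<bar>f r * g r\<bar> \<le> C" ..
qed measurable

lemma tame_add: "tame f \<Longrightarrow> tame g \<Longrightarrow> tame (\<lambda>r. f r + g r)"
  unfolding tame_def
proof (elim conjE exE, intro conjI)
  fix A B assume "\<forall>r>0. \<bar>f r\<bar> \<le> A" "\<forall>r>0. \<bar>g r\<bar> \<le> B"
  then have "\<forall>r>0. \<bar>f r + g r\<bar> \<le> A + B"
    by (auto intro!: order_trans[OF abs_triangle_ineq] add_mono)
  then show "\<exists>C. \<forall>r>0. \<bar>f r + g r\<bar> \<le> C" ..
qed measurable

lemma tame_const: "tame (\<lambda>_. c)"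
  by (auto simp: tame_def)

lemma tame_exp: "0 \<le> s \<Longrightarrow> tame (\<lambda>r. exp (- s * r))"
  by (auto simp: tame_def intro!: exI[of _ 1])

lemma radial_decreasing_1: "(\<lambda>_. 1) \<in> radial_decreasing TYPE('a::euclidean_space)"
  unfolding radial_decreasing_def
proof (intro CollectI conjI allI impI tame_const)
  fix e a :: real and x :: 'a assume e: "0 < e" and a: "1 \<le> a"
  have r: "radial e (\<lambda>_. 1) = (\<lambda>\<xi>::'a. exp (- e * (norm \<xi>)\<^sup>2))"
    by (simp add: radial_def fun_eq_iff)
  show "0 \<le> cos_transform (radial e (\<lambda>_. 1)) (a *\<^sub>R x)"
    unfolding r gaussian_cos_transform(2)[OF e] using e by simp
  have "(norm x)\<^sup>2 \<le> (norm (a *\<^sub>R x))\<^sup>2"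
    using a by (intro power_mono) (auto intro: mult_right_mono[of 1 a, simplified])
  then show "cos_transform (radial e (\<lambda>_. 1)) (a *\<^sub>R x) \<le> cos_transform (radial e (\<lambda>_. 1)) x"
    unfolding r gaussian_cos_transform(2)[OF e] using e
    by (intro mult_left_mono) (auto intro: divide_right_mono)
qed

lemma radial_decreasing_exp_mult:
  assumes "0 \<le> s" "\<phi> \<in> radial_decreasing TYPE('a::euclidean_space)"
  shows "(\<lambda>r. exp (- s * r) * \<phi> r) \<in> radial_decreasing TYPE('a)"
proof -
  have r: "radial e (\<lambda>r. exp (- s * r) * \<phi> r) = (radial (e + s) \<phi> :: 'a \<Rightarrow> real)" for e
    by (auto simp: radial_def algebra_simps simp flip: exp_add)
  show ?thesis
    using assms unfolding radial_decreasing_def mem_Collect_eq r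
    by (auto intro: tame_mult tame_exp[simplified])
qed

lemma cos_transform_radial_add:
  assumes "0 < e" "tame \<phi>" "tame \<psi>"
  shows "cos_transform (radial e (\<lambda>r. \<phi> r + \<psi> r)) x
    = cos_transform (radial e \<phi>) x + cos_transform (radial e \<psi>) (x :: 'a::euclidean_space)"
proof -
  have "cos (x \<bullet> \<xi>) * radial e (\<lambda>r. \<phi> r + \<psi> r) \<xi>
     = cos (x \<bullet> \<xi>) * radial e \<phi> \<xi> + cos (x \<bullet> \<xi>) * radial e \<psi> \<xi>" for \<xi>
    by (simp add: radial_def algebra_simps)
  then show ?thesis
    unfolding cos_transform_def
    by (simp add: Bochner_Integration.integral_add[OF radial_integrable radial_integrable] assms)
qed

lemma radial_decreasing_add:
  assumes "\<phi> \<in> radial_decreasing TYPE('a::euclidean_space)" "\<psi> \<in> radial_decreasing TYPE('a)"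
  shows "(\<lambda>r. \<phi> r + \<psi> r) \<in> radial_decreasing TYPE('a)"
  using assms unfolding radial_decreasing_def
  by (auto simp: cos_transform_radial_add intro!: tame_add add_nonneg_nonneg add_mono)

lemma radial_decreasing_scale:
  assumes "0 \<le> c" "\<phi> \<in> radial_decreasing TYPE('a::euclidean_space)"
  shows "(\<lambda>r. c * \<phi> r) \<in> radial_decreasing TYPE('a)"
proof -
  have "cos_transform (radial e (\<lambda>r. c * \<phi> r)) x = c * cos_transform (radial e \<phi>) x" for e and x :: 'a
  proof -
    have "cos (x \<bullet> \<xi>) * radial e (\<lambda>r. c * \<phi> r) \<xi> = c * (cos (x \<bullet> \<xi>) * radial e \<phi> \<xi>)" for \<xi>
      by (simp add: radial_def)
    then show ?thesis unfolding cos_transform_def by (simp only: integral_mult_right_zero)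
  qed
  then show ?thesis
    using assms unfolding radial_decreasing_def
    by (auto intro!: tame_mult tame_const mult_left_mono)
qed

text \<open>The conditions are inequalities between values of the transform, so they pass to the
  limit once the transforms converge; the Gaussian factor in \<open>radial\<close> supplies the
  dominating function.\<close>

lemma radial_decreasing_lim:
  assumes \<phi>: "\<And>k. \<phi> k \<in> radial_decreasing TYPE('a::euclidean_space)"
    and bd: "\<And>k r. 0 < r \<Longrightarrow> \<bar>\<phi> k r\<bar> \<le> B"
    and lim: "\<And>r. 0 < r \<Longrightarrow> (\<lambda>k. \<phi> k r) \<longlonglongrightarrow> \<psi> r"
    and meas [measurable]: "\<psi> \<in> borel_measurable borel"
  shows "\<psi> \<in> radial_decreasing TYPE('a)"
proof -
  have tame: "tame (\<phi> k)" for k using \<phi>[of k] by (simp add: radial_decreasing_def)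
  then have [measurable]: "\<phi> k \<in> borel_measurable borel" for k by (simp add: tame_def)
  have bd': "\<bar>\<psi> r\<bar> \<le> B" if "0 < r" for r
    by (rule LIMSEQ_le_const2[OF tendsto_rabs[OF lim[OF that]]]) (use bd[OF that] in auto)
  have conv: "(\<lambda>k. cos_transform (radial e (\<phi> k)) x) \<longlonglongrightarrow> cos_transform (radial e \<psi>) x"
    if e: "0 < e" for e and x :: 'a
    unfolding cos_transform_def
  proof (rule integral_dominated_convergence)
    show "integrable lborel (\<lambda>\<xi>::'a. B * exp (- e * (norm \<xi>)\<^sup>2))"
      by (intro integrable_mult_right gaussian_cos_transform e)
    show "AE \<xi> in lborel. (\<lambda>k. cos (x \<bullet> \<xi>) * radial e (\<phi> k) \<xi>) \<longlonglongrightarrow> cos (x \<bullet> \<xi>) * radial e \<psi> \<xi>"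
      using AE_norm_pos
    proof eventually_elim
      case (elim \<xi>)
      show ?case unfolding radial_def by (intro tendsto_intros lim elim)
    qed
    show "AE \<xi> in lborel. norm (cos (x \<bullet> \<xi>) * radial e (\<phi> k) \<xi>) \<le> B * exp (- e * (norm \<xi>)\<^sup>2)" for k
      using AE_norm_pos
    proof eventually_elim
      case (elim \<xi>)
      have "\<bar>cos (x \<bullet> \<xi>)\<bar> * (exp (- e * (norm \<xi>)\<^sup>2) * \<bar>\<phi> k ((norm \<xi>)\<^sup>2)\<bar>) \<le> 1 * (exp (- e * (norm \<xi>)\<^sup>2) * B)"
        using bd[OF elim] by (intro mult_mono) auto
      then show ?case by (simp add: radial_def abs_mult mult.commute)
    qed
  qed measurable
  show ?thesis
    unfolding radial_decreasing_def
  proof (intro CollectI conjI allI impI)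
    show "tame \<psi>" using bd' by (auto simp: tame_def)
    fix e a :: real and x :: 'a assume e: "0 < e" and a: "1 \<le> a"
    show "0 \<le> cos_transform (radial e \<psi>) (a *\<^sub>R x)"
      using \<phi> e a by (intro LIMSEQ_le_const[OF conv[OF e]]) (auto simp: radial_decreasing_def)
    show "cos_transform (radial e \<psi>) (a *\<^sub>R x) \<le> cos_transform (radial e \<psi>) x"
      using \<phi> e a by (intro LIMSEQ_le[OF conv[OF e] conv[OF e]]) (auto simp: radial_decreasing_def)
  qed
qed

lemma radial_multiplier_exp:
  "0 \<le> s \<Longrightarrow> (\<lambda>r. exp (- s * r)) \<in> radial_multiplier TYPE('a::euclidean_space)"
  unfolding radial_multiplier_def by (auto intro: tame_exp[simplified] radial_decreasing_exp_mult[simplified])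

lemma radial_multiplier_1: "(\<lambda>_. 1) \<in> radial_multiplier TYPE('a::euclidean_space)"
  using radial_multiplier_exp[of 0] by simp

lemma radial_multiplier_mult:
  assumes "g \<in> radial_multiplier TYPE('a::euclidean_space)" "h \<in> radial_multiplier TYPE('a)"
  shows "(\<lambda>r. g r * h r) \<in> radial_multiplier TYPE('a)"
  using assms unfolding radial_multiplier_def by (auto simp: mult.assoc tame_mult)

lemma radial_multiplier_add:
  assumes "g \<in> radial_multiplier TYPE('a::euclidean_space)" "h \<in> radial_multiplier TYPE('a)"
  shows "(\<lambda>r. g r + h r) \<in> radial_multiplier TYPE('a)"
  using assms unfolding radial_multiplier_def
  by (auto simp: distrib_right tame_add radial_decreasing_add)

lemma radial_multiplier_scale:
  assumes "0 \<le> c" "h \<in> radial_multiplier TYPE('a::euclidean_space)"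
  shows "(\<lambda>r. c * h r) \<in> radial_multiplier TYPE('a)"
  using assms unfolding radial_multiplier_def
  by (auto simp: mult.assoc radial_decreasing_scale intro!: tame_mult tame_const)

lemma radial_multiplier_sum:
  assumes "\<And>i. i \<in> I \<Longrightarrow> h i \<in> radial_multiplier TYPE('a::euclidean_space)"
  shows "(\<lambda>r. \<Sum>i\<in>I. h i r) \<in> radial_multiplier TYPE('a)"
  using assms
proof (induction I rule: infinite_finite_induct)
  case (insert i I)
  then show ?case by (simp add: radial_multiplier_add)
qed (use radial_multiplier_scale[OF order_refl radial_multiplier_1] in simp_all)

lemma radial_multiplier_power:
  "h \<in> radial_multiplier TYPE('a::euclidean_space) \<Longrightarrow> (\<lambda>r. h r ^ k) \<in> radial_multiplier TYPE('a)"
  by (induction k) (simp_all add: radial_multiplier_1 radial_multiplier_mult)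

lemma radial_multiplier_lim:
  assumes h: "\<And>k. h k \<in> radial_multiplier TYPE('a::euclidean_space)"
    and bd: "\<And>k r. 0 < r \<Longrightarrow> \<bar>h k r\<bar> \<le> B"
    and lim: "\<And>r. 0 < r \<Longrightarrow> (\<lambda>k. h k r) \<longlonglongrightarrow> g r"
    and meas: "g \<in> borel_measurable borel"
  shows "g \<in> radial_multiplier TYPE('a)"
  unfolding radial_multiplier_def
proof (intro CollectI conjI ballI)
  have bd': "\<bar>g r\<bar> \<le> B" if "0 < r" for r
    by (rule LIMSEQ_le_const2[OF tendsto_rabs[OF lim[OF that]]]) (use bd[OF that] in auto)
  then show "tame g" using meas by (auto simp: tame_def)
  fix \<phi> assume \<phi>: "\<phi> \<in> radial_decreasing TYPE('a)"
  then obtain A where A: "\<And>r. 0 < r \<Longrightarrow> \<bar>\<phi> r\<bar> \<le> A" and [measurable]: "\<phi> \<in> borel_measurable borel"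
    by (auto simp: radial_decreasing_def tame_def)
  show "(\<lambda>r. g r * \<phi> r) \<in> radial_decreasing TYPE('a)"
  proof (rule radial_decreasing_lim)
    show "(\<lambda>r. h k r * \<phi> r) \<in> radial_decreasing TYPE('a)" for k
      using h \<phi> by (simp add: radial_multiplier_def)
    show "\<bar>h k r * \<phi> r\<bar> \<le> B * A" if "0 < r" for k r
      using bd[OF that] A[OF that] unfolding abs_mult
      by (intro mult_mono) (auto intro: order_trans[OF abs_ge_zero])
    show "(\<lambda>k. h k r * \<phi> r) \<longlonglongrightarrow> g r * \<phi> r" if "0 < r" for r
      by (intro tendsto_intros lim that)
  qed (use meas in measurable)
qed

text \<open>The exponential series has nonnegative coefficients, so its partial sums stay in the
  class, and exp B bounds them all where |h| <= B.\<close>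

lemma radial_multiplier_exp_comp:
  assumes h: "h \<in> radial_multiplier TYPE('a::euclidean_space)"
  shows "(\<lambda>r. exp (h r)) \<in> radial_multiplier TYPE('a)"
proof -
  obtain B where B: "\<And>r. 0 < r \<Longrightarrow> \<bar>h r\<bar> \<le> B" and [measurable]: "h \<in> borel_measurable borel"
    using h by (auto simp: radial_multiplier_def tame_def)
  show ?thesis
  proof (rule radial_multiplier_lim)
    show "(\<lambda>r. \<Sum>i<k. (1 / fact i) * h r ^ i) \<in> radial_multiplier TYPE('a)" for k
      by (intro radial_multiplier_sum radial_multiplier_scale radial_multiplier_power h) simp
    show "\<bar>\<Sum>i<k. (1 / fact i) * h r ^ i\<bar> \<le> exp B" if "0 < r" for k r
    proof -
      have "\<bar>\<Sum>i<k. (1 / fact i) * h r ^ i\<bar> \<le> (\<Sum>i<k. (1 / fact i) * \<bar>h r\<bar> ^ i)"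
        by (rule order_trans[OF sum_abs]) (simp add: abs_mult power_abs)
      also have "\<dots> \<le> (\<Sum>i. (1 / fact i) * \<bar>h r\<bar> ^ i)"
        using summable_exp[of "\<bar>h r\<bar>"] by (intro sum_le_suminf) (auto simp: divide_inverse)
      also have "\<dots> = exp \<bar>h r\<bar>" by (simp add: exp_def divide_inverse)
      finally show ?thesis using B[OF that] by (auto intro: order_trans)
    qed
    show "(\<lambda>k. \<Sum>i<k. (1 / fact i) * h r ^ i) \<longlonglongrightarrow> exp (h r)" for r
      using exp_converges[of "h r"] by (simp add: sums_def divide_inverse)
  qed measurable
qed

text \<open>These are the coefficients of (1 - x)^b after the constant term. The first is - b, and
  each later one arises from its predecessor by a factor (k + 1 - b) / (k + 2) >= 0.\<close>

lemma gbinomial_alternating_nonpos: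
  fixes b :: real
  assumes "0 < b" "b < 1"
  shows "(-1) ^ Suc k * (b gchoose Suc k) \<le> 0"
proof (induction k)
  case (Suc k)
  have "real (Suc (Suc k)) * ((-1) ^ Suc (Suc k) * (b gchoose Suc (Suc k)))
      = (real (Suc k) - b) * ((-1) ^ Suc k * (b gchoose Suc k))"
  proof -
    have "real (Suc (Suc k)) * (b gchoose Suc (Suc k)) = (b - real (Suc k)) * (b gchoose Suc k)"
      using gbinomial_mult_1[of b "Suc k"] unfolding left_diff_distrib by linarith
    then have "(-1) ^ Suc (Suc k) * (real (Suc (Suc k)) * (b gchoose Suc (Suc k)))
       = (-1) ^ Suc (Suc k) * ((b - real (Suc k)) * (b gchoose Suc k))" by simp
    then show ?thesis by (simp add: algebra_simps)
  qed
  also have "\<dots> \<le> 0" using assms by (intro mult_nonneg_nonpos[OF _ Suc]) linarith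
  finally show ?case unfolding mult_le_0_iff by linarith
qed (use assms in simp)

lemma radial_multiplier_binomial:
  assumes "0 < b" "b < 1" "0 < s"
  shows "(\<lambda>r. 1 - (1 - exp (- s * r)) powr b) \<in> radial_multiplier TYPE('a::euclidean_space)"
proof -
  define c where "c k = - ((-1) ^ Suc k * (b gchoose Suc k))" for k
  have c: "0 \<le> c k" for k
    using gbinomial_alternating_nonpos[OF assms(1,2), of k] by (simp add: c_def)
  have sums: "(\<lambda>k. c k * exp (- s * r) ^ Suc k) sums (1 - (1 - exp (- s * r)) powr b)" if "0 < r" for r
  proof -
    have "(\<lambda>n. (b gchoose n) * (- exp (- s * r)) ^ n) sums (1 + - exp (- s * r)) powr b"
      using that assms by (intro gen_binomial_real) auto
    then have "(\<lambda>n. (b gchoose Suc n) * (- exp (- s * r)) ^ Suc n) sums ((1 - exp (- s * r)) powr b - 1)"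
      by (subst sums_Suc_iff) simp
    from sums_minus[OF this] show ?thesis
      by (simp add: c_def power_minus[of "exp _"] mult_ac)
  qed
  show ?thesis
  proof (rule radial_multiplier_lim)
    show "(\<lambda>r. \<Sum>i<k. c i * exp (- s * r) ^ Suc i) \<in> radial_multiplier TYPE('a)" for k
      using assms by (intro radial_multiplier_sum radial_multiplier_scale radial_multiplier_power radial_multiplier_exp c) simp
    show "(\<lambda>k. \<Sum>i<k. c i * exp (- s * r) ^ Suc i) \<longlonglongrightarrow> 1 - (1 - exp (- s * r)) powr b" if "0 < r" for r
      using sums[OF that] by (simp add: sums_def)
    show "\<bar>\<Sum>i<k. c i * exp (- s * r) ^ Suc i\<bar> \<le> 1" if "0 < r" for k r
    proof -
      have "(\<Sum>i<k. c i * exp (- s * r) ^ Suc i) \<le> 1 - (1 - exp (- s * r)) powr b"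
        using sums[OF that] c by (intro sum_le_suminf[OF sums_summable, THEN order_trans]) (auto simp: sums_iff)
      moreover have "0 \<le> (\<Sum>i<k. c i * exp (- s * r) ^ Suc i)"
        using c by (intro sum_nonneg) auto
      ultimately show ?thesis by (smt (verit) powr_ge_zero)
    qed
  qed measurable
qed

text \<open>r^b is the limit of ((1 - exp (-sr)) / s)^b as s tends to 0, and by the binomial series
  1 - (1 - exp (-sr))^b is a positive combination of the Gaussian profiles exp (-ksr).\<close>

lemma radial_multiplier_stable:
  assumes "0 < b" "b \<le> 1" "0 \<le> t"
  shows "(\<lambda>r. exp (- t * r powr b)) \<in> radial_multiplier TYPE('a::euclidean_space)"
proof (cases "b = 1")
  case True
  show ?thesis
  proof (rule radial_multiplier_lim[where B = 1])
    show "(\<lambda>r. exp (- t * r)) \<in> radial_multiplier TYPE('a)" for k :: nat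
      using assms by (intro radial_multiplier_exp)
  qed (use True assms in auto)
next
  case False
  with assms have b: "b < 1" by simp
  define s where "s k = 1 / real (Suc k)" for k
  have s: "0 < s k" for k by (simp add: s_def)
  show ?thesis
  proof (rule radial_multiplier_lim)
    \<comment> \<open>The exponent - (t / s^b) (1 - e^(- s r))^b is split into a constant and a
      positive multiple of 1 - (1 - e^(- s r))^b, because multipliers may be scaled only by
      nonnegative numbers before \<open>exp\<close> is applied.\<close>
    show "(\<lambda>r. exp (- (t / s k powr b)) * exp ((t / s k powr b) * (1 - (1 - exp (- s k * r)) powr b)))
       \<in> radial_multiplier TYPE('a)" for k
      using assms b s by (intro radial_multiplier_scale radial_multiplier_exp_comp radial_multiplier_binomial) auto
    have eq: "exp (- (t / s k powr b)) * exp ((t / s k powr b) * (1 - (1 - exp (- s k * r)) powr b))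
       = exp (- t * ((1 - exp (- s k * r)) / s k) powr b)" if "0 < r" for k r
      using s[of k] that by (simp add: algebra_simps powr_divide flip: exp_add)
    show "\<bar>exp (- (t / s k powr b)) * exp ((t / s k powr b) * (1 - (1 - exp (- s k * r)) powr b))\<bar> \<le> 1"
      if "0 < r" for k r
      unfolding eq[OF that] using assms by simp
    show "(\<lambda>k. exp (- (t / s k powr b)) * exp ((t / s k powr b) * (1 - (1 - exp (- s k * r)) powr b)))
       \<longlonglongrightarrow> exp (- t * r powr b)" if "0 < r" for r
    proof -
      have "(\<lambda>k. (1 - exp (- s k * r)) / s k) \<longlonglongrightarrow> r"
        unfolding s_def using that by real_asymp
      then show ?thesis
        unfolding eq[OF that] using that by (intro tendsto_intros) auto
    qed
  qed measurable
qed

section \<open>Integrability of the symbols exp (- t |xi|^\<alpha>)\<close>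

lemma exp_powr_le_inverse_quadratic:
  fixes c a :: real
  assumes "0 < c" "0 < a"
  shows "\<exists>C>0. \<forall>s. exp (- c * \<bar>s\<bar> powr a) \<le> C * inverse (1 + s\<^sup>2)"
proof -
  have "((\<lambda>s. exp (- c * s powr a) * (1 + s\<^sup>2)) \<longlongrightarrow> 0) at_top"
    using assms by real_asymp
  then have "eventually (\<lambda>s. exp (- c * s powr a) * (1 + s\<^sup>2) < 1) at_top"
    by (rule order_tendstoD) simp
  then obtain S where S: "\<And>s. S \<le> s \<Longrightarrow> exp (- c * s powr a) * (1 + s\<^sup>2) < 1"
    by (auto simp: eventually_at_top_linorder)
  have "exp (- c * \<bar>s\<bar> powr a) \<le> (2 + S\<^sup>2) * inverse (1 + s\<^sup>2)" for s
  proof (cases "S \<le> \<bar>s\<bar>")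
    case True
    then have "exp (- c * \<bar>s\<bar> powr a) * (1 + s\<^sup>2) \<le> 2 + S\<^sup>2" using S[OF True] by (simp add: add_increasing2 less_imp_le)
    then show ?thesis by (subst divide_inverse[symmetric], subst pos_le_divide_eq) (auto simp: add_pos_nonneg)
  next
    case False
    have "s\<^sup>2 \<le> S\<^sup>2" using False by (simp add: abs_le_square_iff[symmetric])
    moreover have "exp (- c * \<bar>s\<bar> powr a) \<le> 1" using assms by simp
    ultimately have "exp (- c * \<bar>s\<bar> powr a) * (1 + s\<^sup>2) \<le> 1 * (2 + S\<^sup>2)" by (intro mult_mono) auto
    then show ?thesis by (subst divide_inverse[symmetric], subst pos_le_divide_eq) (auto simp: add_pos_nonneg)
  qed
  then show ?thesis by (intro exI[of _ "2 + S\<^sup>2"]) (auto simp: add_pos_nonneg)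
qed

lemma integrable_exp_powr_1d:
  fixes c a :: real
  assumes "0 < c" "0 < a"
  shows "integrable lborel (\<lambda>s. exp (- c * \<bar>s\<bar> powr a))"
proof -
  obtain C where C: "C > 0" "\<And>s. exp (- c * \<bar>s\<bar> powr a) \<le> C * inverse (1 + s\<^sup>2)"
    using exp_powr_le_inverse_quadratic[OF assms] by blast
  have "integrable lborel (\<lambda>s::real. inverse (1 + s\<^sup>2))"
    using integrable_inverse_1_plus_square by (simp add: set_integrable_def)
  from integrable_mult_right[OF this, of C] show ?thesis
    by (rule Bochner_Integration.integrable_bound) (use C in \<open>auto simp: abs_mult intro!: AE_I2 order_trans[OF C(2)]\<close>)
qed

text \<open>Each coordinate is at most the norm, so |xi|^a is at least the average of the a-th
  powers of the coordinates; the integrand is therefore below a product of integrable functions of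
  one variable.\<close>

lemma integrable_exp_norm_powr:
  fixes t a :: real
  assumes "0 < t" "0 < a"
  shows "integrable lborel (\<lambda>\<xi>::'a::euclidean_space. exp (- t * norm \<xi> powr a))"
proof (rule Bochner_Integration.integrable_bound)
  define n where "n = real DIM('a)"
  have n: "0 < n" by (simp add: n_def)
  show "integrable lborel (\<lambda>\<xi>::'a. \<Prod>b\<in>Basis. exp (- (t / n) * \<bar>\<xi> \<bullet> b\<bar> powr a))"
    using assms n by (intro lborel_integral_prod integrable_exp_powr_1d) auto
  show "AE \<xi> in lborel. norm (exp (- t * norm (\<xi>::'a) powr a)) \<le> norm (\<Prod>b\<in>Basis. exp (- (t / n) * \<bar>\<xi> \<bullet> b\<bar> powr a))"
  proof (rule AE_I2)
    fix \<xi> :: 'a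
    have "(\<Sum>b\<in>Basis. \<bar>\<xi> \<bullet> b\<bar> powr a) \<le> (\<Sum>b\<in>(Basis::'a set). norm \<xi> powr a)"
      using assms by (intro sum_mono powr_mono2) (auto simp: Basis_le_norm)
    then have "(t / n) * (\<Sum>b\<in>Basis. \<bar>\<xi> \<bullet> b\<bar> powr a) \<le> (t / n) * (n * norm \<xi> powr a)"
      using assms n by (intro mult_left_mono) (auto simp: n_def)
    also have "\<dots> = t * norm \<xi> powr a" using n by simp
    finally have "exp (- t * norm \<xi> powr a) \<le> exp (\<Sum>b\<in>Basis. - (t / n) * \<bar>\<xi> \<bullet> b\<bar> powr a)"
      by (simp add: sum_distrib_left sum_negf)
    also have "\<dots> = (\<Prod>b\<in>Basis. exp (- (t / n) * \<bar>\<xi> \<bullet> b\<bar> powr a))"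
      by (rule exp_sum) simp
    finally show "norm (exp (- t * norm \<xi> powr a)) \<le> norm (\<Prod>b\<in>Basis. exp (- (t / n) * \<bar>\<xi> \<bullet> b\<bar> powr a))"
      by simp
  qed
qed measurable

text \<open>A multiplier applied to the constant profile 1 is radially decreasing; the remaining
  Gaussian factor exp (- |xi|^2 / (k + 1)) is removed by dominated convergence. The profile involves
  r^(\<alpha>/2) since r stands for |xi|^2, and \<alpha> <= 2 is what keeps this exponent in the
  range b <= 1.\<close>

lemma cos_transform_stable_radial:
  fixes x :: "'a::euclidean_space"
  assumes "0 < t" "0 < \<alpha>" "\<alpha> \<le> 2" "1 \<le> a"
  shows "0 \<le> cos_transform (\<lambda>\<xi>. exp (- t * norm \<xi> powr \<alpha>)) (a *\<^sub>R x)"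
    and "cos_transform (\<lambda>\<xi>. exp (- t * norm \<xi> powr \<alpha>)) (a *\<^sub>R x) \<le> cos_transform (\<lambda>\<xi>. exp (- t * norm \<xi> powr \<alpha>)) x"
proof -
  define \<phi> where "\<phi> r = exp (- t * r powr (\<alpha> / 2))" for r
  have "\<phi> \<in> radial_multiplier TYPE('a)"
    unfolding \<phi>_def[abs_def] using assms by (intro radial_multiplier_stable) auto
  with radial_decreasing_1 have \<phi>: "\<phi> \<in> radial_decreasing TYPE('a)"
    unfolding radial_multiplier_def by fastforce
  then have [measurable]: "\<phi> \<in> borel_measurable borel" by (simp add: radial_decreasing_def tame_def)
  have \<phi>_eq: "\<phi> ((norm \<xi>)\<^sup>2) = exp (- t * norm \<xi> powr \<alpha>)" for \<xi> :: 'a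
    by (cases "\<xi> = 0") (simp_all add: \<phi>_def powr_powr flip: powr_numeral)
  have conv: "(\<lambda>k. cos_transform (radial (1 / real (Suc k)) \<phi>) x) \<longlonglongrightarrow> cos_transform (\<lambda>\<xi>. exp (- t * norm \<xi> powr \<alpha>)) x"
    for x :: 'a
    unfolding cos_transform_def
  proof (rule integral_dominated_convergence)
    show "integrable lborel (\<lambda>\<xi>::'a. exp (- t * norm \<xi> powr \<alpha>))"
      using assms by (intro integrable_exp_norm_powr)
    show "AE \<xi> in lborel. (\<lambda>k. cos (x \<bullet> \<xi>) * radial (1 / real (Suc k)) \<phi> \<xi>) \<longlonglongrightarrow> cos (x \<bullet> \<xi>) * exp (- t * norm \<xi> powr \<alpha>)"
    proof (rule AE_I2)
      fix \<xi> :: 'a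
      have "(\<lambda>k. exp (- (1 / real (Suc k)) * (norm \<xi>)\<^sup>2)) \<longlonglongrightarrow> 1"
        by real_asymp
      from tendsto_mult[OF tendsto_const[of "cos (x \<bullet> \<xi>)"] tendsto_mult[OF this tendsto_const]]
      show "(\<lambda>k. cos (x \<bullet> \<xi>) * radial (1 / real (Suc k)) \<phi> \<xi>) \<longlonglongrightarrow> cos (x \<bullet> \<xi>) * exp (- t * norm \<xi> powr \<alpha>)"
        unfolding radial_def \<phi>_eq by simp
    qed
    show "AE \<xi> in lborel. norm (cos (x \<bullet> \<xi>) * radial (1 / real (Suc k)) \<phi> \<xi>) \<le> exp (- t * norm \<xi> powr \<alpha>)" for k
    proof (rule AE_I2)
      fix \<xi> :: 'a
      have "\<bar>cos (x \<bullet> \<xi>)\<bar> * (exp (- (1 / real (Suc k)) * (norm \<xi>)\<^sup>2) * exp (- t * norm \<xi> powr \<alpha>)) \<le> 1 * (1 * exp (- t * norm \<xi> powr \<alpha>))"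
        by (intro mult_mono) auto
      then show "norm (cos (x \<bullet> \<xi>) * radial (1 / real (Suc k)) \<phi> \<xi>) \<le> exp (- t * norm \<xi> powr \<alpha>)"
        by (simp only: radial_def \<phi>_eq real_norm_def abs_mult abs_exp_cancel mult_1)
    qed
  qed measurable
  show "0 \<le> cos_transform (\<lambda>\<xi>. exp (- t * norm \<xi> powr \<alpha>)) (a *\<^sub>R x)"
    using \<phi> assms(4) by (intro LIMSEQ_le_const[OF conv]) (auto simp: radial_decreasing_def)
  show "cos_transform (\<lambda>\<xi>. exp (- t * norm \<xi> powr \<alpha>)) (a *\<^sub>R x) \<le> cos_transform (\<lambda>\<xi>. exp (- t * norm \<xi> powr \<alpha>)) x"
    using \<phi> assms(4) by (intro LIMSEQ_le[OF conv conv]) (auto simp: radial_decreasing_def)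
qed

text \<open>The classical heat kernel at time \<open>e\<close>, written as an inverse transform so
  that \<open>cos_transform_swap\<close> can move the transform onto the other factor.\<close>

definition gauss :: "real \<Rightarrow> 'a::euclidean_space \<Rightarrow> real" where
  "gauss e x = cos_transform (\<lambda>\<xi>. exp (- e * (norm \<xi>)\<^sup>2)) x / (2 * pi) ^ DIM('a)"

lemma gauss_eq: "0 < e \<Longrightarrow> gauss e x = (1 / sqrt (4 * pi * e)) ^ DIM('a) * exp (- (norm x)\<^sup>2 / (4 * e))"
  for x :: "'a::euclidean_space"
proof -
  assume e: "0 < e"
  have "sqrt (pi / e) / (2 * pi) = 1 / sqrt (4 * pi * e)"
  proof -
    have "sqrt (pi / e) * sqrt (4 * pi * e) = sqrt ((2 * pi)\<^sup>2)"
      using e unfolding real_sqrt_mult[symmetric] by (simp add: power2_eq_square)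
    then have "sqrt (pi / e) * sqrt (4 * pi * e) = 2 * pi" by (simp only: real_sqrt_abs) simp
    then show ?thesis using e by (simp add: field_simps)
  qed
  then have "sqrt (pi / e) ^ DIM('a) / (2 * pi) ^ DIM('a) = (1 / sqrt (4 * pi * e)) ^ DIM('a)"
    unfolding power_divide[symmetric] by simp
  then show ?thesis
    unfolding gauss_def gaussian_cos_transform(2)[OF e] by (simp flip: times_divide_eq_left)
qed

lemma gauss_nonneg: "0 < e \<Longrightarrow> 0 \<le> gauss e x"
  by (simp add: gauss_eq)

lemma gauss_le: "0 < e \<Longrightarrow> gauss e x \<le> gauss e (0 :: 'a)" for x :: "'a::euclidean_space"
  by (auto simp: gauss_eq intro!: mult_left_le)

lemma gauss_measurable [measurable]: "0 < e \<Longrightarrow> (gauss e :: 'a::euclidean_space \<Rightarrow> real) \<in> borel_measurable borel"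
proof -
  assume "0 < e"
  then have "gauss e = (\<lambda>x::'a. (1 / sqrt (4 * pi * e)) ^ DIM('a) * exp (- (norm x)\<^sup>2 / (4 * e)))"
    by (simp add: gauss_eq fun_eq_iff)
  then show ?thesis by simp
qed

lemma gauss_integral:
  assumes "0 < e"
  shows "integrable lborel (gauss e :: 'a::euclidean_space \<Rightarrow> real)" "integral\<^sup>L lborel (gauss e :: 'a \<Rightarrow> real) = 1"
proof -
  define d where "d = 1 / (4 * e)"
  have d: "0 < d" using assms by (simp add: d_def)
  have g: "gauss e = (\<lambda>x::'a. (1 / sqrt (4 * pi * e)) ^ DIM('a) * exp (- d * (norm x)\<^sup>2))"
    using assms by (auto simp: gauss_eq d_def)
  show "integrable lborel (gauss e :: 'a \<Rightarrow> real)"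
    unfolding g by (intro integrable_mult_right gaussian_cos_transform d)
  have "sqrt (pi / d) = sqrt (4 * pi * e)" by (simp add: d_def)
  then have "(1 / sqrt (4 * pi * e)) ^ DIM('a) * sqrt (pi / d) ^ DIM('a) = 1"
    using assms by (simp flip: power_mult_distrib)
  then show "integral\<^sup>L lborel (gauss e :: 'a \<Rightarrow> real) = 1"
    using gaussian_cos_transform(2)[OF d, of "0::'a"] unfolding g by (simp add: cos_transform_def)
qed

lemma lborel_integral_affine:
  fixes h :: "'a::euclidean_space \<Rightarrow> real"
  assumes "c \<noteq> 0" "h \<in> borel_measurable borel"
  shows "(\<integral>x. h x \<partial>lborel) = \<bar>c\<bar> ^ DIM('a) * (\<integral>x. h (z + c *\<^sub>R x) \<partial>lborel)"
    and "integrable lborel h \<Longrightarrow> integrable lborel (\<lambda>x. h (z + c *\<^sub>R x))"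
proof -
  have m: "(\<lambda>x::'a. z + c *\<^sub>R x) \<in> measurable lborel borel" by measurable
  have [measurable]: "h \<in> borel_measurable borel" by (rule assms)
  have L: "lborel = density (distr lborel borel (\<lambda>x::'a. z + c *\<^sub>R x)) (\<lambda>_. ennreal (\<bar>c\<bar> ^ DIM('a)))"
    using lborel_affine[of c z] assms(1) by simp
  show "(\<integral>x. h x \<partial>lborel) = \<bar>c\<bar> ^ DIM('a) * (\<integral>x. h (z + c *\<^sub>R x) \<partial>lborel)"
    using assms(1) by (subst L) (simp add: integral_density integral_distr)
  assume "integrable lborel h"
  then have "integrable (density (distr lborel borel (\<lambda>x::'a. z + c *\<^sub>R x)) (\<lambda>_. ennreal (\<bar>c\<bar> ^ DIM('a)))) h"
    by (simp flip: L)
  then show "integrable lborel (\<lambda>x. h (z + c *\<^sub>R x))"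
    using assms(1) by (simp add: integrable_density integrable_distr_eq)
qed

lemma gauss_scale:
  assumes "0 < s"
  shows "s ^ DIM('a) * gauss (s\<^sup>2) (s *\<^sub>R w) = gauss 1 (w :: 'a::euclidean_space)"
  using assms
  by (simp add: gauss_eq real_sqrt_mult power_mult_distrib power_divide field_simps)

text \<open>As \<open>h\<close> may be unbounded, it is split at a distance from z within which it
  differs from h z by less than 1. The near part is bounded, so dominated convergence applies after
  rescaling; the far part is at most a bound of the Gaussian outside the ball times the L1 norm of
  \<open>h\<close>.\<close>

lemma gauss_approximation:
  fixes h :: "'a::euclidean_space \<Rightarrow> real"
  assumes h: "integrable lborel h" and cont: "isCont h z"
  shows "(\<lambda>k. \<integral>x. h x * gauss ((1 / real (Suc k))\<^sup>2) (x - z) \<partial>lborel) \<longlonglongrightarrow> h z"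
proof -
  define s where "s k = 1 / real (Suc k)" for k
  have s: "0 < s k" for k by (simp add: s_def)
  have s2: "0 < (s k)\<^sup>2" for k using s[of k] by simp
  have [measurable]: "gauss ((s k)\<^sup>2) \<in> borel_measurable (borel :: 'a measure)" "gauss 1 \<in> borel_measurable (borel :: 'a measure)" for k
    using s2 by (auto intro: gauss_measurable)
  have [measurable]: "h \<in> borel_measurable borel" using h borel_measurable_integrable by force
  obtain \<delta> where \<delta>: "\<delta> > 0" "\<And>x. dist x z < \<delta> \<Longrightarrow> dist (h x) (h z) < 1"
    using cont unfolding continuous_at_eps_delta by (metis zero_less_one)
  define near where "near x = h x * indicator (ball z \<delta>) x" for x
  define far where "far x = h x * indicator (- ball z \<delta>) x" for x
  have [measurable]: "near \<in> borel_measurable borel" "far \<in> borel_measurable borel"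
    unfolding near_def far_def by (auto intro!: borel_measurable_times borel_measurable_indicator)
  have split: "h x = near x + far x" for x by (simp add: near_def far_def split: split_indicator)
  have int: "integrable lborel near" "integrable lborel far"
  proof -
    have "integrable lborel (\<lambda>x. h x * indicator A x)" if "A \<in> sets borel" for A
      using integrable_mult_indicator[OF _ h, of A] that by (simp add: mult.commute)
    then show "integrable lborel near" "integrable lborel far"
      unfolding near_def far_def by auto
  qed
  have intg: "integrable lborel (\<lambda>x. g x * gauss ((s k)\<^sup>2) (x - z))" if "integrable lborel g" for g :: "'a \<Rightarrow> real" and k
  proof (rule Bochner_Integration.integrable_bound)
    show "integrable lborel (\<lambda>x. gauss ((s k)\<^sup>2) (0::'a) * g x)" using that by simp
    have [measurable]: "g \<in> borel_measurable borel" using that borel_measurable_integrable by force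
    show "(\<lambda>x. g x * gauss ((s k)\<^sup>2) (x - z)) \<in> borel_measurable lborel"
      by measurable
    show "AE x in lborel. norm (g x * gauss ((s k)\<^sup>2) (x - z)) \<le> norm (gauss ((s k)\<^sup>2) (0::'a) * g x)"
    proof (rule AE_I2)
      fix x
      show "norm (g x * gauss ((s k)\<^sup>2) (x - z)) \<le> norm (gauss ((s k)\<^sup>2) (0::'a) * g x)"
        using gauss_le[OF s2, of k "x - z"] gauss_nonneg[OF s2, of k "x - z"] gauss_nonneg[OF s2, of k "0::'a"]
        by (simp add: abs_mult mult.commute[of "\<bar>g _\<bar>"] mult_right_mono)
    qed
  qed
  have A: "(\<lambda>k. \<integral>x. near x * gauss ((s k)\<^sup>2) (x - z) \<partial>lborel) \<longlonglongrightarrow> h z"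
  proof -
    have eq: "(\<integral>x. near x * gauss ((s k)\<^sup>2) (x - z) \<partial>lborel) = (\<integral>w. near (z + s k *\<^sub>R w) * gauss 1 w \<partial>lborel)" for k
      unfolding gauss_scale[OF s[of k], symmetric]
      using s[of k] by (subst lborel_integral_affine(1)[of "s k" _ z]) (simp_all add: mult_ac)
    have "(\<lambda>k. \<integral>w. near (z + s k *\<^sub>R w) * gauss 1 w \<partial>lborel) \<longlonglongrightarrow> (\<integral>w. h z * gauss 1 (w::'a) \<partial>lborel)"
    proof (rule integral_dominated_convergence)
      show "integrable lborel (\<lambda>w::'a. (\<bar>h z\<bar> + 1) * gauss 1 w)"
        by (intro integrable_mult_right gauss_integral) simp
      show "AE w in lborel. (\<lambda>k. near (z + s k *\<^sub>R w) * gauss 1 w) \<longlonglongrightarrow> h z * gauss 1 w"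
      proof (intro AE_I2 tendsto_mult tendsto_const)
        fix w :: 'a
        have s0: "s \<longlonglongrightarrow> 0" unfolding s_def by real_asymp
        have lim: "(\<lambda>k. z + s k *\<^sub>R w) \<longlonglongrightarrow> z"
          using tendsto_add[OF tendsto_const[of z] tendsto_scaleR[OF s0 tendsto_const[of w]]] by simp
        have "(\<lambda>k. h (z + s k *\<^sub>R w)) \<longlonglongrightarrow> h z"
          using isCont_tendsto_compose[OF cont lim] .
        moreover have "eventually (\<lambda>k. z + s k *\<^sub>R w \<in> ball z \<delta>) sequentially"
          by (rule topological_tendstoD[OF lim]) (use \<delta> in auto)
        then have "eventually (\<lambda>k. h (z + s k *\<^sub>R w) = near (z + s k *\<^sub>R w)) sequentially"
          by eventually_elim (simp add: near_def)
        ultimately show "(\<lambda>k. near (z + s k *\<^sub>R w)) \<longlonglongrightarrow> h z"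
          by (rule Lim_transform_eventually)
      qed
      have nb: "\<bar>near x\<bar> \<le> \<bar>h z\<bar> + 1" for x
        using \<delta>(2)[of x] by (auto simp: near_def dist_commute dist_real_def split: split_indicator)
      show "AE w in lborel. norm (near (z + s k *\<^sub>R w) * gauss 1 w) \<le> (\<bar>h z\<bar> + 1) * gauss 1 w" for k
        using nb gauss_nonneg[OF zero_less_one, where 'a = 'a] by (auto simp: abs_mult intro!: AE_I2 mult_right_mono)
    qed measurable
    then show ?thesis unfolding eq by (simp add: gauss_integral)
  qed
  have B: "(\<lambda>k. \<integral>x. far x * gauss ((s k)\<^sup>2) (x - z) \<partial>lborel) \<longlonglongrightarrow> 0"
  proof (rule tendsto_0_le[where K = 1])
    define C where "C k = (1 / sqrt (4 * pi * (s k)\<^sup>2)) ^ DIM('a) * exp (- \<delta>\<^sup>2 / (4 * (s k)\<^sup>2))" for k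
    have "C = (\<lambda>k. (real (Suc k) / sqrt (4 * pi)) ^ DIM('a) * exp (- (\<delta>\<^sup>2 / 4) * (real (Suc k))\<^sup>2))"
    proof
      fix k
      have "1 / sqrt (4 * pi * (s k)\<^sup>2) = real (Suc k) / sqrt (4 * pi)"
        by (simp add: real_sqrt_mult s_def)
      moreover have "- \<delta>\<^sup>2 / (4 * (s k)\<^sup>2) = - (\<delta>\<^sup>2 / 4) * (real (Suc k))\<^sup>2"
        by (simp add: s_def power_divide)
      ultimately show "C k = (real (Suc k) / sqrt (4 * pi)) ^ DIM('a) * exp (- (\<delta>\<^sup>2 / 4) * (real (Suc k))\<^sup>2)"
        by (simp only: C_def)
    qed
    moreover have "(\<lambda>k. (real (Suc k) / sqrt (4 * pi)) ^ DIM('a) * exp (- (\<delta>\<^sup>2 / 4) * (real (Suc k))\<^sup>2)) \<longlonglongrightarrow> 0"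
    proof -
      have "0 < \<delta>\<^sup>2 / 4" "0 < sqrt (4 * pi)" using \<delta> by auto
      then show ?thesis unfolding power_divide by real_asymp
    qed
    ultimately have "C \<longlonglongrightarrow> 0" by simp
    then show "(\<lambda>k. C k * (\<integral>x. \<bar>h x\<bar> \<partial>lborel)) \<longlonglongrightarrow> 0"
      by (rule tendsto_mult_left_zero)
    have C: "gauss ((s k)\<^sup>2) (x - z) \<le> C k" if "x \<notin> ball z \<delta>" for x k
    proof -
      have "\<delta>\<^sup>2 \<le> (norm (x - z))\<^sup>2"
        using that \<delta>(1) by (intro power_mono) (auto simp: dist_norm norm_minus_commute)
      then show ?thesis
        unfolding gauss_eq[OF s2] C_def using s[of k] by (intro mult_left_mono) (auto intro!: divide_right_mono)
    qed
    have C0: "0 \<le> C k" for k using s[of k] by (simp add: C_def)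
    have "norm (\<integral>x. far x * gauss ((s k)\<^sup>2) (x - z) \<partial>lborel) \<le> (\<integral>x. norm (far x * gauss ((s k)\<^sup>2) (x - z)) \<partial>lborel)" for k
      by (rule integral_norm_bound)
    also have "\<dots> k \<le> (\<integral>x. C k * \<bar>h x\<bar> \<partial>lborel)" for k
    proof (rule integral_mono)
      show "integrable lborel (\<lambda>x. norm (far x * gauss ((s k)\<^sup>2) (x - z)))"
        using intg[OF int(2), of k] by (rule integrable_norm)
      show "integrable lborel (\<lambda>x. C k * \<bar>h x\<bar>)" using h by simp
      show "norm (far x * gauss ((s k)\<^sup>2) (x - z)) \<le> C k * \<bar>h x\<bar>" for x
        using C[of x k] gauss_nonneg[OF s2, of k "x - z"] C0[of k]
        by (auto simp: far_def abs_mult mult.commute[of "\<bar>h x\<bar>"] intro!: mult_right_mono split: split_indicator)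
    qed
    finally show "\<forall>\<^sub>F k in sequentially. norm (\<integral>x. far x * gauss ((s k)\<^sup>2) (x - z) \<partial>lborel)
        \<le> norm (C k * (\<integral>x. \<bar>h x\<bar> \<partial>lborel)) * 1"
      using C0 by (simp add: abs_mult)
  qed
  have "(\<lambda>k. \<integral>x. h x * gauss ((s k)\<^sup>2) (x - z) \<partial>lborel) =
     (\<lambda>k. (\<integral>x. near x * gauss ((s k)\<^sup>2) (x - z) \<partial>lborel) + (\<integral>x. far x * gauss ((s k)\<^sup>2) (x - z) \<partial>lborel))"
    unfolding split distrib_right by (subst Bochner_Integration.integral_add[OF intg[OF int(1)] intg[OF int(2)]]) simp
  with tendsto_add[OF A B] show ?thesis by (simp add: s_def)
qed

section \<open>The fractional heat kernel\<close>

text \<open>The Fourier inversion formula for the symbol of the fractional heat equation;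
  \<open>heat_kernel_eq_stable_kernel\<close> identifies it with the kernel defined by
  \<open>THE\<close>.\<close>

definition stable_kernel :: "real \<Rightarrow> real \<Rightarrow> 'a::euclidean_space \<Rightarrow> real" where
  "stable_kernel \<alpha> t x = cos_transform (\<lambda>\<xi>. exp (- t * norm \<xi> powr \<alpha>)) x / (2 * pi) ^ DIM('a)"

lemma cos_transform_continuous:
  fixes h :: "'a::euclidean_space \<Rightarrow> real"
  assumes "integrable lborel h"
  shows "continuous_on UNIV (cos_transform h)"
proof (unfold continuous_on_sequentially, intro allI ballI impI, elim conjE)
  fix x :: "nat \<Rightarrow> 'a" and a assume lim: "x \<longlonglongrightarrow> a"
  have [measurable]: "h \<in> borel_measurable borel" using assms borel_measurable_integrable by force
  show "(cos_transform h \<circ> x) \<longlonglongrightarrow> cos_transform h a"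
    unfolding cos_transform_def o_def
  proof (rule integral_dominated_convergence)
    show "integrable lborel (\<lambda>\<xi>. \<bar>h \<xi>\<bar>)" using assms by simp
    show "AE \<xi> in lborel. (\<lambda>k. cos (x k \<bullet> \<xi>) * h \<xi>) \<longlonglongrightarrow> cos (a \<bullet> \<xi>) * h \<xi>"
      by (intro AE_I2 tendsto_intros lim)
    show "AE \<xi> in lborel. norm (cos (x k \<bullet> \<xi>) * h \<xi>) \<le> \<bar>h \<xi>\<bar>" for k
      by (auto simp: abs_mult intro!: AE_I2 mult_left_le_one_le)
  qed measurable
qed

lemma cos_transform_abs_le:
  fixes h :: "'a::euclidean_space \<Rightarrow> real"
  assumes "integrable lborel h"
  shows "\<bar>cos_transform h x\<bar> \<le> (\<integral>\<xi>. \<bar>h \<xi>\<bar> \<partial>lborel)"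
proof -
  have [measurable]: "h \<in> borel_measurable borel" using assms borel_measurable_integrable by force
  have "norm (cos_transform h x) \<le> (\<integral>\<xi>. norm (cos (x \<bullet> \<xi>) * h \<xi>) \<partial>lborel)"
    unfolding cos_transform_def by (rule integral_norm_bound)
  also have "\<dots> \<le> (\<integral>\<xi>. \<bar>h \<xi>\<bar> \<partial>lborel)"
  proof (rule integral_mono')
    show "integrable lborel (\<lambda>\<xi>. \<bar>h \<xi>\<bar>)" using assms by simp
  qed (auto simp: abs_mult intro!: mult_left_le_one_le)
  finally show ?thesis by simp
qed

lemma cos_transform_uminus: "cos_transform h (- x) = cos_transform h x"
  by (simp add: cos_transform_def)

text \<open>This multiplication formula is Fubini's theorem, with |g| |h| as integrable majorant. It
  moves the transform from \<open>h\<close> to \<open>g\<close>, which serves for uniqueness,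
  inversion and the semigroup law alike.\<close>

lemma cos_transform_swap:
  fixes h g :: "'a::euclidean_space \<Rightarrow> real"
  assumes h: "integrable lborel h" and g: "integrable lborel g"
  shows "(\<integral>x. g x * cos_transform h (x - z) \<partial>lborel)
    = (\<integral>\<xi>. h \<xi> * (\<integral>x. g x * cos ((x - z) \<bullet> \<xi>) \<partial>lborel) \<partial>lborel)"
proof -
  have [measurable]: "h \<in> borel_measurable borel" "g \<in> borel_measurable borel"
    using h g borel_measurable_integrable by force+
  have int: "integrable (lborel \<Otimes>\<^sub>M lborel) (\<lambda>(x, \<xi>). g x * (cos ((x - z) \<bullet> \<xi>) * h \<xi>))"
  proof (rule Bochner_Integration.integrable_bound)
    show "integrable (lborel \<Otimes>\<^sub>M lborel) (\<lambda>(x, \<xi>). g x * h \<xi>)"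
      using g h by (intro lborel_pair.Fubini_integrable) (simp_all add: abs_mult)
    show "AE p in lborel \<Otimes>\<^sub>M lborel. norm (case p of (x, \<xi>) \<Rightarrow> g x * (cos ((x - z) \<bullet> \<xi>) * h \<xi>)) \<le> norm (case p of (x, \<xi>) \<Rightarrow> g x * h \<xi>)"
      by (auto simp: abs_mult intro!: AE_I2 mult_left_mono mult_left_le_one_le)
  qed measurable
  have "(\<integral>x. g x * cos_transform h (x - z) \<partial>lborel) = (\<integral>x. (\<integral>\<xi>. g x * (cos ((x - z) \<bullet> \<xi>) * h \<xi>) \<partial>lborel) \<partial>lborel)"
    by (simp add: cos_transform_def)
  also have "\<dots> = (\<integral>\<xi>. (\<integral>x. g x * (cos ((x - z) \<bullet> \<xi>) * h \<xi>) \<partial>lborel) \<partial>lborel)"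
    using lborel_pair.Fubini_integral[OF int] by simp
  also have "\<dots> = (\<integral>\<xi>. (\<integral>x. h \<xi> * (g x * cos ((x - z) \<bullet> \<xi>)) \<partial>lborel) \<partial>lborel)"
    by (simp add: mult_ac)
  finally show ?thesis by simp
qed

text \<open>Injectivity of the Fourier transform: a Gaussian centred at z is itself a cosine
  transform, so its pairing with \<open>d\<close> vanishes by \<open>cos_transform_swap\<close>,
  while shrinking Gaussians recover d z.\<close>

lemma continuous_integrable_eq_0I:
  fixes d :: "'a::euclidean_space \<Rightarrow> real"
  assumes d: "integrable lborel d" and cont: "continuous_on UNIV d"
    and c: "\<And>\<xi>. (\<integral>x. d x * cos (x \<bullet> \<xi>) \<partial>lborel) = 0" and s: "\<And>\<xi>. (\<integral>x. d x * sin (x \<bullet> \<xi>) \<partial>lborel) = 0"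
  shows "d z = 0"
proof -
  have [measurable]: "d \<in> borel_measurable borel" using d borel_measurable_integrable by force
  have int: "integrable lborel (\<lambda>x. d x * cos (x \<bullet> \<xi>))" "integrable lborel (\<lambda>x. d x * sin (x \<bullet> \<xi>))" for \<xi>
    by (rule Bochner_Integration.integrable_bound[OF d]; force simp: abs_mult intro!: mult_right_le_one_le AE_I2)+
  have z: "(\<integral>x. d x * cos ((x - z) \<bullet> \<xi>) \<partial>lborel) = 0" for \<xi>
  proof -
    have eq: "d x * cos ((x - z) \<bullet> \<xi>) = cos (z \<bullet> \<xi>) * (d x * cos (x \<bullet> \<xi>)) + sin (z \<bullet> \<xi>) * (d x * sin (x \<bullet> \<xi>))" for x
      by (simp add: inner_diff_left cos_diff algebra_simps)
    show ?thesis unfolding eq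
      by (subst Bochner_Integration.integral_add) (auto intro!: integrable_mult_right int simp: c s)
  qed
  have "(\<integral>x. d x * gauss ((1 / real (Suc k))\<^sup>2) (x - z) \<partial>lborel) = 0" for k
  proof -
    define e where "e = (1 / real (Suc k))\<^sup>2"
    have e: "0 < e" by (simp add: e_def)
    have "(\<integral>x. d x * gauss e (x - z) \<partial>lborel) = (\<integral>x. d x * cos_transform (\<lambda>\<xi>. exp (- e * (norm \<xi>)\<^sup>2)) (x - z) \<partial>lborel) / (2 * pi) ^ DIM('a)"
      unfolding gauss_def times_divide_eq_right by simp
    also have "\<dots> = 0"
      by (subst cos_transform_swap[OF gaussian_cos_transform(1)[OF e] d]) (simp add: z)
    finally show ?thesis by (simp add: e_def)
  qed
  moreover have "(\<lambda>k. \<integral>x. d x * gauss ((1 / real (Suc k))\<^sup>2) (x - z) \<partial>lborel) \<longlonglongrightarrow> d z"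
    using cont by (intro gauss_approximation d) (simp add: continuous_on_eq_continuous_at)
  ultimately show ?thesis by (simp add: LIMSEQ_const_iff)
qed

lemma fourier_eq_cos_sin:
  fixes k :: "real^'n \<Rightarrow> real"
  assumes [measurable]: "k \<in> borel_measurable borel" and int: "integrable lborel k"
  shows "fourier k \<xi> = Complex (\<integral>x. k x * cos (x \<bullet> \<xi>) \<partial>lborel) (- (\<integral>x. k x * sin (x \<bullet> \<xi>) \<partial>lborel))"
proof -
  have re: "Re (exp (- \<i> * complex_of_real (x \<bullet> \<xi>)) * complex_of_real (k x)) = k x * cos (x \<bullet> \<xi>)"
    and im: "Im (exp (- \<i> * complex_of_real (x \<bullet> \<xi>)) * complex_of_real (k x)) = - (k x * sin (x \<bullet> \<xi>))" for x
    by (simp_all add: Re_exp Im_exp mult.commute)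
  have i: "complex_integrable lborel (\<lambda>x. exp (- \<i> * complex_of_real (x \<bullet> \<xi>)) * complex_of_real (k x))"
    by (rule Bochner_Integration.integrable_bound[OF int]) (auto simp: norm_mult)
  have "fourier k \<xi> = (\<integral>x. exp (- \<i> * complex_of_real (x \<bullet> \<xi>)) * complex_of_real (k x) \<partial>lborel)"
    unfolding fourier_def by (rule integral_completion) measurable
  then show ?thesis
    using integral_Re[OF i, unfolded re] integral_Im[OF i, unfolded im] by (simp add: complex_eq_iff)
qed

context
  fixes \<alpha> :: real
  assumes \<alpha>: "0 < \<alpha>" "\<alpha> \<le> 2"
begin

lemma stable_kernel_nonneg: "0 < t \<Longrightarrow> 0 \<le> stable_kernel \<alpha> t x"
  using cos_transform_stable_radial(1)[of t \<alpha> 1 x] \<alpha> by (simp add: stable_kernel_def)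

lemma stable_kernel_radial_decreasing:
  "0 < t \<Longrightarrow> 1 \<le> a \<Longrightarrow> stable_kernel \<alpha> t (a *\<^sub>R x) \<le> stable_kernel \<alpha> t x"
  using cos_transform_stable_radial(2)[of t \<alpha> a x] \<alpha> by (simp add: stable_kernel_def divide_right_mono)

lemma stable_kernel_uminus: "stable_kernel \<alpha> t (- x) = stable_kernel \<alpha> t x"
  by (simp add: stable_kernel_def cos_transform_uminus)

lemma stable_kernel_continuous: "0 < t \<Longrightarrow> continuous_on UNIV (stable_kernel \<alpha> t :: 'a::euclidean_space \<Rightarrow> real)"
  unfolding stable_kernel_def[abs_def] using \<alpha>
  by (intro continuous_intros cos_transform_continuous integrable_exp_norm_powr) auto

text \<open>Joint measurability in time and space is what Tonelli's theorem asks for in the Duhamel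
  term.\<close>

lemma stable_kernel_measurable [measurable]:
  "(\<lambda>p. stable_kernel \<alpha> (fst p) (snd p :: 'a::euclidean_space)) \<in> borel_measurable borel"
  unfolding stable_kernel_def[abs_def] cos_transform_def borel_prod[symmetric] by measurable

lemma stable_kernel_scaling:
  fixes x :: "'a::euclidean_space"
  assumes "0 < t"
  shows "stable_kernel \<alpha> t x = t powr (- real DIM('a) / \<alpha>) * stable_kernel \<alpha> 1 (t powr (- 1 / \<alpha>) *\<^sub>R x)"
proof -
  \<comment> \<open>The scale with t c^\<alpha> = 1, which turns the symbol at time t into the one
    at time 1.\<close>
  define c where "c = t powr (- 1 / \<alpha>)"
  have c: "0 < c" using assms by (simp add: c_def)
  have ct: "t * c powr \<alpha> = 1" using assms \<alpha> unfolding c_def by (subst powr_powr) (simp add: powr_minus_divide)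
  have "cos_transform (\<lambda>\<xi>. exp (- t * norm \<xi> powr \<alpha>)) x
      = c ^ DIM('a) * (\<integral>\<xi>. cos (x \<bullet> (0 + c *\<^sub>R \<xi>)) * exp (- t * norm (0 + c *\<^sub>R \<xi>) powr \<alpha>) \<partial>lborel)"
    unfolding cos_transform_def using lborel_integral_affine(1)[of c "\<lambda>\<xi>. cos (x \<bullet> \<xi>) * exp (- t * norm \<xi> powr \<alpha>)" 0] c by simp
  also have "(\<lambda>\<xi>. exp (- t * norm (0 + c *\<^sub>R \<xi>) powr \<alpha>)) = (\<lambda>\<xi>::'a. exp (- 1 * norm \<xi> powr \<alpha>))"
    using c ct by (simp add: powr_mult fun_eq_iff)
  finally have "cos_transform (\<lambda>\<xi>. exp (- t * norm \<xi> powr \<alpha>)) x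
      = c ^ DIM('a) * cos_transform (\<lambda>\<xi>. exp (- 1 * norm \<xi> powr \<alpha>)) (c *\<^sub>R x)"
    by (simp add: cos_transform_def)
  moreover have "c ^ DIM('a) = t powr (- real DIM('a) / \<alpha>)"
    using c unfolding c_def by (simp add: powr_powr flip: powr_realpow)
  ultimately show ?thesis by (simp add: stable_kernel_def c_def)
qed

text \<open>K(1,0) is a positive multiple of the integral of a positive function. Positivity at the
  origin is enough for later: by scaling, K(t,x) = t^-p K(1, t^(-1/\<alpha>) x), and for fixed x
  this argument tends to the origin as t grows.\<close>

lemma stable_kernel_0_pos: "0 < stable_kernel \<alpha> 1 (0 :: 'a::euclidean_space)"
proof -
  have int: "integrable lborel (\<lambda>\<xi>::'a. exp (- 1 * norm \<xi> powr \<alpha>))"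
    using \<alpha> by (intro integrable_exp_norm_powr) auto
  have "\<not> (AE \<xi> in lborel. exp (- 1 * norm (\<xi>::'a) powr \<alpha>) = 0)"
    using ae_filter_eq_bot_iff[of "lborel :: 'a measure"] by (auto simp: eventually_False)
  then have "0 < (\<integral>\<xi>. exp (- 1 * norm \<xi> powr \<alpha>) \<partial>(lborel :: 'a measure))"
    using integral_nonneg_eq_0_iff_AE[OF int] by (simp add: less_le)
  then show ?thesis by (simp add: stable_kernel_def cos_transform_def)
qed

lemma stable_kernel_le: 
  fixes x :: "'a::euclidean_space"
  assumes "0 < t"
  shows "stable_kernel \<alpha> t x \<le> t powr (- real DIM('a) / \<alpha>) * stable_kernel \<alpha> 1 (0::'a)"
proof -
  have int: "integrable lborel (\<lambda>\<xi>::'a. exp (- 1 * norm \<xi> powr \<alpha>))"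
    using \<alpha> by (intro integrable_exp_norm_powr) auto
  have "cos_transform (\<lambda>\<xi>::'a. exp (- 1 * norm \<xi> powr \<alpha>)) y \<le> cos_transform (\<lambda>\<xi>. exp (- 1 * norm \<xi> powr \<alpha>)) (0::'a)" for y :: 'a
    using abs_le_D1[OF cos_transform_abs_le[OF int, of y]] by (simp add: cos_transform_def)
  then have "stable_kernel \<alpha> 1 y \<le> stable_kernel \<alpha> 1 (0::'a)" for y :: 'a
    by (simp add: stable_kernel_def divide_right_mono)
  then show ?thesis unfolding stable_kernel_scaling[OF assms, of x] by (intro mult_left_mono) auto
qed

text \<open>By scaling, t^p K(t,x) = K(1, t^(-1/\<alpha>) x) with p = n/\<alpha>; as t grows the
  argument moves along its ray towards the origin, where K is larger.\<close>

lemma stable_kernel_time_mono: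
  fixes x :: "'a::euclidean_space"
  assumes "0 < s" "s \<le> t"
  shows "(s / t) powr (real DIM('a) / \<alpha>) * stable_kernel \<alpha> s x \<le> stable_kernel \<alpha> t x"
proof -
  define a where "a = (t / s) powr (1 / \<alpha>)"
  have a: "1 \<le> a" using assms \<alpha> by (auto simp: a_def intro!: ge_one_powr_ge_zero)
  have "stable_kernel \<alpha> 1 (s powr (- 1 / \<alpha>) *\<^sub>R x) = stable_kernel \<alpha> 1 (a *\<^sub>R (t powr (- 1 / \<alpha>) *\<^sub>R x))"
    using assms \<alpha> by (simp add: a_def powr_divide powr_minus_divide)
  also have "\<dots> \<le> stable_kernel \<alpha> 1 (t powr (- 1 / \<alpha>) *\<^sub>R x)"
    by (intro stable_kernel_radial_decreasing a) simp
  finally have *: "stable_kernel \<alpha> 1 (s powr (- 1 / \<alpha>) *\<^sub>R x) \<le> stable_kernel \<alpha> 1 (t powr (- 1 / \<alpha>) *\<^sub>R x)" .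
  have "(s / t) powr (real DIM('a) / \<alpha>) * stable_kernel \<alpha> s x
     = t powr (- real DIM('a) / \<alpha>) * stable_kernel \<alpha> 1 (s powr (- 1 / \<alpha>) *\<^sub>R x)"
    using assms unfolding stable_kernel_scaling[OF assms(1), of x] by (simp add: powr_divide powr_minus_divide)
  also have "\<dots> \<le> t powr (- real DIM('a) / \<alpha>) * stable_kernel \<alpha> 1 (t powr (- 1 / \<alpha>) *\<^sub>R x)"
    by (intro mult_left_mono *) auto
  also have "\<dots> = stable_kernel \<alpha> t x"
    using assms by (subst stable_kernel_scaling[of t x]) auto
  finally show ?thesis .
qed

text \<open>Fourier inversion, with integrability of K still to be found. Damped by Gaussians, the
  integrals of K against cosines are Gaussian averages of the symbol and converge to it. At
  frequency 0, nonnegativity of K and Fatou's lemma turn this into integrability, after which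
  dominated convergence removes the damping at every frequency.\<close>

lemma stable_kernel_transform:
  fixes \<eta> :: "'a::euclidean_space"
  assumes t: "0 < t"
  shows "integrable lborel (stable_kernel \<alpha> t :: 'a \<Rightarrow> real)"
    and "(\<integral>x. stable_kernel \<alpha> t x * cos (x \<bullet> \<eta>) \<partial>lborel) = exp (- t * norm \<eta> powr \<alpha>)"
    and "(\<integral>x. stable_kernel \<alpha> t x * sin (x \<bullet> \<eta>) \<partial>lborel) = 0"
proof -
  define \<psi> where "\<psi> \<xi> = exp (- t * norm \<xi> powr \<alpha>)" for \<xi> :: 'a
  have \<psi>: "integrable lborel \<psi>"
    unfolding \<psi>_def using t \<alpha> by (intro integrable_exp_norm_powr)
  have cont\<psi>: "isCont \<psi> \<xi>" for \<xi>
    unfolding \<psi>_def by (intro continuous_intros) (use \<alpha> in auto)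
  define K where "K = (stable_kernel \<alpha> t :: 'a \<Rightarrow> real)"
  have K: "K x = cos_transform \<psi> x / (2 * pi) ^ DIM('a)" for x
    by (simp add: K_def stable_kernel_def \<psi>_def[abs_def])
  have K0: "0 \<le> K x" for x by (simp add: K_def stable_kernel_nonneg t)
  have contK: "continuous_on UNIV K" unfolding K_def by (rule stable_kernel_continuous[OF t])
  then have [measurable]: "K \<in> borel_measurable borel" by (rule borel_measurable_continuous_onI)
  define e where "e k = (1 / real (Suc k))\<^sup>2" for k
  have e: "0 < e k" for k by (simp add: e_def)
  have intg: "integrable lborel (\<lambda>x::'a. exp (- e k * (norm x)\<^sup>2) * cos (x \<bullet> \<eta>))" for k \<eta>
    by (rule Bochner_Integration.integrable_bound[OF gaussian_cos_transform(1)[OF e[of k]]])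
       (auto simp: abs_mult intro!: mult_right_le_one_le)
  have J: "(\<lambda>k. \<integral>x. exp (- e k * (norm x)\<^sup>2) * cos (x \<bullet> \<eta>) * K x \<partial>lborel) \<longlonglongrightarrow> \<psi> \<eta>" for \<eta>
  proof -
    have "(\<integral>x. exp (- e k * (norm x)\<^sup>2) * cos (x \<bullet> \<eta>) * K x \<partial>lborel)
       = ((\<integral>\<xi>. \<psi> \<xi> * gauss (e k) (\<xi> - - \<eta>) \<partial>lborel) + (\<integral>\<xi>. \<psi> \<xi> * gauss (e k) (\<xi> - \<eta>) \<partial>lborel)) / 2"
      (is "?L k = ?R k") for k
    proof -
      \<comment> \<open>The product formula for cosines splits this into Gaussians centred at -
        \<eta> and \<eta>; the two limits agree because the symbol is even.\<close>
      have inner: "(\<integral>x. exp (- e k * (norm x)\<^sup>2) * cos (x \<bullet> \<eta>) * cos ((x - 0) \<bullet> \<xi>) \<partial>lborel)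
         = (2 * pi) ^ DIM('a) * ((gauss (e k) (\<xi> - - \<eta>) + gauss (e k) (\<xi> - \<eta>)) / 2)" for \<xi>
      proof -
        have eq: "exp (- e k * (norm x)\<^sup>2) * cos (x \<bullet> \<eta>) * cos ((x - 0) \<bullet> \<xi>)
           = exp (- e k * (norm x)\<^sup>2) * cos (x \<bullet> (\<xi> - - \<eta>)) / 2 + exp (- e k * (norm x)\<^sup>2) * cos (x \<bullet> (\<xi> - \<eta>)) / 2" for x
          by (simp add: inner_add_right inner_diff_right cos_add cos_diff field_simps)
        have g: "(\<integral>x. exp (- e k * (norm x)\<^sup>2) * cos (x \<bullet> \<zeta>) \<partial>lborel) = (2 * pi) ^ DIM('a) * gauss (e k) \<zeta>" for \<zeta> :: 'a
          by (simp add: gauss_def cos_transform_def mult.commute inner_commute)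
        show ?thesis
          unfolding eq
          by (subst Bochner_Integration.integral_add[OF integrable_divide_zero[OF intg] integrable_divide_zero[OF intg]])
             (simp only: integral_divide_zero g, simp add: field_simps)
      qed
      have intp: "integrable lborel (\<lambda>\<xi>. \<psi> \<xi> * gauss (e k) (\<xi> - \<zeta>))" for \<zeta>
      proof (rule Bochner_Integration.integrable_bound)
        show "integrable lborel (\<lambda>\<xi>. gauss (e k) (0::'a) * \<psi> \<xi>)" using \<psi> by simp
        have [measurable]: "gauss (e k) \<in> borel_measurable (borel :: 'a measure)" by (rule gauss_measurable[OF e])
        show "(\<lambda>\<xi>. \<psi> \<xi> * gauss (e k) (\<xi> - \<zeta>)) \<in> borel_measurable lborel" unfolding \<psi>_def by measurable
        show "AE \<xi> in lborel. norm (\<psi> \<xi> * gauss (e k) (\<xi> - \<zeta>)) \<le> norm (gauss (e k) (0::'a) * \<psi> \<xi>)"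
          using gauss_le[OF e[of k], where 'a = 'a] gauss_nonneg[OF e[of k], where 'a = 'a]
          by (auto simp: abs_mult \<psi>_def mult.commute[of "exp _"] intro!: AE_I2 mult_right_mono)
      qed
      have "(\<integral>x. exp (- e k * (norm x)\<^sup>2) * cos (x \<bullet> \<eta>) * K x \<partial>lborel)
         = (\<integral>x. exp (- e k * (norm x)\<^sup>2) * cos (x \<bullet> \<eta>) * cos_transform \<psi> (x - 0) \<partial>lborel) / (2 * pi) ^ DIM('a)"
        by (simp add: K)
      also have "\<dots> = (\<integral>\<xi>. \<psi> \<xi> * gauss (e k) (\<xi> - - \<eta>) / 2 + \<psi> \<xi> * gauss (e k) (\<xi> - \<eta>) / 2 \<partial>lborel)"
      proof -
        have eq: "\<psi> \<xi> * ((2 * pi) ^ DIM('a) * ((A + B) / 2)) = (2 * pi) ^ DIM('a) * (\<psi> \<xi> * A / 2 + \<psi> \<xi> * B / 2)" for \<xi> A B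
          by (simp add: field_simps)
        show ?thesis
          by (subst cos_transform_swap[OF \<psi> intg], subst inner) (simp only: eq integral_mult_right_zero, simp)
      qed
      also have "\<dots> = ((\<integral>\<xi>. \<psi> \<xi> * gauss (e k) (\<xi> - - \<eta>) \<partial>lborel) + (\<integral>\<xi>. \<psi> \<xi> * gauss (e k) (\<xi> - \<eta>) \<partial>lborel)) / 2"
        by (subst Bochner_Integration.integral_add[OF integrable_divide_zero[OF intp] integrable_divide_zero[OF intp]])
           (simp only: integral_divide_zero add_divide_distrib)
      finally show ?thesis .
    qed
    then have "?L = ?R" ..
    moreover have "?R \<longlonglongrightarrow> (\<psi> (- \<eta>) + \<psi> \<eta>) / 2"
      unfolding e_def by (intro tendsto_intros gauss_approximation \<psi> cont\<psi>) simp
    moreover have "(\<psi> (- \<eta>) + \<psi> \<eta>) / 2 = \<psi> \<eta>" by (simp add: \<psi>_def)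
    ultimately show ?thesis by (simp only:)
  qed
  have e0: "(\<lambda>k. exp (- e k * r)) \<longlonglongrightarrow> 1" for r
    unfolding e_def by real_asymp
  have int: "integrable lborel K"
  proof (rule integrableI_bounded)
    have Kint: "integrable lborel (\<lambda>x. exp (- e k * (norm x)\<^sup>2) * K x)" for k
    proof (rule Bochner_Integration.integrable_bound)
      show "integrable lborel (\<lambda>x::'a. K 0 * exp (- e k * (norm x)\<^sup>2))"
        by (intro integrable_mult_right gaussian_cos_transform e)
      have "K x \<le> K 0" for x
        using stable_kernel_le[OF t, of x] stable_kernel_scaling[OF t, of "0::'a"] by (simp add: K_def)
      then show "AE x in lborel. norm (exp (- e k * (norm x)\<^sup>2) * K x) \<le> norm (K 0 * exp (- e k * (norm x)\<^sup>2))"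
        using K0 by (auto simp: abs_mult mult.commute intro!: AE_I2 mult_left_mono)
    qed measurable
    have "(\<integral>\<^sup>+x. ennreal (K x) \<partial>lborel) = (\<integral>\<^sup>+x. liminf (\<lambda>k. ennreal (exp (- e k * (norm x)\<^sup>2) * K x)) \<partial>lborel)"
    proof (intro nn_integral_cong)
      fix x
      have "(\<lambda>k. ennreal (exp (- e k * (norm x)\<^sup>2) * K x)) \<longlonglongrightarrow> ennreal (1 * K x)"
        by (intro tendsto_ennrealI tendsto_intros e0)
      then show "ennreal (K x) = liminf (\<lambda>k. ennreal (exp (- e k * (norm x)\<^sup>2) * K x))"
        by (simp add: lim_imp_Liminf)
    qed
    also have "\<dots> \<le> liminf (\<lambda>k. \<integral>\<^sup>+x. ennreal (exp (- e k * (norm x)\<^sup>2) * K x) \<partial>lborel)"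
      by (rule nn_integral_liminf) measurable
    also have "(\<lambda>k. \<integral>\<^sup>+x. ennreal (exp (- e k * (norm x)\<^sup>2) * K x) \<partial>lborel) = (\<lambda>k. ennreal (\<integral>x. exp (- e k * (norm x)\<^sup>2) * K x \<partial>lborel))"
      using K0 by (intro ext nn_integral_eq_integral Kint) simp
    also have "liminf \<dots> = ennreal (\<psi> 0)"
      by (intro lim_imp_Liminf tendsto_ennrealI) (use J[of 0] in simp_all)
    finally show "(\<integral>\<^sup>+x. ennreal (norm (K x)) \<partial>lborel) < \<infinity>" using K0 by (simp add: le_less_trans)
  qed simp
  then show "integrable lborel (stable_kernel \<alpha> t :: 'a \<Rightarrow> real)" by (simp add: K_def)
  have "(\<lambda>k. \<integral>x. exp (- e k * (norm x)\<^sup>2) * cos (x \<bullet> \<eta>) * K x \<partial>lborel) \<longlonglongrightarrow> (\<integral>x. K x * cos (x \<bullet> \<eta>) \<partial>lborel)"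
  proof (rule integral_dominated_convergence[OF _ _ int])
    show "AE x in lborel. (\<lambda>k. exp (- e k * (norm x)\<^sup>2) * cos (x \<bullet> \<eta>) * K x) \<longlonglongrightarrow> K x * cos (x \<bullet> \<eta>)"
    proof (rule AE_I2)
      fix x
      have "(\<lambda>k. exp (- e k * (norm x)\<^sup>2) * cos (x \<bullet> \<eta>) * K x) \<longlonglongrightarrow> 1 * cos (x \<bullet> \<eta>) * K x"
        by (intro tendsto_intros e0)
      then show "(\<lambda>k. exp (- e k * (norm x)\<^sup>2) * cos (x \<bullet> \<eta>) * K x) \<longlonglongrightarrow> K x * cos (x \<bullet> \<eta>)"
        by (simp add: mult.commute)
    qed
    show "AE x in lborel. norm (exp (- e k * (norm x)\<^sup>2) * cos (x \<bullet> \<eta>) * K x) \<le> K x" for k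
    proof (rule AE_I2)
      fix x
      have "exp (- e k * (norm x)\<^sup>2) * \<bar>cos (x \<bullet> \<eta>)\<bar> \<le> 1 * 1"
        using e[of k] by (intro mult_mono) auto
      then have "(exp (- e k * (norm x)\<^sup>2) * \<bar>cos (x \<bullet> \<eta>)\<bar>) * K x \<le> 1 * K x"
        by (intro mult_right_mono K0) simp
      then show "norm (exp (- e k * (norm x)\<^sup>2) * cos (x \<bullet> \<eta>) * K x) \<le> K x"
        using K0[of x] by (simp add: abs_mult)
    qed
  qed measurable
  from LIMSEQ_unique[OF this J]
  show "(\<integral>x. stable_kernel \<alpha> t x * cos (x \<bullet> \<eta>) \<partial>lborel) = exp (- t * norm \<eta> powr \<alpha>)"
    by (simp add: K_def \<psi>_def)
  \<comment> \<open>K is even, so the reflection x -> - x shows that the sine integral is its own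
    negative.\<close>
  have "(\<integral>x. K x * sin (x \<bullet> \<eta>) \<partial>lborel) = - (\<integral>x. K x * sin (x \<bullet> \<eta>) \<partial>lborel)"
  proof -
    have m: "(\<lambda>x. K x * sin (x \<bullet> \<eta>)) \<in> borel_measurable borel" by measurable
    show ?thesis
      using lborel_integral_affine(1)[OF _ m, of "-1" 0] by (simp add: K_def stable_kernel_uminus)
  qed
  then show "(\<integral>x. stable_kernel \<alpha> t x * sin (x \<bullet> \<eta>) \<partial>lborel) = 0"
    by (simp add: K_def)
qed

lemma stable_kernel_integral: "0 < t \<Longrightarrow> integral\<^sup>L lborel (stable_kernel \<alpha> t :: 'a::euclidean_space \<Rightarrow> real) = 1"
  using stable_kernel_transform(2)[of t 0] \<alpha> by simp

text \<open>With K(s) written as a transform and the integrals swapped, the inner integral is a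
  transform of K(t), so the symbols multiply and the times add.\<close>

lemma stable_kernel_semigroup:
  fixes x :: "'a::euclidean_space"
  assumes s: "0 < s" and t: "0 < t"
  shows "(\<integral>y. stable_kernel \<alpha> s (x - y) * stable_kernel \<alpha> t y \<partial>lborel) = stable_kernel \<alpha> (s + t) x"
proof -
  define \<psi> where "\<psi> t \<xi> = exp (- t * norm \<xi> powr \<alpha>)" for t and \<xi> :: 'a
  have \<psi>: "integrable lborel (\<psi> s)"
    unfolding \<psi>_def using s \<alpha> by (intro integrable_exp_norm_powr)
  define K where "K = (stable_kernel \<alpha> t :: 'a \<Rightarrow> real)"
  note trans = stable_kernel_transform[OF t, where 'a = 'a, folded K_def]
  have [measurable]: "K \<in> borel_measurable borel" using trans(1) borel_measurable_integrable by force
  have int: "integrable lborel (\<lambda>y. K y * cos (y \<bullet> \<xi>))" "integrable lborel (\<lambda>y. K y * sin (y \<bullet> \<xi>))" for \<xi>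
    by (rule Bochner_Integration.integrable_bound[OF trans(1)]; force simp: abs_mult intro!: mult_right_le_one_le AE_I2)+
  have inner: "(\<integral>y. K y * cos ((y - x) \<bullet> \<xi>) \<partial>lborel) = cos (x \<bullet> \<xi>) * \<psi> t \<xi>" for \<xi>
  proof -
    have eq: "K y * cos ((y - x) \<bullet> \<xi>) = cos (x \<bullet> \<xi>) * (K y * cos (y \<bullet> \<xi>)) + sin (x \<bullet> \<xi>) * (K y * sin (y \<bullet> \<xi>))" for y
      by (simp add: inner_diff_left cos_diff algebra_simps)
    show ?thesis unfolding eq
      by (subst Bochner_Integration.integral_add) (auto intro!: integrable_mult_right int simp: trans \<psi>_def)
  qed
  have "(\<integral>y. stable_kernel \<alpha> s (x - y) * stable_kernel \<alpha> t y \<partial>lborel) = (\<integral>y. K y * cos_transform (\<psi> s) (y - x) \<partial>lborel) / (2 * pi) ^ DIM('a)"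
  proof -
    have "stable_kernel \<alpha> s (x - y) = cos_transform (\<psi> s) (y - x) / (2 * pi) ^ DIM('a)" for y
      using stable_kernel_uminus[of s "x - y"] by (simp add: stable_kernel_def \<psi>_def[abs_def])
    then show ?thesis by (simp add: K_def mult.commute)
  qed
  also have "(\<integral>y. K y * cos_transform (\<psi> s) (y - x) \<partial>lborel) = cos_transform (\<psi> (s + t)) x"
    by (subst cos_transform_swap[OF \<psi> trans(1)], subst inner)
       (simp add: cos_transform_def \<psi>_def exp_add[symmetric] algebra_simps)
  finally show ?thesis unfolding stable_kernel_def[of \<alpha> "s + t"] \<psi>_def[abs_def] .
qed

text \<open>Existence in the \<open>THE\<close> is Fourier inversion; uniqueness holds because the
  difference of two candidates is continuous and integrable with vanishing transform.\<close>

lemma heat_kernel_eq_stable_kernel: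
  assumes t: "0 < t"
  shows "heat_kernel \<alpha> t = (stable_kernel \<alpha> t :: real^'n \<Rightarrow> real)"
  unfolding heat_kernel_def
proof (rule the_equality)
  let ?K = "stable_kernel \<alpha> t :: real^'n \<Rightarrow> real"
  have [measurable]: "?K \<in> borel_measurable borel"
    by (intro borel_measurable_continuous_onI stable_kernel_continuous t)
  show K: "continuous_on UNIV ?K \<and> integrable lebesgue ?K \<and> (\<forall>\<xi>. fourier ?K \<xi> = complex_of_real (exp (- t * norm \<xi> powr \<alpha>)))"
    by (auto simp: integrable_completion stable_kernel_transform[OF t] fourier_eq_cos_sin complex_eq_iff
        intro!: stable_kernel_continuous t)
  fix k :: "real^'n \<Rightarrow> real"
  assume k: "continuous_on UNIV k \<and> integrable lebesgue k \<and> (\<forall>\<xi>. fourier k \<xi> = complex_of_real (exp (- t * norm \<xi> powr \<alpha>)))"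
  then have [measurable]: "k \<in> borel_measurable borel"
    by (intro borel_measurable_continuous_onI) simp
  have ki: "integrable lborel k" using k by (simp add: integrable_completion)
  have Ki: "integrable lborel ?K" by (rule stable_kernel_transform[OF t])
  have int: "integrable lborel (\<lambda>x. h x * cos (x \<bullet> \<xi>))" "integrable lborel (\<lambda>x. h x * sin (x \<bullet> \<xi>))"
    if [measurable]: "h \<in> borel_measurable borel" and "integrable lborel h" for h :: "real^'n \<Rightarrow> real" and \<xi>
    by (rule Bochner_Integration.integrable_bound[OF that(2)]; force simp: abs_mult intro!: mult_right_le_one_le AE_I2)+
  have eq: "fourier k \<xi> = fourier ?K \<xi>" for \<xi> using K k by simp
  have "k z - ?K z = 0" for z
  proof (rule continuous_integrable_eq_0I[where d = "\<lambda>x. k x - ?K x"])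
    show "continuous_on UNIV (\<lambda>x. k x - ?K x)" using k K by (intro continuous_intros) auto
    show "(\<integral>x. (k x - ?K x) * cos (x \<bullet> \<xi>) \<partial>lborel) = 0" for \<xi>
      using eq[of \<xi>] ki Ki by (simp add: fourier_eq_cos_sin left_diff_distrib Bochner_Integration.integral_diff int)
    show "(\<integral>x. (k x - ?K x) * sin (x \<bullet> \<xi>) \<partial>lborel) = 0" for \<xi>
      using eq[of \<xi>] ki Ki by (simp add: fourier_eq_cos_sin left_diff_distrib Bochner_Integration.integral_diff int)
  qed (use ki Ki in simp)
  then show "k = ?K" by (simp add: fun_eq_iff)
qed

end

section \<open>Monotone Volterra equations\<close>

text \<open>One notion covers global solutions, with \<open>I = {t0..}\<close>, and solutions up to
  blow-up, with \<open>I = {t0..<T}\<close>; continuity is asked on compact initial pieces, where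
  the integrals are taken.\<close>

definition volterra :: "(real \<Rightarrow> real \<Rightarrow> real) \<Rightarrow> real \<Rightarrow> real \<Rightarrow> real set \<Rightarrow> (real \<Rightarrow> real) \<Rightarrow> bool" where
  "volterra G y0 t0 I y \<longleftrightarrow>
     (\<forall>t\<in>I. continuous_on {t0..t} y \<and> y t = y0 + integral {t0..t} (\<lambda>s. G s (y s)))"

definition volterra_super :: "(real \<Rightarrow> real \<Rightarrow> real) \<Rightarrow> real \<Rightarrow> real \<Rightarrow> real \<Rightarrow> (real \<Rightarrow> real) \<Rightarrow> bool" where
  "volterra_super G y0 t0 t1 z \<longleftrightarrow> continuous_on {t0..t1} z \<and>
     (\<forall>t\<in>{t0..t1}. y0 + integral {t0..t} (\<lambda>s. G s (z s)) \<le> z t)"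

text \<open>Monotonicity in the unknown drives both existence and comparison: Picard iterates
  started at the constant y0 increase and stay below every supersolution.\<close>

locale monotone_rhs =
  fixes G :: "real \<Rightarrow> real \<Rightarrow> real" and t0 :: real
  assumes cont: "continuous_on ({t0..} \<times> UNIV) (\<lambda>(s, z). G s z)"
    and mono: "\<And>s z w. t0 \<le> s \<Longrightarrow> z \<le> w \<Longrightarrow> G s z \<le> G s w"
    and nonneg: "\<And>s z. t0 \<le> s \<Longrightarrow> 0 \<le> G s z"
begin

lemma cont_comp:
  assumes "continuous_on {t0..t} z"
  shows "continuous_on {t0..t} (\<lambda>s. G s (z s))"
proof -
  have "continuous_on {t0..t} ((\<lambda>(s, z). G s z) \<circ> (\<lambda>s. (s, z s)))"
    by (intro continuous_on_compose continuous_intros assms continuous_on_subset[OF cont]) auto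
  then show ?thesis by (simp add: o_def)
qed

lemma integrable_comp: "continuous_on {t0..t} z \<Longrightarrow> (\<lambda>s. G s (z s)) integrable_on {t0..t}"
  by (intro integrable_continuous_real cont_comp)

lemma integral_comp_mono:
  assumes "continuous_on {t0..t} z" "continuous_on {t0..t} w" "\<And>s. s \<in> {t0..t} \<Longrightarrow> z s \<le> w s"
  shows "integral {t0..t} (\<lambda>s. G s (z s)) \<le> integral {t0..t} (\<lambda>s. G s (w s))"
  using assms by (intro integral_le integrable_comp mono) auto

lemma volterra_mono:
  assumes "volterra G y0 t0 I y" "t \<in> I" "s \<in> {t0..t}" "s \<in> I"
  shows "y s \<le> y t"
proof -
  have "continuous_on {t0..t} y" "continuous_on {t0..s} y" using assms by (auto simp: volterra_def)
  then have "integral {t0..s} (\<lambda>r. G r (y r)) \<le> integral {t0..t} (\<lambda>r. G r (y r))"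
    using assms(3) by (intro integral_subset_le integrable_comp) (auto intro: nonneg)
  then show ?thesis using assms by (simp add: volterra_def)
qed

lemma volterra_ge:
  assumes "volterra G y0 t0 I y" "t \<in> I"
  shows "y0 \<le> y t"
proof -
  have "0 \<le> integral {t0..t} (\<lambda>r. G r (y r))"
    using assms by (intro integral_nonneg integrable_comp nonneg) (auto simp: volterra_def)
  then show ?thesis using assms by (simp add: volterra_def)
qed

text \<open>The point b beyond t makes I look like {t0..b} near t, so the fundamental theorem on a
  compact interval yields the derivative within I, one-sided at t0.\<close>

lemma volterra_deriv:
  assumes y: "volterra G y0 t0 I y" and I: "t0 \<le> t" "b \<in> I" "t < b" "{t0..b} \<subseteq> I" "I \<subseteq> {t0..}"
  shows "(y has_real_derivative G t (y t)) (at t within I)"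
proof -
  have "continuous_on {t0..b} y" using y I(2) by (simp add: volterra_def)
  then have "((\<lambda>u. y0 + integral {t0..u} (\<lambda>s. G s (y s))) has_real_derivative 0 + G t (y t)) (at t within {t0..b})"
    using I by (intro derivative_intros integral_has_real_derivative cont_comp) auto
  moreover have "y u = y0 + integral {t0..u} (\<lambda>s. G s (y s))" if "u \<in> {t0..b}" for u
    using y I(4) that by (auto simp: volterra_def)
  ultimately have "(y has_real_derivative G t (y t)) (at t within {t0..b})"
    using I by (subst has_field_derivative_cong_eventually[where g = "\<lambda>u. y0 + integral {t0..u} (\<lambda>s. G s (y s))"])
      (auto simp: eventually_at_filter)
  moreover have "at t within {t0..b} = at t within I"
    using I by (intro at_within_nhd[of t "{..<b}"]) auto
  ultimately show ?thesis by simp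
qed

text \<open>The bound \<open>B\<close> makes the increasing iterates converge, and monotone
  convergence under the integral makes the limit a solution. Every supersolution dominates each
  iterate by induction, hence also the limit.\<close>

lemma bounded_minimal_solution:
  assumes bound: "\<And>s z. t0 \<le> s \<Longrightarrow> G s z \<le> B s" and contB: "continuous_on {t0..} B"
  obtains y where "volterra G y0 t0 {t0..} y"
    and "\<And>z t1 t. volterra_super G y0 t0 t1 z \<Longrightarrow> t \<in> {t0..t1} \<Longrightarrow> y t \<le> z t"
proof -
  define Y where "Y = rec_nat (\<lambda>t. y0) (\<lambda>_ y t. y0 + integral {t0..t} (\<lambda>s. G s (y s)))"
  have Y0: "Y 0 = (\<lambda>t. y0)" and YS: "Y (Suc k) = (\<lambda>t. y0 + integral {t0..t} (\<lambda>s. G s (Y k s)))" for k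
    by (simp_all add: Y_def)
  have contY: "continuous_on {t0..t} (Y k)" for k t
  proof (induction k)
    case (Suc k)
    then show ?case unfolding YS
      by (intro continuous_intros indefinite_integral_continuous_1 integrable_comp)
  qed (simp add: Y0)
  have intB: "B integrable_on {t0..t}" for t
    by (intro integrable_continuous_real continuous_on_subset[OF contB]) auto
  have incr: "Y k t \<le> Y (Suc k) t" if "t0 \<le> t" for k t
    using that
  proof (induction k arbitrary: t)
    case 0
    then show ?case unfolding YS Y0 by (auto intro!: integral_nonneg integrable_comp nonneg)
  next
    case (Suc k)
    have "integral {t0..t} (\<lambda>s. G s (Y k s)) \<le> integral {t0..t} (\<lambda>s. G s (Y (Suc k) s))"
      by (intro integral_comp_mono contY) (use Suc.IH in auto)
    then show ?case
      unfolding fun_cong[OF YS[of k], of t] fun_cong[OF YS[of "Suc k"], of t] by simp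
  qed
  have upper: "Y k t \<le> y0 + integral {t0..t} B" if "t0 \<le> t" for k t
  proof -
    have "y0 \<le> y0 + integral {t0..t} B"
      using bound nonneg that by (auto intro!: integral_nonneg intB order_trans[OF nonneg bound])
    moreover have "integral {t0..t} (\<lambda>s. G s (Y k s)) \<le> integral {t0..t} B" for k
      by (intro integral_le integrable_comp contY intB bound) auto
    ultimately show ?thesis by (cases k) (auto simp: Y0 YS)
  qed
  define y where "y t = lim (\<lambda>k. Y k t)" for t
  have lim: "(\<lambda>k. Y k t) \<longlonglongrightarrow> y t" if "t0 \<le> t" for t
  proof -
    have "incseq (\<lambda>k. Y k t)" using incr[OF that] by (rule incseq_SucI)
    then obtain L where "(\<lambda>k. Y k t) \<longlonglongrightarrow> L"
      using incseq_convergent[of "\<lambda>k. Y k t" "y0 + integral {t0..t} B"] upper[OF \<open>t0 \<le> t\<close>] by metis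
    then show ?thesis unfolding y_def by (simp add: limI)
  qed
  have conv: "(\<lambda>s. G s (y s)) integrable_on {t0..t} \<and>
      (\<lambda>k. integral {t0..t} (\<lambda>s. G s (Y k s))) \<longlonglongrightarrow> integral {t0..t} (\<lambda>s. G s (y s))" if "t0 \<le> t" for t
  proof (rule monotone_convergence_increasing)
    show "(\<lambda>s. G s (Y k s)) integrable_on {t0..t}" for k by (intro integrable_comp contY)
    show "G s (Y k s) \<le> G s (Y (Suc k) s)" if "s \<in> {t0..t}" for k s
      using that by (intro mono incr) auto
    show "(\<lambda>k. G s (Y k s)) \<longlonglongrightarrow> G s (y s)" if "s \<in> {t0..t}" for s
    proof -
      have "continuous_on UNIV ((\<lambda>(s, z). G s z) \<circ> Pair s)"
        using that by (intro continuous_on_compose continuous_intros continuous_on_subset[OF cont]) auto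
      then have "isCont (G s) (y s)" by (simp add: o_def continuous_on_eq_continuous_at)
      then show ?thesis using that by (intro isCont_tendsto_compose[where g = "G s"] lim) auto
    qed
    show "bounded (range (\<lambda>k. integral {t0..t} (\<lambda>s. G s (Y k s))))"
      unfolding bounded_iff
    proof (intro exI ballI)
      fix x assume "x \<in> range (\<lambda>k. integral {t0..t} (\<lambda>s. G s (Y k s)))"
      then obtain k where x: "x = integral {t0..t} (\<lambda>s. G s (Y k s))" by auto
      have "0 \<le> x" unfolding x by (intro integral_nonneg integrable_comp contY nonneg) auto
      moreover have "x \<le> integral {t0..t} B" unfolding x by (intro integral_le integrable_comp contY intB bound) auto
      ultimately show "norm x \<le> integral {t0..t} B" by simp
    qed
  qed
  have eq: "y t = y0 + integral {t0..t} (\<lambda>s. G s (y s))" if "t0 \<le> t" for t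
  proof (rule LIMSEQ_unique)
    show "(\<lambda>k. Y (Suc k) t) \<longlonglongrightarrow> y t" using lim[OF that] by (rule LIMSEQ_Suc)
    show "(\<lambda>k. Y (Suc k) t) \<longlonglongrightarrow> y0 + integral {t0..t} (\<lambda>s. G s (y s))"
      unfolding YS using conv[OF that] by (intro tendsto_intros) auto
  qed
  have cont_y: "continuous_on {t0..t} y" for t
  proof (cases "t0 \<le> t")
    case True
    have "continuous_on {t0..t} (\<lambda>t. y0 + integral {t0..t} (\<lambda>s. G s (y s)))"
      using conv[OF True] by (intro continuous_intros indefinite_integral_continuous_1) auto
    then show ?thesis using eq by (subst continuous_on_cong[OF refl]) auto
  qed simp
  show ?thesis
  proof (rule that)
    show "volterra G y0 t0 {t0..} y" using cont_y eq by (auto simp: volterra_def)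
    fix z t1 t assume z: "volterra_super G y0 t0 t1 z" and t: "t \<in> {t0..t1}"
    have contz: "continuous_on {t0..t} z" if "t \<le> t1" for t
      using z that unfolding volterra_super_def by (elim conjE continuous_on_subset) auto
    have zge: "y0 + integral {t0..t} (\<lambda>s. G s (z s)) \<le> z t" if "t \<in> {t0..t1}" for t
      using z that by (auto simp: volterra_super_def)
    have "Y k t \<le> z t" for k
      using t
    proof (induction k arbitrary: t)
      case 0
      have "0 \<le> integral {t0..t} (\<lambda>s. G s (z s))"
        using 0 by (intro integral_nonneg integrable_comp contz nonneg) auto
      then show ?case using zge[OF 0] by (simp add: Y0)
    next
      case (Suc k)
      have "Y (Suc k) t \<le> y0 + integral {t0..t} (\<lambda>s. G s (z s))"
        unfolding YS using Suc by (intro add_left_mono integral_comp_mono contY contz) auto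
      also have "\<dots> \<le> z t" using zge Suc.prems .
      finally show ?case .
    qed
    then show "y t \<le> z t" using t by (intro LIMSEQ_le_const2[OF lim]) auto
  qed
qed

lemma truncated: "monotone_rhs (\<lambda>s z. G s (min c z)) t0"
proof
  have "continuous_on ({t0..} \<times> UNIV) ((\<lambda>(s, z). G s z) \<circ> (\<lambda>(s, z). (s, min c z)))"
    by (intro continuous_on_compose continuous_on_subset[OF cont])
       (auto simp: case_prod_unfold intro!: continuous_intros)
  then show "continuous_on ({t0..} \<times> UNIV) (\<lambda>(s, z). G s (min c z))"
    by (simp add: o_def case_prod_unfold)
qed (auto intro!: mono nonneg)

text \<open>Truncating the second argument at a natural number N gives a global solution, which solves the original
  equation until it reaches N.\<close>

lemma minimal_solution:
  obtains (global) y where "volterra G y0 t0 {t0..} y"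
  | (blowup) T y where "t0 < T" "volterra G y0 t0 {t0..<T} y" "filterlim y at_top (at_left T)"
      "\<And>z t1 t. volterra_super G y0 t0 t1 z \<Longrightarrow> t \<in> {t0..t1} \<Longrightarrow> t < T \<Longrightarrow> y t \<le> z t"
proof -
  define H where "H N s z = G s (min (real N) z)" for N s z
  interpret H: monotone_rhs "H N" t0 for N unfolding H_def[abs_def] by (rule truncated)
  have "\<exists>y. volterra (H N) y0 t0 {t0..} y \<and> (\<forall>z t1 t. volterra_super (H N) y0 t0 t1 z \<longrightarrow> t \<in> {t0..t1} \<longrightarrow> y t \<le> z t)" for N
  proof -
    have "continuous_on {t0..} ((\<lambda>(s, z). G s z) \<circ> (\<lambda>s. (s, real N)))"
      by (intro continuous_on_compose continuous_intros continuous_on_subset[OF cont]) auto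
    then have "continuous_on {t0..} (\<lambda>s. G s (real N))" by (simp add: o_def)
    then show ?thesis
      by (rule H.bounded_minimal_solution[rotated]) (auto simp: H_def intro: mono)
  qed
  then obtain Y where Y: "\<And>N. volterra (H N) y0 t0 {t0..} (Y N)"
    and Ymin: "\<And>N z t1 t. volterra_super (H N) y0 t0 t1 z \<Longrightarrow> t \<in> {t0..t1} \<Longrightarrow> Y N t \<le> z t"
    by metis
  have contY: "continuous_on {t0..t} (Y N)" for N t
    using Y[of N] by (cases "t0 \<le> t") (auto simp: volterra_def)
  have Yeq: "Y N t = y0 + integral {t0..t} (\<lambda>s. H N s (Y N s))" if "t0 \<le> t" for N t
    using Y[of N] that by (auto simp: volterra_def)
  have Ymono_t: "Y N s \<le> Y N t" if "t0 \<le> s" "s \<le> t" for N s t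
    using H.volterra_mono[OF Y, of t s] that by auto
  have Ymono: "Y N t \<le> Y M t" if "N \<le> M" "t0 \<le> t" for N M t
  proof (rule Ymin)
    have "integral {t0..t} (\<lambda>s. H N s (Y M s)) \<le> integral {t0..t} (\<lambda>s. H M s (Y M s))" for t
      using \<open>N \<le> M\<close> by (intro integral_le H.integrable_comp contY) (auto simp: H_def intro!: mono)
    then show "volterra_super (H N) y0 t0 t (Y M)"
      using Yeq[of _ M] contY by (auto simp: volterra_super_def)
  qed (use that in auto)
  \<comment> \<open>While Y N stays below N its truncation is inactive, so Y N also solves the
    equation truncated at the larger M and, by minimality, lies above Y M.\<close>
  have Yagree: "Y M t = Y N t" if "N \<le> M" "t0 \<le> t" "t \<le> t1" "Y N t1 \<le> real N" for N M t t1
  proof (rule antisym)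
    show "Y M t \<le> Y N t"
    proof (rule Ymin)
      have "integral {t0..t} (\<lambda>s. H M s (Y N s)) = integral {t0..t} (\<lambda>s. H N s (Y N s))" if "t \<le> t1" for t
      proof (rule integral_cong)
        fix s assume "s \<in> {t0..t}"
        then have "Y N s \<le> real N" using Ymono_t[of s t1 N] that \<open>Y N t1 \<le> real N\<close> by auto
        then show "H M s (Y N s) = H N s (Y N s)" using \<open>N \<le> M\<close> by (simp add: H_def min_absorb2)
      qed
      then show "volterra_super (H M) y0 t0 t1 (Y N)"
        using Yeq[of _ N] contY by (auto simp: volterra_super_def)
    qed (use that in auto)
  qed (use Ymono that in auto)
  \<comment> \<open>A time is good when some truncation is inactive up to it; by
    \<open>Yagree\<close> the value of \<open>y\<close> there does not depend on which one.\<close>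
  define good where "good t \<longleftrightarrow> (\<exists>N. Y N t \<le> real N)" for t
  define y where "y t = Y (SOME N. Y N t \<le> real N) t" for t
  have y: "y t = Y N t" if "t0 \<le> t" "t \<le> t1" "Y N t1 \<le> real N" for t t1 N
  proof -
    define M where "M = (SOME N. Y N t \<le> real N)"
    have N: "Y N t \<le> real N" using Ymono_t[OF that(1,2), of N] that(3) by simp
    then have M: "Y M t \<le> real M" unfolding M_def by (rule someI)
    have "Y M t = Y N t"
      using Yagree[of N M t t] Yagree[of M N t t] N M that(1) by (cases "N \<le> M") auto
    then show ?thesis by (simp add: y_def M_def)
  qed
  have sol: "continuous_on {t0..t} y \<and> y t = y0 + integral {t0..t} (\<lambda>s. G s (y s))" if "good t" "t0 \<le> t" for t
  proof -
    obtain N where N: "Y N t \<le> real N" using \<open>good t\<close> by (auto simp: good_def)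
    have yN: "y s = Y N s" if "s \<in> {t0..t}" for s using y[of s t N] N that by auto
    have "continuous_on {t0..t} y" using contY yN by (subst continuous_on_cong[OF refl]) auto
    moreover have "integral {t0..t} (\<lambda>s. H N s (Y N s)) = integral {t0..t} (\<lambda>s. G s (y s))"
    proof (rule integral_cong)
      fix s assume s: "s \<in> {t0..t}"
      then have "Y N s \<le> real N" using Ymono_t[of s t N] N by auto
      then show "H N s (Y N s) = G s (y s)" by (simp add: H_def yN[OF s])
    qed
    ultimately show ?thesis using Yeq[OF that(2), of N] yN[of t] that(2) by auto
  qed
  have good_mono: "good s" if "good t" "t0 \<le> s" "s \<le> t" for s t
    using order_trans[OF Ymono_t[OF that(2,3)]] that(1) by (auto simp: good_def)
  show ?thesis
  proof (cases "\<forall>t\<ge>t0. good t")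
    case True
    then show ?thesis using sol by (intro global[of y]) (auto simp: volterra_def)
  next
    case False
    define bad where "bad = {t. t0 \<le> t \<and> \<not> good t}"
    have bad: "bad \<noteq> {}" "bdd_below bad" using False by (auto simp: bad_def)
    define T where "T = Inf bad"
    have T0: "t0 \<le> T" unfolding T_def using bad(1) by (rule cInf_greatest) (auto simp: bad_def)
    have before: "good t" if "t0 \<le> t" "t < T" for t
      using cInf_lower[OF _ bad(2), of t] that by (auto simp: T_def bad_def)
    \<comment> \<open>The infimum of the bad times is itself bad: at a good T the next truncation
      leaves room, Y (N+1) T = Y N T <= N < N + 1, and by continuity goodness would persist beyond
      T.\<close>
    have nT: "\<not> good T"
    proof
      assume "good T"
      then obtain N where N: "Y N T \<le> real N" by (auto simp: good_def)
      have "Y (Suc N) T = Y N T" using Yagree[of N "Suc N" T T] N T0 by simp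
      then have less: "Y (Suc N) T < real (Suc N)" using N by simp
      have "continuous (at T within {t0..T+1}) (Y (Suc N))"
        using contY[of "T+1" "Suc N"] T0 by (auto simp: continuous_on_eq_continuous_within)
      then have "eventually (\<lambda>t. Y (Suc N) t < real (Suc N)) (at T within {t0..T+1})"
        unfolding continuous_within using less by (rule order_tendstoD)
      then obtain d where d: "d > 0" "\<And>t. t \<in> {t0..T+1} \<Longrightarrow> t \<noteq> T \<Longrightarrow> dist t T < d \<Longrightarrow> Y (Suc N) t < real (Suc N)"
        unfolding eventually_at by blast
      obtain t where t: "t \<in> bad" "t < T + min d 1"
        using cInf_lessD[OF bad(1), of "T + min d 1"] d by (auto simp: T_def)
      have "T \<le> t" unfolding T_def using t bad by (intro cInf_lower)
      moreover have "t \<noteq> T" using t(1) \<open>good T\<close> by (auto simp: bad_def)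
      ultimately have "Y (Suc N) t < real (Suc N)" using t T0 by (intro d(2)) (auto simp: dist_real_def)
      then have "good t" unfolding good_def by (intro exI[of _ "Suc N"]) simp
      then show False using t by (simp add: bad_def)
    qed
    have "good t0"
    proof -
      obtain N :: nat where "y0 \<le> real N" using real_arch_simple by blast
      then show ?thesis using Yeq[of t0 N] by (auto simp: good_def)
    qed
    then have T: "t0 < T" using nT T0 by (cases "T = t0") auto
    show ?thesis
    proof (rule blowup[OF T])
      show "volterra G y0 t0 {t0..<T} y" using sol before by (auto simp: volterra_def)
      \<comment> \<open>Since T is bad, Y N T > N for every N, and by continuity Y N > N just before
        T. The truncation representing y there must have a level of at least N, so y lies above Y
        N.\<close>
      show "filterlim y at_top (at_left T)"
        unfolding filterlim_at_top
      proof
        fix Z :: real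
        obtain N :: nat where N: "Z \<le> real N" using real_arch_simple by blast
        have "real N < Y N T" using nT by (auto simp: good_def not_le)
        moreover have "continuous (at T within {t0..T}) (Y N)"
          using contY[of T N] T by (auto simp: continuous_on_eq_continuous_within)
        ultimately have "eventually (\<lambda>t. real N < Y N t) (at T within {t0..T})"
          unfolding continuous_within by (intro order_tendstoD)
        then have "eventually (\<lambda>t. real N < Y N t) (at_left T)"
          using T by (simp add: at_within_Icc_at_left)
        moreover have "eventually (\<lambda>t. t \<in> {t0<..<T}) (at_left T)"
          by (rule eventually_at_leftI[OF _ T])
        ultimately show "eventually (\<lambda>t. Z \<le> y t) (at_left T)"
        proof eventually_elim
          case (elim t)
          then obtain M where M: "Y M t \<le> real M" using before[of t] by (auto simp: good_def)
          then have yt: "y t = Y M t" using elim y[of t t M] by auto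
          have "N \<le> M"
          proof (rule ccontr)
            assume "\<not> N \<le> M"
            then have "Y N t = Y M t" using Yagree[of M N t t] M elim by auto
            then show False using elim M \<open>\<not> N \<le> M\<close> by auto
          qed
          then show ?case using Ymono[of N M t] elim N yt by auto
        qed
      qed
      fix z t1 t assume z: "volterra_super G y0 t0 t1 z" and t: "t \<in> {t0..t1}" "t < T"
      obtain N where N: "Y N t \<le> real N" using before[of t] t by (auto simp: good_def)
      have "Y N t \<le> z t"
      proof (rule Ymin)
        have contz: "continuous_on {t0..t} z" if "t \<le> t1" for t
          using z that unfolding volterra_super_def by (elim conjE continuous_on_subset) auto
        have le: "integral {t0..t} (\<lambda>s. H N s (z s)) \<le> integral {t0..t} (\<lambda>s. G s (z s))" if "t \<le> t1" for t
          using that by (intro integral_le H.integrable_comp integrable_comp contz) (auto simp: H_def intro!: mono)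
        show "volterra_super (H N) y0 t0 t1 z"
          using z le by (fastforce simp: volterra_super_def)
      qed (use t in auto)
      then show "y t \<le> z t" using y[of t t N] N t by simp
    qed
  qed
qed

end

section \<open>The similarity equation\<close>

lemma nn_integral_set_eq_integral:
  fixes g :: "real \<Rightarrow> real"
  assumes si: "set_integrable lborel S g" and nn: "\<And>x. x \<in> S \<Longrightarrow> 0 \<le> g x"
  shows "(\<integral>\<^sup>+x\<in>S. ennreal (g x) \<partial>lborel) = ennreal (integral S g)"
proof -
  have "(\<integral>\<^sup>+x\<in>S. ennreal (g x) \<partial>lborel) = (\<integral>\<^sup>+x. ennreal (indicator S x *\<^sub>R g x) \<partial>lborel)"
    by (intro nn_integral_cong) (simp split: split_indicator)
  also have "\<dots> = ennreal (LINT x:S|lborel. g x)"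
    unfolding set_lebesgue_integral_def
    using si nn by (intro nn_integral_eq_integral) (auto simp: set_integrable_def split: split_indicator)
  also have "\<dots> = ennreal (integral S g)"
    using set_borel_integral_eq_integral(2)[OF si] by simp
  finally show ?thesis .
qed

lemma nn_integral_Icc_eq_integral:
  fixes g :: "real \<Rightarrow> real"
  assumes "continuous_on {a..b} g" "\<And>x. x \<in> {a..b} \<Longrightarrow> 0 \<le> g x"
  shows "(\<integral>\<^sup>+x\<in>{a..b}. ennreal (g x) \<partial>lborel) = ennreal (integral {a..b} g)"
proof (rule nn_integral_set_eq_integral)
  show "set_integrable lborel {a..b} g"
    unfolding set_integrable_def using assms(1) by (intro borel_integrable_compact) auto
qed (use assms(2) in auto)

lemma nn_integral_incseq_sets:
  fixes h :: "real \<Rightarrow> ennreal"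
  assumes [measurable]: "h \<in> borel_measurable borel" and "\<And>k. S k \<in> sets borel" "incseq S"
  shows "(SUP k. \<integral>\<^sup>+x\<in>S k. h x \<partial>lborel) = (\<integral>\<^sup>+x\<in>(\<Union>k. S k). h x \<partial>lborel)"
  using SUP_emeasure_incseq[of S "density lborel h"] assms by (auto simp: emeasure_density)

lemma UN_Icc_eq_Ici: "(\<Union>k. {a..a + real (Suc k)}) = {a..}"
proof safe
  fix x assume "a \<le> x"
  moreover obtain k :: nat where "x - a \<le> real k" using real_arch_simple by blast
  ultimately show "x \<in> (\<Union>k. {a..a + real (Suc k)})" by (auto intro!: exI[of _ k])
qed auto

text \<open>For p = n/\<alpha> the exponent is 2 + \<alpha>/n, so this is the integral of condition
  (c) up to \<delta>.\<close>

definition fujita_integral :: "(real \<Rightarrow> real) \<Rightarrow> real \<Rightarrow> real \<Rightarrow> ennreal" where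
  "fujita_integral f p \<delta> = (\<integral>\<^sup>+u\<in>{0<..<\<delta>}. ennreal (f u / u powr (2 + 1 / p)) \<partial>lborel)"

lemma fujita_integral_mono: "\<delta> \<le> \<delta>' \<Longrightarrow> fujita_integral f p \<delta> \<le> fujita_integral f p \<delta>'"
  unfolding fujita_integral_def by (intro nn_integral_mono) (auto split: split_indicator)

locale source =
  fixes f :: "real \<Rightarrow> real" and p :: real
  assumes p: "0 < p"
    and cont_f: "continuous_on {0..} f"
    and mono_f: "mono_on {0..} f"
    and f_0: "f 0 = 0"
begin

lemma f_mono: "0 \<le> u \<Longrightarrow> u \<le> v \<Longrightarrow> f u \<le> f v"
  using mono_f by (auto simp: mono_on_def)

lemma f_nonneg: "0 \<le> u \<Longrightarrow> 0 \<le> f u"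
  using f_mono[of 0 u] f_0 by simp

text \<open>Nothing is assumed about \<open>f\<close> at negative arguments; clamping yields a
  function that is continuous, hence Borel, on the whole line.\<close>

lemma f_clamp_continuous: "continuous_on UNIV (\<lambda>u. f (max 0 u))"
proof -
  have "continuous_on UNIV (f \<circ> max 0)"
    by (intro continuous_on_compose continuous_intros continuous_on_subset[OF cont_f]) auto
  then show ?thesis by (simp add: o_def)
qed

lemma f_clamp_measurable: "(\<lambda>u. f (max 0 u)) \<in> borel_measurable borel"
  by (intro borel_measurable_continuous_onI f_clamp_continuous)

lemma continuous_profile: "0 < t0 \<Longrightarrow> 0 \<le> A \<Longrightarrow> continuous_on {t0..t1} (\<lambda>s. s powr p * f (A * s powr - p))"
proof -
  assume "0 < t0" "0 \<le> A"
  then have "continuous_on {t0..t1} (f \<circ> (\<lambda>s. A * s powr - p))"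
    by (intro continuous_on_compose continuous_intros continuous_on_subset[OF cont_f]) auto
  with \<open>0 < t0\<close> show ?thesis unfolding o_def by (intro continuous_intros) auto
qed

lemma profile_measurable: "0 < A \<Longrightarrow> (\<lambda>s. f (A * s powr - p)) \<in> borel_measurable borel"
  using measurable_compose[OF _ f_clamp_measurable, of "\<lambda>s. A * s powr - p" borel] by (simp add: max_absorb2)

text \<open>For u = A s^-p one finds f(u) u^(-2-1/p) |du| = p A^(-1-1/p) s^p f(A s^-p) ds: the
  exponent 2 + 1/p is the one that produces the weight s^p of the similarity equation.\<close>

lemma fujita_substitution_Icc:
  assumes A: "0 < A" and t: "0 < t0" "t0 < t1"
  shows "ennreal (p * A powr - (1 + 1 / p)) * (\<integral>\<^sup>+s\<in>{t0..t1}. ennreal (s powr p * f (A * s powr - p)) \<partial>lborel)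
    = (\<integral>\<^sup>+u\<in>{A * t1 powr - p..A * t0 powr - p}. ennreal (f u / u powr (2 + 1 / p)) \<partial>lborel)"
proof -
  \<comment> \<open>The substitution u = A s^-p is decreasing; its negative is increasing, as the
    substitution rule requires, and the sign is undone at the end by a reflection.\<close>
  define g where "g s = - (A * s powr - p)" for s
  define g' where "g' s = A * p * s powr (- p - 1)" for s
  define F where "F w = f (- w) / (- w) powr (2 + 1 / p)" for w
  have gneg: "g t0 < 0" "g t1 < 0" using A t by (auto simp: g_def)
  have "continuous_on {g t0..g t1} (f \<circ> uminus)"
    using gneg by (intro continuous_on_compose continuous_intros continuous_on_subset[OF cont_f]) auto
  then have "continuous_on {g t0..g t1} F"
    using gneg unfolding F_def o_def by (intro continuous_intros) auto
  then have meas: "set_borel_measurable borel {g t0..g t1} F"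
    unfolding set_borel_measurable_def by (intro borel_measurable_continuous_on_indicator) auto
  have deriv: "(g has_real_derivative g' s) (at s)" if "s \<in> {t0..t1}" for s
    unfolding g_def g'_def using that t by (auto intro!: derivative_eq_intros simp: powr_diff field_simps)
  have "(\<integral>\<^sup>+w. ennreal (F w) * indicator {g t0..g t1} w \<partial>lborel) = (\<integral>\<^sup>+s. ennreal (F (g s) * g' s) * indicator {t0..t1} s \<partial>lborel)"
  proof -
    have "continuous_on {t0..t1} g'" unfolding g'_def using t by (intro continuous_intros) auto
    from nn_integral_substitution[OF meas deriv this] show ?thesis
      unfolding nn_integral_set_ennreal using A p t by (auto simp: g'_def)
  qed
  also have "\<dots> = (\<integral>\<^sup>+s. ennreal (p * A powr - (1 + 1 / p)) * (ennreal (s powr p * f (A * s powr - p)) * indicator {t0..t1} s) \<partial>lborel)"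
  proof (intro nn_integral_cong)
    fix s :: real
    show "ennreal (F (g s) * g' s) * indicator {t0..t1} s
      = ennreal (p * A powr - (1 + 1 / p)) * (ennreal (s powr p * f (A * s powr - p)) * indicator {t0..t1} s)"
    proof (cases "s \<in> {t0..t1}")
      case True
      then have s: "0 < s" using t by auto
      have "(A * s powr - p) powr (2 + 1 / p) = A powr (2 + 1 / p) * s powr (- 2 * p - 1)"
      proof -
        have "(s powr - p) powr (2 + 1 / p) = s powr (- p * (2 + 1 / p))" by (rule powr_powr)
        also have "- p * (2 + 1 / p) = - 2 * p - 1" using p by (simp add: field_simps)
        finally show ?thesis using s A by (simp add: powr_mult)
      qed
      then have "F (g s) * g' s = f (A * s powr - p) * (A / A powr (2 + 1 / p)) * p * (s powr (- p - 1) / s powr (- 2 * p - 1))"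
        by (simp add: F_def g_def g'_def)
      also have "s powr (- p - 1) / s powr (- 2 * p - 1) = s powr p"
        using s by (simp flip: powr_diff)
      also have "A / A powr (2 + 1 / p) = A powr - (1 + 1 / p)"
      proof -
        have "A / A powr (2 + 1 / p) = A powr (1 - (2 + 1 / p))" unfolding powr_diff using A by simp
        also have "1 - (2 + 1 / p) = - (1 + 1 / p)" by simp
        finally show ?thesis .
      qed
      finally show ?thesis
        using True p A by (simp add: ac_simps flip: ennreal_mult')
    qed simp
  qed
  also have "\<dots> = ennreal (p * A powr - (1 + 1 / p)) * (\<integral>\<^sup>+s\<in>{t0..t1}. ennreal (s powr p * f (A * s powr - p)) \<partial>lborel)"
    by (rule nn_integral_cmult) (use profile_measurable[OF A] in measurable)
  finally have 1: "(\<integral>\<^sup>+w. ennreal (F w) * indicator {g t0..g t1} w \<partial>lborel)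
     = ennreal (p * A powr - (1 + 1 / p)) * (\<integral>\<^sup>+s\<in>{t0..t1}. ennreal (s powr p * f (A * s powr - p)) \<partial>lborel)" .
  have "(\<integral>\<^sup>+w. ennreal (F w) * indicator {g t0..g t1} w \<partial>lborel)
     = (\<integral>\<^sup>+u. ennreal (F (0 + -1 * u)) * indicator {g t0..g t1} (0 + -1 * u) \<partial>lborel)"
  proof -
    have "(\<lambda>w. ennreal (indicator {g t0..g t1} w *\<^sub>R F w)) \<in> borel_measurable borel"
      using meas unfolding set_borel_measurable_def by measurable
    also have "(\<lambda>w. ennreal (indicator {g t0..g t1} w *\<^sub>R F w)) = (\<lambda>w. ennreal (F w) * indicator {g t0..g t1} w)"
      by (auto split: split_indicator)
    finally show ?thesis by (subst nn_integral_real_affine[where c = "-1" and t = 0]) auto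
  qed
  also have "\<dots> = (\<integral>\<^sup>+u\<in>{A * t1 powr - p..A * t0 powr - p}. ennreal (f u / u powr (2 + 1 / p)) \<partial>lborel)"
    by (intro nn_integral_cong) (auto simp: F_def g_def split: split_indicator)
  finally show ?thesis using 1 by simp
qed

text \<open>Compact intervals exhaust both sides: as the upper limit t1 tends to infinity, A t1^-p
  decreases to 0.\<close>

lemma fujita_substitution:
  assumes A: "0 < A" and t0: "0 < t0"
  shows "ennreal (p * A powr - (1 + 1 / p)) * (\<integral>\<^sup>+s\<in>{t0..}. ennreal (s powr p * f (A * s powr - p)) \<partial>lborel)
    = fujita_integral f p (A * t0 powr - p)"
proof -
  define S where "S k = {t0..t0 + real (Suc k)}" for k
  define R where "R k = {A * (t0 + real (Suc k)) powr - p..A * t0 powr - p}" for k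
  have m1: "(\<lambda>s. ennreal (s powr p * f (A * s powr - p))) \<in> borel_measurable borel"
    using profile_measurable[OF A] by measurable
  have US: "(\<Union>k. S k) = {t0..}" unfolding S_def by (rule UN_Icc_eq_Ici)
  have UR: "(\<Union>k. R k) = {0<..A * t0 powr - p}"
  proof safe
    fix x assume x: "x \<in> {0<..A * t0 powr - p}"
    have "(\<lambda>k. A * (t0 + real (Suc k)) powr - p) \<longlonglongrightarrow> 0"
      using A p t0 by real_asymp
    then have "eventually (\<lambda>k. A * (t0 + real (Suc k)) powr - p < x) sequentially"
      using x by (intro order_tendstoD) auto
    then obtain k where "A * (t0 + real (Suc k)) powr - p < x" by (auto simp: eventually_sequentially)
    with x show "x \<in> (\<Union>k. R k)" by (auto simp: R_def intro!: exI[of _ k])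
  next
    fix x k assume "x \<in> R k"
    moreover have "0 < A * (t0 + real (Suc k)) powr - p" using A t0 by simp
    ultimately show "x \<in> {0<..A * t0 powr - p}" unfolding R_def by (auto simp del: of_nat_Suc)
  qed
  have incR: "incseq R"
    using A p t0 by (auto simp: R_def incseq_def intro!: mult_left_mono powr_mono2' intro: order_trans[rotated] simp del: of_nat_Suc)
  have "ennreal (p * A powr - (1 + 1 / p)) * (\<integral>\<^sup>+s\<in>{t0..}. ennreal (s powr p * f (A * s powr - p)) \<partial>lborel)
    = (SUP k. ennreal (p * A powr - (1 + 1 / p)) * (\<integral>\<^sup>+s\<in>S k. ennreal (s powr p * f (A * s powr - p)) \<partial>lborel))"
    unfolding US[symmetric]
    by (subst nn_integral_incseq_sets[OF m1, symmetric]) (auto simp: S_def incseq_def SUP_mult_left_ennreal)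
  also have "\<dots> = (SUP k. \<integral>\<^sup>+u\<in>R k. ennreal (f (max 0 u) / u powr (2 + 1 / p)) \<partial>lborel)"
  proof (intro SUP_cong refl)
    fix k
    have "0 < A * (t0 + real (Suc k)) powr - p" using A t0 by simp
    then have "(\<integral>\<^sup>+u\<in>R k. ennreal (f (max 0 u) / u powr (2 + 1 / p)) \<partial>lborel) = (\<integral>\<^sup>+u\<in>R k. ennreal (f u / u powr (2 + 1 / p)) \<partial>lborel)"
      unfolding R_def by (intro nn_integral_cong) (auto split: split_indicator simp: max_def simp del: of_nat_Suc)
    then show "ennreal (p * A powr - (1 + 1 / p)) * (\<integral>\<^sup>+s\<in>S k. ennreal (s powr p * f (A * s powr - p)) \<partial>lborel)
      = (\<integral>\<^sup>+u\<in>R k. ennreal (f (max 0 u) / u powr (2 + 1 / p)) \<partial>lborel)"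
      using fujita_substitution_Icc[OF A t0, of "t0 + real (Suc k)"] by (simp add: S_def R_def)
  qed
  also have "\<dots> = (\<integral>\<^sup>+u\<in>{0<..A * t0 powr - p}. ennreal (f (max 0 u) / u powr (2 + 1 / p)) \<partial>lborel)"
    unfolding UR[symmetric]
    by (rule nn_integral_incseq_sets[OF _ _ incR]) (use f_clamp_measurable in \<open>auto simp: R_def\<close>)
  also have "\<dots> = fujita_integral f p (A * t0 powr - p)"
    unfolding fujita_integral_def
  proof (rule nn_integral_cong_AE)
    show "AE u in lborel. ennreal (f (max 0 u) / u powr (2 + 1 / p)) * indicator {0<..A * t0 powr - p} u
        = ennreal (f u / u powr (2 + 1 / p)) * indicator {0<..<A * t0 powr - p} u"
      using AE_lborel_singleton[of "A * t0 powr - p"] by eventually_elim (auto split: split_indicator simp: max_def)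
  qed
  finally show ?thesis .
qed

lemma fujita_divergent:
  assumes div: "\<And>\<delta>. 0 < \<delta> \<Longrightarrow> fujita_integral f p \<delta> = \<infinity>" and A: "0 < A" and t0: "0 < t0"
  shows "\<exists>t>t0. Z < integral {t0..t} (\<lambda>s. s powr p * f (A * s powr - p))"
proof -
  define S where "S k = {t0..t0 + real (Suc k)}" for k
  have US: "(\<Union>k. S k) = {t0..}" unfolding S_def by (rule UN_Icc_eq_Ici)
  have m1: "(\<lambda>s. ennreal (s powr p * f (A * s powr - p))) \<in> borel_measurable borel"
    using profile_measurable[OF A] by measurable
  have "ennreal (p * A powr - (1 + 1 / p)) * (\<integral>\<^sup>+s\<in>{t0..}. ennreal (s powr p * f (A * s powr - p)) \<partial>lborel) = \<infinity>"
    using fujita_substitution[OF A t0] div[of "A * t0 powr - p"] A t0 by simp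
  then have "(\<integral>\<^sup>+s\<in>{t0..}. ennreal (s powr p * f (A * s powr - p)) \<partial>lborel) = \<infinity>"
    by (auto simp: ennreal_mult_eq_top_iff)
  then have "(SUP k. \<integral>\<^sup>+s\<in>S k. ennreal (s powr p * f (A * s powr - p)) \<partial>lborel) = \<infinity>"
    unfolding US[symmetric] by (subst nn_integral_incseq_sets[OF m1]) (auto simp: S_def incseq_def)
  then have "ennreal Z < (SUP k. \<integral>\<^sup>+s\<in>S k. ennreal (s powr p * f (A * s powr - p)) \<partial>lborel)"
    by (simp only: infinity_ennreal_def ennreal_less_top)
  then obtain k where k: "ennreal Z < (\<integral>\<^sup>+s\<in>S k. ennreal (s powr p * f (A * s powr - p)) \<partial>lborel)"
    by (auto simp: less_SUP_iff)
  have "(\<integral>\<^sup>+s\<in>S k. ennreal (s powr p * f (A * s powr - p)) \<partial>lborel) = ennreal (integral (S k) (\<lambda>s. s powr p * f (A * s powr - p)))"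
    unfolding S_def using A t0 by (intro nn_integral_Icc_eq_integral continuous_profile) (auto intro!: mult_nonneg_nonneg f_nonneg)
  with k have "Z < integral (S k) (\<lambda>s. s powr p * f (A * s powr - p))"
    using ennreal_leI leD not_le by metis
  then show ?thesis by (intro exI[of _ "t0 + real (Suc k)"]) (auto simp: S_def)
qed

text \<open>By the substitution the integral is at most A^(1+1/p) I / p for A <= \<delta>, where I
  is the Fujita integral up to \<delta>; the surplus power A^(1/p) makes this at most \<eta> A once
  A is small.\<close>

lemma fujita_convergent:
  assumes conv: "0 < \<delta>" "fujita_integral f p \<delta> < \<infinity>" and \<eta>: "0 < \<eta>"
  obtains A where "0 < A" "(\<integral>\<^sup>+s\<in>{1..}. ennreal (s powr p * f (A * s powr - p)) \<partial>lborel) \<le> ennreal (\<eta> * A)"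
proof -
  obtain I where I: "fujita_integral f p \<delta> = ennreal I" "0 \<le> I"
    using conv(2) by (cases "fujita_integral f p \<delta>") auto
  have "((\<lambda>A. A powr (1 / p) * I / p) \<longlongrightarrow> 0) (at_right 0)"
    using p by real_asymp
  then have "eventually (\<lambda>A. A powr (1 / p) * I / p < \<eta>) (at_right 0)"
    using \<eta> by (rule order_tendstoD)
  moreover have "eventually (\<lambda>A. A \<in> {0<..<\<delta>}) (at_right 0)"
    using conv(1) by (intro eventually_at_right_real)
  ultimately have "eventually (\<lambda>A. A \<in> {0<..<\<delta>} \<and> A powr (1 / p) * I / p < \<eta>) (at_right 0)"
    by eventually_elim auto
  from eventually_happens'[OF trivial_limit_at_right_real this]
  obtain A where A: "0 < A" "A < \<delta>" "A powr (1 / p) * I / p < \<eta>" by auto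
  define J where "J = (\<integral>\<^sup>+s\<in>{1..}. ennreal (s powr p * f (A * s powr - p)) \<partial>lborel)"
  have "ennreal (p * A powr - (1 + 1 / p)) * J \<le> ennreal I"
    using fujita_substitution[OF A(1), of 1] fujita_integral_mono[of A \<delta> f p] A I by (simp add: J_def)
  then have "ennreal (A powr (1 + 1 / p) / p) * (ennreal (p * A powr - (1 + 1 / p)) * J) \<le> ennreal (A powr (1 + 1 / p) / p) * ennreal I"
    by (rule mult_left_mono) simp
  also have "ennreal (A powr (1 + 1 / p) / p) * (ennreal (p * A powr - (1 + 1 / p)) * J) = J"
  proof -
    have "A powr (1 + 1 / p) / p * (p * A powr - (1 + 1 / p)) = 1"
    proof -
      have "A powr (1 + 1 / p) * A powr - (1 + 1 / p) = 1"
        unfolding powr_add[symmetric] using A by simp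
      moreover have "a / p * (p * b) = a * b" for a b using p by simp
      ultimately show ?thesis by (simp only:)
    qed
    then show ?thesis
      using p by (simp add: mult.assoc[symmetric] ennreal_mult[symmetric])
  qed
  also have "ennreal (A powr (1 + 1 / p) / p) * ennreal I = ennreal (A * (A powr (1 / p) * I / p))"
    using A p I by (simp add: powr_add flip: ennreal_mult)
  also have "\<dots> \<le> ennreal (\<eta> * A)"
    unfolding mult.commute[of \<eta>] using A by (intro ennreal_leI mult_left_mono) auto
  finally show ?thesis using that A by (simp add: J_def)
qed

end

text \<open>The right-hand side of the equation for y(t) = t^p x(t) when x' = \<kappa> f(x) - p x / t; the maximum
  only keeps the argument in the domain of f.\<close>

definition similarity_rhs :: "(real \<Rightarrow> real) \<Rightarrow> real \<Rightarrow> real \<Rightarrow> real \<Rightarrow> real \<Rightarrow> real" where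
  "similarity_rhs f p \<kappa> s z = \<kappa> * s powr p * f (max 0 (s powr - p * z))"

context source
begin

lemma similarity_rhs_monotone:
  assumes "0 < t0" "0 \<le> \<kappa>"
  shows "monotone_rhs (similarity_rhs f p \<kappa>) t0"
proof
  have "continuous_on ({t0..} \<times> UNIV) ((\<lambda>u. f (max 0 u)) \<circ> (\<lambda>(s, z). s powr - p * z))"
    using assms by (intro continuous_on_compose continuous_on_subset[OF f_clamp_continuous])
      (auto simp: case_prod_unfold intro!: continuous_intros)
  then have "continuous_on ({t0..} \<times> UNIV) (\<lambda>q. f (max 0 (fst q powr - p * snd q)))"
    by (simp add: o_def case_prod_unfold)
  then show "continuous_on ({t0..} \<times> UNIV) (\<lambda>(s, z). similarity_rhs f p \<kappa> s z)"
    using assms unfolding similarity_rhs_def case_prod_unfold by (intro continuous_intros) auto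
  show "similarity_rhs f p \<kappa> s z \<le> similarity_rhs f p \<kappa> s w" if "z \<le> w" for s z w
  proof -
    have "max 0 (s powr - p * z) \<le> max 0 (s powr - p * w)"
      using that by (intro max.mono mult_left_mono) auto
    then show ?thesis
      using assms unfolding similarity_rhs_def by (intro mult_left_mono f_mono) auto
  qed
  show "0 \<le> similarity_rhs f p \<kappa> s z" for s z
    using assms unfolding similarity_rhs_def by (intro mult_nonneg_nonneg f_nonneg) auto
qed

end

text \<open>The best possible g in (S) is an infimum of increasing functions; being monotone it is Borel, so it
  can be used in substitutions.\<close>

lemma condS_monotone:
  assumes "condS f" and pos: "\<And>u. 0 < u \<Longrightarrow> 0 < f u"
    and mono: "\<And>u v. 0 \<le> u \<Longrightarrow> u \<le> v \<Longrightarrow> f u \<le> f v"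
  obtains c0 \<mu>0 and g :: "real \<Rightarrow> real" where "0 < c0" "0 < \<mu>0" "\<And>\<mu>. \<mu>0 < \<mu> \<Longrightarrow> 0 < g \<mu>"
    "g \<in> borel_measurable borel" "(\<integral>\<^sup>+\<mu>\<in>{\<mu>0<..}. ennreal (1 / g \<mu>) \<partial>lborel) < \<infinity>"
    "\<And>l \<mu>. 0 < l \<Longrightarrow> \<mu>0 < \<mu> \<Longrightarrow> l * \<mu> < c0 \<Longrightarrow> g \<mu> * f l \<le> f (l * \<mu>)"
proof -
  obtain c0 \<mu>0 and g :: "real \<Rightarrow> real" where c0: "0 < c0" and \<mu>0: "0 < \<mu>0"
    and g: "\<And>\<mu>. \<mu>0 < \<mu> \<Longrightarrow> 0 < g \<mu>" and int: "set_integrable lebesgue {\<mu>0<..} (\<lambda>s. 1 / g s)"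
    and S: "\<And>l \<mu>. 0 < l \<Longrightarrow> \<mu>0 \<le> \<mu> \<Longrightarrow> l * \<mu> \<in> {0<..<c0} \<Longrightarrow> g \<mu> * f l \<le> f (l * \<mu>)"
    using assms(1) unfolding condS_def by blast
  \<comment> \<open>As \<mu> grows, each quotient grows and fewer l remain admissible; both effects
    raise the infimum.\<close>
  define Q where "Q \<mu> = (\<lambda>l. f (l * \<mu>) / f l) ` {l. 0 < l \<and> l * \<mu> < c0}" for \<mu>
  \<comment> \<open>The value 0 up to \<mu>0 keeps \<open>h\<close> monotone on the whole
    line.\<close>
  define h where "h \<mu> = (if \<mu>0 < \<mu> then Inf (Q \<mu>) else 0)" for \<mu>
  have ne: "Q \<mu> \<noteq> {}" if "\<mu>0 < \<mu>" for \<mu>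
    using that \<mu>0 c0 by (auto simp: Q_def intro!: exI[of _ "c0 / (2 * \<mu>)"])
  have bdd: "bdd_below (Q \<mu>)" if "\<mu>0 < \<mu>" for \<mu>
    unfolding bdd_below_def Q_def using that \<mu>0 by (auto intro!: exI[of _ 0] divide_nonneg_nonneg less_imp_le[OF pos])
  have gh: "g \<mu> \<le> h \<mu>" if "\<mu>0 < \<mu>" for \<mu>
  proof -
    have "g \<mu> \<le> Inf (Q \<mu>)"
    proof (rule cInf_greatest[OF ne[OF that]])
      fix x assume "x \<in> Q \<mu>"
      then obtain l where l: "0 < l" "l * \<mu> < c0" "x = f (l * \<mu>) / f l" by (auto simp: Q_def)
      then have "g \<mu> * f l \<le> f (l * \<mu>)" using that \<mu>0 by (intro S) auto
      then show "g \<mu> \<le> x" using l pos[of l] by (simp add: pos_le_divide_eq)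
    qed
    then show ?thesis using that by (simp add: h_def)
  qed
  have hpos: "0 < h \<mu>" if "\<mu>0 < \<mu>" for \<mu> using g[OF that] gh[OF that] by simp
  have hmono: "mono h"
  proof
    fix \<mu> \<nu> :: real assume le: "\<mu> \<le> \<nu>"
    show "h \<mu> \<le> h \<nu>"
    proof (cases "\<mu>0 < \<mu>")
      case True
      have "Inf (Q \<mu>) \<le> Inf (Q \<nu>)"
      proof (rule cInf_greatest)
        show "Q \<nu> \<noteq> {}" using True le by (intro ne) simp
        fix x assume "x \<in> Q \<nu>"
        then obtain l where l: "0 < l" "l * \<nu> < c0" "x = f (l * \<nu>) / f l" by (auto simp: Q_def)
        have l\<mu>: "l * \<mu> \<le> l * \<nu>" using l le by simp
        have "Inf (Q \<mu>) \<le> f (l * \<mu>) / f l"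
        proof (rule cInf_lower[OF _ bdd[OF True]])
          show "f (l * \<mu>) / f l \<in> Q \<mu>"
            unfolding Q_def using l le_less_trans[OF l\<mu> l(2)] by (intro image_eqI[of _ _ l]) auto
        qed
        also have "\<dots> \<le> x"
          using l l\<mu> True \<mu>0 pos[of l] by (auto intro!: divide_right_mono mono)
        finally show "Inf (Q \<mu>) \<le> x" .
      qed
      then show ?thesis using True le by (simp add: h_def)
    next
      case False
      then show ?thesis using hpos[of \<nu>] by (simp add: h_def less_imp_le split: if_splits)
    qed
  qed
  have hS: "h \<mu> * f l \<le> f (l * \<mu>)" if "0 < l" "\<mu>0 < \<mu>" "l * \<mu> < c0" for l \<mu>
  proof -
    have "Inf (Q \<mu>) \<le> f (l * \<mu>) / f l"
      using that by (intro cInf_lower bdd) (auto simp: Q_def)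
    then show ?thesis using that pos[of l] by (simp add: h_def field_simps)
  qed
  have "(\<integral>\<^sup>+\<mu>\<in>{\<mu>0<..}. ennreal (1 / h \<mu>) \<partial>lborel) = (\<integral>\<^sup>+\<mu>\<in>{\<mu>0<..}. ennreal (1 / h \<mu>) \<partial>lebesgue)"
    by (simp add: nn_integral_completion)
  also have "\<dots> \<le> (\<integral>\<^sup>+\<mu>. ennreal (norm (indicator {\<mu>0<..} \<mu> *\<^sub>R (1 / g \<mu>))) \<partial>lebesgue)"
    using gh g hpos by (intro nn_integral_mono) (auto split: split_indicator intro!: ennreal_leI frac_le simp: less_imp_le)
  also have "\<dots> < \<infinity>"
    using int unfolding set_integrable_def integrable_iff_bounded by simp
  finally have "(\<integral>\<^sup>+\<mu>\<in>{\<mu>0<..}. ennreal (1 / h \<mu>) \<partial>lborel) < \<infinity>" .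
  then show ?thesis using that[of c0 \<mu>0 h] c0 \<mu>0 hpos hS borel_measurable_mono[OF hmono] by blast
qed

section \<open>Global solutions of the similarity equation\<close>

context source
begin

lemma condB_integral_bounded:
  assumes "condB f" and c: "0 < c" "0 < f c"
  obtains M where "\<And>z. c \<le> z \<Longrightarrow> integral {c..z} (\<lambda>u. 1 / f u) \<le> M"
proof -
  have pos: "0 < f u" if "c \<le> u" for u using f_mono[of c u] c that by simp
  \<comment> \<open>(B) covers only u >= 1; if c < 1, the stretch from c to 1 is controlled by 1 / f
    c, since f is nondecreasing.\<close>
  define K where "K = (\<integral>\<^sup>+u. ennreal (1 / f c) * indicator {c..1} u + 1 / ennreal (f u) * indicator {1..} u \<partial>lborel)"
  have "(\<lambda>u. 1 / ennreal (f (max 0 u)) * indicator {1..} u) \<in> borel_measurable lborel"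
    using f_clamp_measurable by measurable
  also have "(\<lambda>u. 1 / ennreal (f (max 0 u)) * indicator {1..} u) = (\<lambda>u. 1 / ennreal (f u) * indicator {1..} u)"
    by (auto simp: max_def split: split_indicator)
  finally have [measurable]: "(\<lambda>u. 1 / ennreal (f u) * indicator {1..} u) \<in> borel_measurable lborel" .
  have "K = ennreal (1 / f c) * emeasure lborel {c..1} + (\<integral>\<^sup>+u\<in>{1..}. 1 / ennreal (f u) \<partial>lborel)"
    unfolding K_def by (subst nn_integral_add) (auto simp: nn_integral_cmult_indicator)
  also have "\<dots> < \<infinity>"
    using assms(1) by (simp add: condB_def ennreal_mult_less_top emeasure_lborel_Icc_eq)
  finally obtain k where k: "K = ennreal k" "0 \<le> k" by (cases K) auto
  have "integral {c..z} (\<lambda>u. 1 / f u) \<le> k" if z: "c \<le> z" for z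
  proof -
    have "continuous_on {c..z} (\<lambda>u. 1 / f u)"
      using c pos by (intro continuous_intros continuous_on_subset[OF cont_f]) (auto simp: less_imp_neq[symmetric])
    then have "ennreal (integral {c..z} (\<lambda>u. 1 / f u)) = (\<integral>\<^sup>+u\<in>{c..z}. ennreal (1 / f u) \<partial>lborel)"
      using pos by (subst nn_integral_Icc_eq_integral) (auto intro: less_imp_le)
    also have "\<dots> \<le> K"
      unfolding K_def
    proof (intro nn_integral_mono)
      fix u
      show "ennreal (1 / f u) * indicator {c..z} u \<le> ennreal (1 / f c) * indicator {c..1} u + 1 / ennreal (f u) * indicator {1..} u"
      proof (cases "u \<in> {c..z}")
        case True
        show ?thesis
        proof (cases "u \<le> 1")
          case le: True
          have "1 / f u \<le> 1 / f c" using True c pos f_mono[of c u] by (intro divide_left_mono) auto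
          then have "ennreal (1 / f u) \<le> ennreal (1 / f c)" by (rule ennreal_leI)
          then show ?thesis using True le by (auto simp: add_increasing2)
        next
          case False
          have "1 / ennreal (f u) = ennreal (1 / f u)" using pos[of u] True by (simp add: divide_ennreal flip: ennreal_1)
          then show ?thesis using True False by simp
        qed
      qed simp
    qed
    finally show ?thesis using k by simp
  qed
  then show ?thesis by (rule that)
qed

lemma no_global_similarity_solution:
  assumes div: "\<And>\<delta>. 0 < \<delta> \<Longrightarrow> fujita_integral f p \<delta> = \<infinity>"
    and superlinear: "\<And>u v. 0 < u \<Longrightarrow> u \<le> v \<Longrightarrow> f u / u \<le> f v / v"
    and "condB f" "condS f" and \<kappa>: "0 < \<kappa>" and t0: "0 < t0" and y0: "0 < y0"
  shows "\<not> volterra (similarity_rhs f p \<kappa>) y0 t0 {t0..} y"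
proof
  assume y: "volterra (similarity_rhs f p \<kappa>) y0 t0 {t0..} y"
  interpret monotone_rhs "similarity_rhs f p \<kappa>" t0 using t0 \<kappa> by (intro similarity_rhs_monotone) auto
  \<comment> \<open>If f vanished at some u > 0 it would vanish on (0,u), and the Fujita integral up
    to u would be 0.\<close>
  have pos: "0 < f u" if "0 < u" for u
  proof (rule ccontr)
    assume "\<not> 0 < f u"
    then have "f v = 0" if "v \<in> {0<..<u}" for v using f_mono[of v u] f_nonneg[of v] that by auto
    then have "fujita_integral f p u = (\<integral>\<^sup>+v. 0 \<partial>(lborel :: real measure))"
      unfolding fujita_integral_def by (intro nn_integral_cong) (auto split: split_indicator)
    then show False using div[OF \<open>0 < u\<close>] by simp
  qed
  have yge: "y0 \<le> y t" if "t0 \<le> t" for t using volterra_ge[OF y] that by simp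
  have ymono: "y s \<le> y t" if "t0 \<le> s" "s \<le> t" for s t using volterra_mono[OF y, of t s] that by auto
  have rhs: "similarity_rhs f p \<kappa> t (y t) = \<kappa> * t powr p * f (t powr - p * y t)" if "t0 \<le> t" for t
    using yge[OF that] y0 by (simp add: similarity_rhs_def max_absorb2)
  have conty: "continuous_on {t0..t} y" for t using y by (cases "t0 \<le> t") (auto simp: volterra_def)
  have dy: "(y has_real_derivative \<kappa> * t powr p * f (t powr - p * y t)) (at t)" if "t0 < t" for t
  proof -
    have "(y has_real_derivative similarity_rhs f p \<kappa> t (y t)) (at t within {t0..})"
      using that by (intro volterra_deriv[OF y, where b = "t + 1"]) auto
    moreover have "at t within {t0..} = at t" using that by (intro at_within_interior) (auto simp: interior_Ici[of "t0 - 1"])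
    ultimately show ?thesis using rhs[of t] that by simp
  qed
  \<comment> \<open>Since y >= y0, the increment of y is at least \<kappa> times the integral of s^p
    f(y0 s^-p), which diverges.\<close>
  have unbounded: "\<exists>t>t0. Z < y t" for Z
  proof -
    obtain t where t: "t > t0" "(Z - y0) / \<kappa> < integral {t0..t} (\<lambda>s. s powr p * f (y0 * s powr - p))"
      using fujita_divergent[OF div y0 t0] by blast
    have "\<kappa> * integral {t0..t} (\<lambda>s. s powr p * f (y0 * s powr - p)) = integral {t0..t} (\<lambda>s. \<kappa> * (s powr p * f (y0 * s powr - p)))"
      by simp
    also have "\<dots> \<le> integral {t0..t} (\<lambda>s. similarity_rhs f p \<kappa> s (y s))"
    proof (rule integral_le)
      show "(\<lambda>s. \<kappa> * (s powr p * f (y0 * s powr - p))) integrable_on {t0..t}"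
        using t0 y0 by (intro integrable_continuous_real continuous_intros continuous_profile) auto
      show "(\<lambda>s. similarity_rhs f p \<kappa> s (y s)) integrable_on {t0..t}" by (intro integrable_comp conty)
      show "\<kappa> * (s powr p * f (y0 * s powr - p)) \<le> similarity_rhs f p \<kappa> s (y s)" if "s \<in> {t0..t}" for s
        using that yge[of s] y0 \<kappa> unfolding rhs[of s, OF atLeastAtMost_iff[THEN iffD1, THEN conjunct1, OF that]] mult.assoc
        by (intro mult_left_mono f_mono) (auto simp: mult.commute intro!: mult_right_mono)
    qed
    also have "\<dots> = y t - y0" using y t(1) by (auto simp: volterra_def)
    finally have "\<kappa> * integral {t0..t} (\<lambda>s. s powr p * f (y0 * s powr - p)) \<le> y t - y0" .
    moreover have "Z - y0 < \<kappa> * integral {t0..t} (\<lambda>s. s powr p * f (y0 * s powr - p))"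
      using t(2) \<kappa> by (simp add: field_simps)
    ultimately show ?thesis using t(1) by (intro exI[of _ t]) auto
  qed
  obtain c0 \<mu>0 and g :: "real \<Rightarrow> real" where c0: "0 < c0" and \<mu>0: "0 < \<mu>0" and g: "\<And>\<mu>. \<mu>0 < \<mu> \<Longrightarrow> 0 < g \<mu>"
    and [measurable]: "g \<in> borel_measurable borel"
    and gint: "(\<integral>\<^sup>+\<mu>\<in>{\<mu>0<..}. ennreal (1 / g \<mu>) \<partial>lborel) < \<infinity>"
    and S: "\<And>l \<mu>. 0 < l \<Longrightarrow> \<mu>0 < \<mu> \<Longrightarrow> l * \<mu> < c0 \<Longrightarrow> g \<mu> * f l \<le> f (l * \<mu>)"
    using condS_monotone[of f, OF \<open>condS f\<close> pos f_mono] by blast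
  define x where "x t = t powr - p * y t" for t
  have dx: "(x has_real_derivative \<kappa> * f (x t) - p / t * x t) (at t)" if "t0 < t" for t
  proof -
    have t: "0 < t" using that t0 by simp
    have "(x has_real_derivative (- p * t powr (- p - 1)) * y t + (\<kappa> * t powr p * f (t powr - p * y t)) * t powr - p) (at t)"
      unfolding x_def by (intro DERIV_mult dy that) (use t in \<open>auto intro!: derivative_eq_intros\<close>)
    moreover have "(- p * t powr (- p - 1)) * y t + (\<kappa> * t powr p * f (t powr - p * y t)) * t powr - p = \<kappa> * f (x t) - p / t * x t"
      using t by (simp add: x_def powr_diff powr_minus field_simps)
    ultimately show ?thesis by simp
  qed
  \<comment> \<open>From this time on the damping p x / t is at most half of \<kappa> f(x) whenever
    x >= c0, because f(x)/x >= f(c0)/c0.\<close>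
  define ts where "ts = max (t0 + 1) (2 * p * c0 / (\<kappa> * f c0))"
  have ts: "t0 < ts" by (simp add: ts_def)
  have growth: "\<kappa> * f (x t) / 2 \<le> \<kappa> * f (x t) - p / t * x t" if "ts \<le> t" "c0 \<le> x t" for t
  proof -
    have t: "0 < t" using that t0 ts by simp
    have "f c0 / c0 * x t \<le> f (x t)"
      using superlinear[OF c0 that(2)] c0 that(2) by (simp add: field_simps)
    then have "\<kappa> * (f c0 / c0 * x t) \<le> \<kappa> * f (x t)" by (rule mult_left_mono) (use \<kappa> in simp)
    moreover have "2 * p / t \<le> \<kappa> * (f c0 / c0)"
    proof -
      have "2 * p * c0 / (\<kappa> * f c0) \<le> t" using that by (simp add: ts_def)
      then show ?thesis using t \<kappa> c0 pos[OF c0] by (simp add: field_simps)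
    qed
    then have "2 * p / t * x t \<le> \<kappa> * (f c0 / c0) * x t"
      using that c0 by (intro mult_right_mono) auto
    ultimately have "2 * p / t * x t \<le> \<kappa> * f (x t)" by (simp only: mult.assoc)
    moreover have "2 * p / t * x t = 2 * (p / t * x t)" by simp
    ultimately show ?thesis by linarith
  qed
  \<comment> \<open>If x reached c0 after ts it would stay above c0 with x' >= \<kappa> f(x) / 2;
    then a primitive of 1/f would grow at least linearly along x, against (B).\<close>
  have small: "x t < c0" if "ts \<le> t" for t
  proof (rule ccontr)
    assume "\<not> x t < c0"
    then have xt: "c0 \<le> x t" by simp
    have contx: "continuous_on {t..b} x" for b
      using that ts by (intro DERIV_atLeastAtMost_imp_continuous_on[of _ _ x]) (auto intro!: exI dx)
    \<comment> \<open>At the last time s up to r with x s >= c0 the derivative is positive, so x >=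
      c0 would continue past s.\<close>
    have stay: "c0 \<le> x r" if r: "t \<le> r" for r
    proof (rule ccontr)
      assume "\<not> c0 \<le> x r"
      then have xr: "x r < c0" by simp
      define D where "D = {s \<in> {t..r}. c0 \<le> x s}"
      have "closed D" unfolding D_def
        by (intro continuous_on_closed_Collect_le contx continuous_on_const closed_atLeastAtMost)
      moreover have "t \<in> D" using r xt by (simp add: D_def)
      moreover have "bdd_above D" by (auto simp: D_def intro!: bdd_aboveI[of _ r])
      ultimately have sD: "Sup D \<in> D" by (intro closed_contains_Sup) auto
      define s where "s = Sup D"
      have s: "t \<le> s" "s \<le> r" "c0 \<le> x s" using sD by (auto simp: s_def D_def)
      then have "s < r" using xr by (cases "s = r") auto
      have s': "ts \<le> s" using s \<open>ts \<le> t\<close> by simp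
      have "0 < \<kappa> * f (x s) / 2" using \<kappa> c0 s pos[of "x s"] by simp
      then have "0 < \<kappa> * f (x s) - p / s * x s" using growth[OF s' s(3)] by linarith
      then obtain d where d: "0 < d" "\<And>h. 0 < h \<Longrightarrow> h < d \<Longrightarrow> x s < x (s + h)"
        using DERIV_pos_inc_right[OF dx[of s]] s' ts by auto
      define h where "h = min (d / 2) (r - s)"
      have h: "0 < h" "h < d" "s + h \<le> r" using d \<open>s < r\<close> by (auto simp: h_def min_def)
      then have "s + h \<in> D" using d(2)[of h] s by (auto simp: D_def)
      then have "s + h \<le> s" unfolding s_def by (intro cSup_upper) (auto simp: D_def intro!: bdd_aboveI[of _ r])
      then show False using h by simp
    qed
    obtain M where M: "\<And>z. c0 \<le> z \<Longrightarrow> integral {c0..z} (\<lambda>u. 1 / f u) \<le> M"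
      using condB_integral_bounded[OF \<open>condB f\<close> c0 pos[OF c0]] by blast
    \<comment> \<open>Starting the primitive at c0 / 2 makes it differentiable from both sides at c0
      itself.\<close>
    define P where "P z = integral {c0 / 2..z} (\<lambda>u. 1 / f u)" for z
    have contf: "continuous_on {c0 / 2..b} (\<lambda>u. 1 / f u)" for b
      using c0 by (intro continuous_intros continuous_on_subset[OF cont_f]) (auto simp: less_imp_neq[OF pos, symmetric])
    have dP: "(P has_real_derivative 1 / f z) (at z)" if "c0 \<le> z" for z
    proof -
      have "(P has_real_derivative 1 / f z) (at z within {c0 / 2..z + 1})"
        unfolding P_def using that c0 by (intro integral_has_real_derivative contf) auto
      moreover have "at z within {c0 / 2..z + 1} = at z"
        using that c0 by (intro at_within_Icc_at) auto
      ultimately show ?thesis by simp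
    qed
    have dPx: "((\<lambda>r. P (x r) - \<kappa> / 2 * r) has_real_derivative (1 / f (x r)) * (\<kappa> * f (x r) - p / r * x r) - \<kappa> / 2) (at r)"
      if "t \<le> r" for r
      using that \<open>ts \<le> t\<close> ts
      by (auto intro!: derivative_eq_intros DERIV_chain2[OF dP[OF stay] dx])
    have lower: "P (x t) + \<kappa> / 2 * (r - t) \<le> P (x r)" if "t \<le> r" for r
    proof -
      have "P (x t) - \<kappa> / 2 * t \<le> P (x r) - \<kappa> / 2 * r"
      proof (rule DERIV_nonneg_imp_nondecreasing[OF that])
        fix s assume s: "t \<le> s" "s \<le> r"
        have fpos: "0 < f (x s)" using pos stay[OF s(1)] c0 by auto
        have "\<kappa> / 2 = 1 / f (x s) * (\<kappa> * f (x s) / 2)" using fpos by simp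
        also have "\<dots> \<le> 1 / f (x s) * (\<kappa> * f (x s) - p / s * x s)"
          using s \<open>ts \<le> t\<close> fpos by (intro mult_left_mono growth stay) auto
        finally show "\<exists>D. ((\<lambda>r. P (x r) - \<kappa> / 2 * r) has_real_derivative D) (at s) \<and> 0 \<le> D"
          using dPx[OF s(1)] by (intro exI conjI) auto
      qed
      then show ?thesis by (simp add: algebra_simps diff_divide_distrib)
    qed
    have upper: "P (x r) \<le> integral {c0 / 2..c0} (\<lambda>u. 1 / f u) + M" if "t \<le> r" for r
    proof -
      have "integral {c0 / 2..c0} (\<lambda>u. 1 / f u) + integral {c0..x r} (\<lambda>u. 1 / f u) = P (x r)"
        unfolding P_def using stay[OF that] c0 by (intro Henstock_Kurzweil_Integration.integral_combine integrable_continuous_real contf) auto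
      then show ?thesis using M[OF stay[OF that]] by simp
    qed
    define B where "B = integral {c0 / 2..c0} (\<lambda>u. 1 / f u) + M"
    \<comment> \<open>A time so late that the lower bound for P (x r) exceeds the upper bound by at
      least 1.\<close>
    define r where "r = t + (max 0 (B - P (x t)) + 1) * 2 / \<kappa>"
    have "t \<le> r" using \<kappa> by (simp add: r_def)
    moreover have "\<kappa> / 2 * (r - t) = max 0 (B - P (x t)) + 1" using \<kappa> by (simp add: r_def)
    ultimately show False using lower[of r] upper[of r] unfolding B_def[symmetric] by linarith
  qed
  \<comment> \<open>From t2 on both restrictions in (S) are met: y > \<mu>0 because y is
    nondecreasing, and x < c0 by \<open>small\<close>.\<close>
  obtain t2 where t2: "ts < t2" "\<mu>0 < y t2"
  proof -
    obtain t where "t0 < t" "\<mu>0 < y t" using unbounded by blast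
    then show ?thesis using ymono[of t "max t (ts + 1)"] by (intro that[of "max t (ts + 1)"]) auto
  qed
  obtain I where I: "(\<integral>\<^sup>+\<mu>\<in>{\<mu>0<..}. ennreal (1 / g \<mu>) \<partial>lborel) = ennreal I" "0 \<le> I"
    using gint by (cases "\<integral>\<^sup>+\<mu>\<in>{\<mu>0<..}. ennreal (1 / g \<mu>) \<partial>lborel") auto
  have t20: "0 < t2" "t0 < t2" using t2 ts t0 by auto
  obtain t where t: "t2 < t" "I / \<kappa> < integral {t2..t} (\<lambda>s. s powr p * f (1 * s powr - p))"
    using fujita_divergent[OF div zero_less_one t20(1)] by blast
  have "ennreal (\<kappa> * integral {t2..t} (\<lambda>s. s powr p * f (1 * s powr - p)))
      = (\<integral>\<^sup>+s\<in>{t2..t}. ennreal (\<kappa> * (s powr p * f (1 * s powr - p))) \<partial>lborel)"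
    using t20 \<kappa> by (subst nn_integral_Icc_eq_integral)
      (auto intro!: continuous_intros continuous_profile[where A = 1, simplified] mult_nonneg_nonneg f_nonneg)
  also have "\<dots> \<le> (\<integral>\<^sup>+s. ennreal (1 / g (y s) * (\<kappa> * s powr p * f (s powr - p * y s))) * indicator {t2..t} s \<partial>lborel)"
  proof (intro nn_integral_mono)
    fix s
    show "ennreal (\<kappa> * (s powr p * f (1 * s powr - p))) * indicator {t2..t} s
      \<le> ennreal (1 / g (y s) * (\<kappa> * s powr p * f (s powr - p * y s))) * indicator {t2..t} s"
    proof (cases "s \<in> {t2..t}")
      case True
      then have s: "ts \<le> s" "t0 \<le> s" "0 < s" "t2 \<le> s" using t2 ts t0 by auto
      have ys: "\<mu>0 < y s" using ymono[of t2 s] t2(2) t20 s by auto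
      \<comment> \<open>(S) with l = s^-p and \<mu> = y s; the product l \<mu> is x s.\<close>
      have "g (y s) * f (s powr - p) \<le> f (s powr - p * y s)"
        using ys small[OF s(1)] s by (intro S) (auto simp: x_def)
      then have "f (s powr - p) \<le> 1 / g (y s) * f (s powr - p * y s)"
        using g[OF ys] by (simp add: field_simps)
      then have "\<kappa> * s powr p * f (s powr - p) \<le> \<kappa> * s powr p * (1 / g (y s) * f (s powr - p * y s))"
        using \<kappa> by (intro mult_left_mono) auto
      then show ?thesis using True by (auto intro!: ennreal_leI simp: mult_ac)
    qed simp
  qed
  \<comment> \<open>Separation of variables: the integrand is y'(s) / g(y s), and substituting \<mu>
    = y s leaves an integral of 1/g, which is bounded independently of t.\<close>
  also have "\<dots> = (\<integral>\<^sup>+\<mu>. ennreal (1 / g \<mu>) * indicator {y t2..y t} \<mu> \<partial>lborel)"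
  proof -
    have "set_borel_measurable borel {y t2..y t} (\<lambda>\<mu>. 1 / g \<mu>)"
      unfolding set_borel_measurable_def by measurable
    moreover have "continuous_on {t2..t} (\<lambda>s. \<kappa> * s powr p * f (s powr - p * y s))"
    proof -
      have "continuous_on {t2..t} (\<lambda>s. similarity_rhs f p \<kappa> s (y s))"
        using cont_comp[OF conty, of t] t20 by (elim continuous_on_subset) auto
      then show ?thesis using rhs t20 by (subst (asm) continuous_on_cong[OF refl]) auto
    qed
    moreover have "0 \<le> \<kappa> * s powr p * f (s powr - p * y s)" if "s \<in> {t2..t}" for s
      using that \<kappa> yge[of s] y0 t20 by (intro mult_nonneg_nonneg f_nonneg) auto
    moreover have "(y has_real_derivative \<kappa> * s powr p * f (s powr - p * y s)) (at s)" if "s \<in> {t2..t}" for s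
      using that t20 by (intro dy) auto
    ultimately show ?thesis
      unfolding nn_integral_set_ennreal
      using t by (intro nn_integral_substitution[symmetric]) auto
  qed
  also have "\<dots> \<le> ennreal I"
    unfolding I(1)[symmetric] using t2 by (intro nn_integral_mono) (auto split: split_indicator)
  finally have "\<kappa> * integral {t2..t} (\<lambda>s. s powr p * f (1 * s powr - p)) \<le> I" using I by simp
  then show False using t(2) \<kappa> by (simp add: field_simps)
qed

end

section \<open>Equivalence of ODE blow-up and divergence\<close>

lemma condM_source:
  assumes "condM f" "0 < p"
  shows "source f p"
proof
  show "continuous_on {0..} f"
    using assms(1) local_lipschitz_continuous_on[of "UNIV :: real set" "{0..}" "\<lambda>_. f"] by (simp add: condM_def)
qed (use assms in \<open>auto simp: condM_def\<close>)

text \<open>The integral is nondecreasing in \<delta>, so divergence for all small \<delta> forces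
  it for every \<delta>.\<close>

lemma eventually_fujita_integral_iff:
  "(\<forall>\<^sub>F \<delta> in at_right 0. fujita_integral f p \<delta> = \<infinity>) \<longleftrightarrow> (\<forall>\<delta>>0. fujita_integral f p \<delta> = \<infinity>)"
proof
  assume "\<forall>\<^sub>F \<delta> in at_right 0. fujita_integral f p \<delta> = \<infinity>"
  then obtain b where b: "0 < b" "\<And>\<delta>. 0 < \<delta> \<Longrightarrow> \<delta> < b \<Longrightarrow> fujita_integral f p \<delta> = \<infinity>"
    by (auto simp: eventually_at_right_field)
  show "\<forall>\<delta>>0. fujita_integral f p \<delta> = \<infinity>"
  proof (intro allI impI)
    fix \<delta> :: real assume "0 < \<delta>"
    then have "fujita_integral f p (min \<delta> (b / 2)) = \<infinity>" using b by (intro b(2)) auto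
    then show "fujita_integral f p \<delta> = \<infinity>"
      using fujita_integral_mono[of "min \<delta> (b / 2)" \<delta> f p] by (simp add: top_unique)
  qed
next
  assume "\<forall>\<delta>>0. fujita_integral f p \<delta> = \<infinity>"
  then show "\<forall>\<^sub>F \<delta> in at_right 0. fujita_integral f p \<delta> = \<infinity>"
    by (auto simp: eventually_at_right_field intro!: exI[of _ 1])
qed

section \<open>Convexity of f and the two directions for the ODE\<close>

locale convex_source = source +
  assumes convex_pos: "convex_on {0<..} f"
begin

text \<open>Both points are shifted by e_k > 0 into the open half-line; the inequality there passes
  to the limit by continuity of f on the closed half-line.\<close>

lemma convex_nonneg: "convex_on {0..} f"
proof (rule convex_onI)
  fix t x y :: real
  assume t: "0 < t" "t < 1" and xy: "x \<in> {0..}" "y \<in> {0..}"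
  define e where "e k = 1 / real (Suc k)" for k
  have e: "0 < e k" "0 \<le> e k" for k by (simp_all add: e_def)
  have e0: "e \<longlonglongrightarrow> 0" unfolding e_def by real_asymp
  have lim: "(\<lambda>k. f (z + e k)) \<longlonglongrightarrow> f z" if "0 \<le> z" for z
  proof (rule continuous_on_tendsto_compose[OF cont_f])
    show "(\<lambda>k. z + e k) \<longlonglongrightarrow> z" using tendsto_add[OF tendsto_const e0, of z] by simp
  qed (use that e(2) in \<open>auto intro!: always_eventually add_nonneg_nonneg\<close>)
  show "f ((1 - t) *\<^sub>R x + t *\<^sub>R y) \<le> (1 - t) * f x + t * f y"
  proof (rule LIMSEQ_le)
    show "(\<lambda>k. f (((1 - t) *\<^sub>R x + t *\<^sub>R y) + e k)) \<longlonglongrightarrow> f ((1 - t) *\<^sub>R x + t *\<^sub>R y)"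
      using t xy by (intro lim) auto
    show "(\<lambda>k. (1 - t) * f (x + e k) + t * f (y + e k)) \<longlonglongrightarrow> (1 - t) * f x + t * f y"
      using xy by (intro tendsto_intros lim) auto
    have "f (((1 - t) *\<^sub>R x + t *\<^sub>R y) + e k) \<le> (1 - t) * f (x + e k) + t * f (y + e k)" for k
    proof -
      have "((1 - t) *\<^sub>R x + t *\<^sub>R y) + e k = (1 - t) *\<^sub>R (x + e k) + t *\<^sub>R (y + e k)"
        by (simp add: algebra_simps)
      then show ?thesis
        using convex_onD[OF convex_pos, of t "x + e k" "y + e k"] t xy e(1)[of k] by auto
    qed
    then show "\<exists>N. \<forall>n\<ge>N. f (((1 - t) *\<^sub>R x + t *\<^sub>R y) + e n) \<le> (1 - t) * f (x + e n) + t * f (y + e n)" by blast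
  qed
qed simp

text \<open>The chord of f from 0 to v starts at f 0 = 0, so convexity gives f(u) <= (u/v)
  f(v).\<close>

lemma superlinear:
  assumes "0 < u" "u \<le> v"
  shows "f u / u \<le> f v / v"
proof -
  have "f ((1 - u / v) *\<^sub>R 0 + (u / v) *\<^sub>R v) \<le> (1 - u / v) * f 0 + (u / v) * f v"
    using assms by (intro convex_onD[OF convex_nonneg]) auto
  then show ?thesis using assms by (simp add: f_0 field_simps)
qed

lemma supporting_line:
  assumes "0 < m"
  obtains c where "\<And>u. 0 \<le> u \<Longrightarrow> f m + c * (u - m) \<le> f u"
proof -
  have "m \<in> interior {0..}" using assms by (simp add: interior_Ici[of "-1"])
  from convex_le_Inf_differential[OF convex_nonneg this] show ?thesis
    by (intro that) auto
qed

text \<open>With a global solution excluded, \<open>minimal_solution\<close> leaves a solution y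
  that blows up at T; x = t^-p y inherits this because t^-p stays above T^-p on [t0,T).\<close>

lemma ode_blowup_if_divergent:
  assumes div: "\<And>\<delta>. 0 < \<delta> \<Longrightarrow> fujita_integral f p \<delta> = \<infinity>"
    and "condB f" "condS f" and x0: "0 < x0" and t0: "0 < t0"
  shows "\<exists>T>t0. \<exists>x. x t0 = x0 \<and> (\<forall>t\<in>{t0..<T}. 0 \<le> x t \<and>
      (x has_real_derivative (f (x t) - p / t * x t)) (at t within {t0..<T})) \<and> filterlim x at_top (at_left T)"
proof -
  interpret monotone_rhs "similarity_rhs f p 1" t0 using t0 by (intro similarity_rhs_monotone) auto
  define y0 where "y0 = t0 powr p * x0"
  have y0: "0 < y0" using x0 t0 by (simp add: y0_def)
  show ?thesis
  proof (cases rule: minimal_solution[of y0])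
    case (global y)
    then show ?thesis
      using no_global_similarity_solution[OF div superlinear \<open>condB f\<close> \<open>condS f\<close> zero_less_one t0 y0, of y] by blast
  next
    case (blowup T y)
    define x where "x t = t powr - p * y t" for t
    have yge: "0 < y t" if "t \<in> {t0..<T}" for t
      using volterra_ge[OF blowup(2) that] y0 by simp
    have dx: "(x has_real_derivative (f (x t) - p / t * x t)) (at t within {t0..<T})" if t: "t \<in> {t0..<T}" for t
    proof -
      have "(y has_real_derivative similarity_rhs f p 1 t (y t)) (at t within {t0..<T})"
        using t by (intro volterra_deriv[OF blowup(2), where b = "(t + T) / 2"]) auto
      then have dy: "(y has_real_derivative t powr p * f (x t)) (at t within {t0..<T})"
        using yge[OF t] by (simp add: similarity_rhs_def x_def max_absorb2)
      have "(x has_real_derivative (- p * t powr (- p - 1)) * y t + (t powr p * f (x t)) * t powr - p) (at t within {t0..<T})"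
        unfolding x_def[of t] unfolding x_def[abs_def]
        by (intro DERIV_mult dy[unfolded x_def]) (use t t0 in \<open>auto intro!: derivative_eq_intros\<close>)
      moreover have "(- p * t powr (- p - 1)) * y t + (t powr p * f (x t)) * t powr - p = f (x t) - p / t * x t"
        using t t0 by (simp add: x_def powr_diff powr_minus field_simps)
      ultimately show ?thesis by simp
    qed
    have "filterlim (\<lambda>t. T powr - p * y t) at_top (at_left T)"
      using t0 blowup(1) by (intro filterlim_tendsto_pos_mult_at_top[OF tendsto_const _ blowup(3)]) auto
    moreover have "eventually (\<lambda>t. T powr - p * y t \<le> x t) (at_left T)"
    proof (rule eventually_at_leftI[OF _ blowup(1)])
      fix t assume "t \<in> {t0<..<T}"
      then show "T powr - p * y t \<le> x t"
        unfolding x_def using yge[of t] t0 p by (intro mult_right_mono powr_mono2') auto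
    qed
    ultimately have "filterlim x at_top (at_left T)" by (rule filterlim_at_top_mono)
    moreover have "x t0 = x0"
    proof -
      have "y t0 = y0" using blowup(1,2) by (simp add: volterra_def)
      then show ?thesis using t0 by (simp add: x_def y0_def powr_minus)
    qed
    ultimately show ?thesis
      using blowup(1) dx yge by (intro exI[of _ T] conjI exI[of _ x]) (auto simp: x_def[of t for t] less_imp_le)
  qed
qed

end

context source
begin

text \<open>Starting from A/2, as long as y <= A one has y' <= t^p f(A t^-p), whose total integral
  is at most A/4; so y stays below 3A/4 and never attains A.\<close>

lemma no_ode_blowup_if_convergent:
  assumes A: "0 < A" and int: "(\<integral>\<^sup>+s\<in>{1..}. ennreal (s powr p * f (A * s powr - p)) \<partial>lborel) \<le> ennreal (1 / 4 * A)"
    and x1: "x 1 = A / 2"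
    and x: "\<And>t. t \<in> {1..<T} \<Longrightarrow> 0 \<le> x t \<and> (x has_real_derivative (f (x t) - p / t * x t)) (at t within {1..<T})"
    and T: "1 < T"
  shows "\<not> filterlim x at_top (at_left T)"
proof -
  define y where "y t = t powr p * x t" for t
  have dy: "(y has_real_derivative t powr p * f (x t)) (at t within {1..<T})" if t: "t \<in> {1..<T}" for t
  proof -
    have "(y has_real_derivative (p * t powr (p - 1)) * x t + (f (x t) - p / t * x t) * t powr p) (at t within {1..<T})"
      unfolding y_def using x[OF t] by (intro DERIV_mult conjunct2[OF x[OF t]]) (use t in \<open>auto intro!: derivative_eq_intros\<close>)
    moreover have "(p * t powr (p - 1)) * x t + (f (x t) - p / t * x t) * t powr p = t powr p * f (x t)"
      using t by (simp add: powr_diff field_simps)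
    ultimately show ?thesis by simp
  qed
  have conty: "continuous_on {1..<T} y" using dy by (rule DERIV_continuous_on)
  have contx: "continuous_on {1..<T} x" using x by (intro DERIV_continuous_on) blast
  have small: "y t < A" if t: "t \<in> {1..<T}" for t
  proof (rule ccontr)
    assume "\<not> y t < A"
    define D where "D = {s \<in> {1..t}. A \<le> y s}"
    have "closed D" unfolding D_def
      using t by (intro continuous_on_closed_Collect_le continuous_on_subset[OF conty] continuous_on_const closed_atLeastAtMost) auto
    moreover have "t \<in> D" using t \<open>\<not> y t < A\<close> by (simp add: D_def)
    moreover have bdd: "bdd_below D" by (auto simp: D_def intro!: bdd_belowI[of _ 1])
    ultimately have "Inf D \<in> D" by (intro closed_contains_Inf) auto
    define r where "r = Inf D"
    have r: "1 \<le> r" "r \<le> t" "A \<le> y r" using \<open>Inf D \<in> D\<close> by (auto simp: r_def D_def)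
    have before: "y s \<le> A" if "s \<in> {1..<r}" for s
    proof (rule ccontr)
      assume "\<not> y s \<le> A"
      then have "s \<in> D" using that r by (auto simp: D_def)
      then have "r \<le> s" unfolding r_def by (intro cInf_lower bdd)
      then show False using that by simp
    qed
    have FTC: "((\<lambda>s. s powr p * f (x s)) has_integral (y r - y 1)) {1..r}"
    proof (rule fundamental_theorem_of_calculus[OF r(1)])
      fix s assume "s \<in> {1..r}"
      then show "(y has_vector_derivative s powr p * f (x s)) (at s within {1..r})"
        using r t unfolding has_real_derivative_iff_has_vector_derivative[symmetric]
        by (intro has_field_derivative_subset[OF dy]) auto
    qed
    have "y r - y 1 = integral {1..r} (\<lambda>s. s powr p * f (x s))"
      using FTC by (simp add: integral_unique)
    \<comment> \<open>The bound y <= A is available strictly before the first time r with y r >= A,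
      hence the null endpoint is dropped.\<close>
    also have "\<dots> = integral {1..<r} (\<lambda>s. s powr p * f (x s))"
      by (rule integral_spike_set) (auto intro: negligible_subset[of "{r}"])
    also have "\<dots> \<le> integral {1..<r} (\<lambda>s. s powr p * f (A * s powr - p))"
    proof (rule integral_le)
      show "(\<lambda>s. s powr p * f (x s)) integrable_on {1..<r}"
        using FTC by (subst integrable_spike_set_eq[of _ "{1..r}"]) (auto intro: negligible_subset[of "{r}"] has_integral_integrable)
      have "(\<lambda>s. s powr p * f (A * s powr - p)) integrable_on {1..r}"
        using A by (intro integrable_continuous_real continuous_profile) auto
      then show "(\<lambda>s. s powr p * f (A * s powr - p)) integrable_on {1..<r}"
        by (subst integrable_spike_set_eq[of _ "{1..r}"]) (auto intro: negligible_subset[of "{r}"])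
      fix s assume s: "s \<in> {1..<r}"
      have "x s = y s * s powr - p" using s by (simp add: y_def powr_minus)
      also have "\<dots> \<le> A * s powr - p" by (intro mult_right_mono before s) simp
      finally show "s powr p * f (x s) \<le> s powr p * f (A * s powr - p)"
        using x[of s] s r t by (intro mult_left_mono f_mono) auto
    qed
    also have "\<dots> = integral {1..r} (\<lambda>s. s powr p * f (A * s powr - p))"
      by (rule integral_spike_set) (auto intro: negligible_subset[of "{r}"])
    also have "\<dots> \<le> 1 / 4 * A"
    proof -
      have "ennreal (integral {1..r} (\<lambda>s. s powr p * f (A * s powr - p))) = (\<integral>\<^sup>+s\<in>{1..r}. ennreal (s powr p * f (A * s powr - p)) \<partial>lborel)"
        using A by (intro nn_integral_Icc_eq_integral[symmetric] continuous_profile) (auto intro!: mult_nonneg_nonneg f_nonneg)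
      also have "\<dots> \<le> (\<integral>\<^sup>+s\<in>{1..}. ennreal (s powr p * f (A * s powr - p)) \<partial>lborel)"
        by (intro nn_integral_mono) (auto split: split_indicator)
      also note int
      finally show ?thesis using A by (subst (asm) ennreal_le_iff) auto
    qed
    finally show False using r(3) x1 A by (simp add: y_def)
  qed
  have bound: "x t \<le> A" if "t \<in> {1..<T}" for t
  proof -
    have "1 * x t \<le> t powr p * x t"
      using that p x[OF that] by (intro mult_right_mono ge_one_powr_ge_zero) auto
    then show ?thesis using small[OF that] by (simp add: y_def)
  qed
  show ?thesis
  proof
    assume "filterlim x at_top (at_left T)"
    then have "eventually (\<lambda>t. A < x t) (at_left T)" by (simp add: filterlim_at_top_dense)
    moreover have "eventually (\<lambda>t. t \<in> {1<..<T}) (at_left T)" by (rule eventually_at_leftI[OF _ T])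
    ultimately have "eventually (\<lambda>t. A < x t \<and> t \<in> {1<..<T}) (at_left T)" by (rule eventually_conj)
    from eventually_happens'[OF trivial_limit_at_left_real this]
    obtain t where "A < x t" "t \<in> {1<..<T}" by auto
    then show False using bound[of t] by auto
  qed
qed

end

lemma (in convex_source) ode_blowup_iff_divergent:
  fixes n :: nat
  assumes "p = real n / \<alpha>" "0 < \<alpha>" "condB f" "condS f"
  shows "ode_blowup_property n \<alpha> f \<longleftrightarrow> (\<forall>\<delta>>0. fujita_integral f p \<delta> = \<infinity>)"
proof
  have pt: "real n / (\<alpha> * t) = p / t" for t using assms(1) by simp
  {
    assume "\<forall>\<delta>>0. fujita_integral f p \<delta> = \<infinity>"
    then show "ode_blowup_property n \<alpha> f"
      unfolding ode_blowup_property_def pt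
      by (intro allI impI ode_blowup_if_divergent assms) auto
  next
    assume ode: "ode_blowup_property n \<alpha> f"
    show "\<forall>\<delta>>0. fujita_integral f p \<delta> = \<infinity>"
    proof (rule ccontr)
      assume "\<not> ?thesis"
      then obtain \<delta> where \<delta>: "0 < \<delta>" "fujita_integral f p \<delta> < \<infinity>" by (auto simp: less_top)
      obtain A where A: "0 < A" "(\<integral>\<^sup>+s\<in>{1..}. ennreal (s powr p * f (A * s powr - p)) \<partial>lborel) \<le> ennreal (1 / 4 * A)"
        using fujita_convergent[OF \<delta>, of "1 / 4"] by auto
      obtain T x where "1 < T" "x 1 = A / 2" "filterlim x at_top (at_left T)"
        "\<forall>t\<in>{1..<T}. 0 \<le> x t \<and> (x has_real_derivative (f (x t) - p / t * x t)) (at t within {1..<T})"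
        using ode[unfolded ode_blowup_property_def pt, rule_format, of "A / 2" 1] A by auto
      then show False using no_ode_blowup_if_convergent[OF A, of x T] by blast
    qed
  }
qed

section \<open>Lower bounds for mild solutions\<close>

text \<open>The heat semigroup with values in [0,oo], where Tonelli and monotone convergence apply
  without integrability conditions.\<close>

definition nn_heat :: "real \<Rightarrow> real \<Rightarrow> ('a::euclidean_space \<Rightarrow> ennreal) \<Rightarrow> 'a \<Rightarrow> ennreal" where
  "nn_heat \<alpha> t \<psi> x = (\<integral>\<^sup>+y. ennreal (stable_kernel \<alpha> t (x - y)) * \<psi> y \<partial>lborel)"

lemma nn_heat_mono: "(\<And>y. \<phi> y \<le> \<psi> y) \<Longrightarrow> nn_heat \<alpha> t \<phi> x \<le> nn_heat \<alpha> t \<psi> x"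
  unfolding nn_heat_def by (intro nn_integral_mono mult_left_mono) auto

locale stable =
  fixes \<alpha> :: real
  assumes \<alpha>: "0 < \<alpha>" "\<alpha> \<le> 2"
begin

lemma kernel_measurable [measurable (raw)]:
  fixes g :: "'b \<Rightarrow> 'a::euclidean_space"
  assumes "\<tau> \<in> borel_measurable M" "g \<in> borel_measurable M"
  shows "(\<lambda>z. stable_kernel \<alpha> (\<tau> z) (g z)) \<in> borel_measurable M"
proof -
  have "(\<lambda>z. (\<tau> z, g z)) \<in> measurable M borel"
    using assms unfolding borel_prod[symmetric] by measurable
  from measurable_compose[OF this stable_kernel_measurable[OF \<alpha>]] show ?thesis by simp
qed

lemma nn_heat_measurable [measurable (raw)]:
  fixes g :: "'b \<Rightarrow> 'a::euclidean_space"
  assumes [measurable]: "\<tau> \<in> borel_measurable M" "g \<in> borel_measurable M"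
    "(\<lambda>(z, y). \<psi> z y) \<in> borel_measurable (M \<Otimes>\<^sub>M borel)"
  shows "(\<lambda>z. nn_heat \<alpha> (\<tau> z) (\<psi> z) (g z)) \<in> borel_measurable M"
  unfolding nn_heat_def by measurable

lemma kernel_integrable_shift:
  fixes x :: "'a::euclidean_space"
  assumes "0 < t"
  shows "integrable lborel (\<lambda>y. stable_kernel \<alpha> t (x - y))" "(\<integral>y. stable_kernel \<alpha> t (x - y) \<partial>lborel) = 1"
proof -
  have m: "stable_kernel \<alpha> t \<in> borel_measurable (borel :: 'a measure)" by measurable
  show "integrable lborel (\<lambda>y. stable_kernel \<alpha> t (x - y))"
    using lborel_integral_affine(2)[OF _ m, of "-1" x] stable_kernel_transform(1)[OF \<alpha> assms, where 'a = 'a] by simp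
  show "(\<integral>y. stable_kernel \<alpha> t (x - y) \<partial>lborel) = 1"
    using lborel_integral_affine(1)[OF _ m, of "-1" x] stable_kernel_integral[OF \<alpha> assms, where 'a = 'a] by simp
qed

lemma nn_kernel_semigroup:
  fixes x :: "'a::euclidean_space"
  assumes s: "0 < s" and t: "0 < t"
  shows "nn_heat \<alpha> s (\<lambda>y. ennreal (stable_kernel \<alpha> t y)) x = ennreal (stable_kernel \<alpha> (s + t) x)"
proof -
  let ?g = "\<lambda>y. stable_kernel \<alpha> s (x - y) * stable_kernel \<alpha> t y"
  have nn: "0 \<le> stable_kernel \<alpha> r y" if "0 < r" for r and y :: 'a
    by (rule stable_kernel_nonneg[OF \<alpha> that])
  have int: "integrable lborel ?g"
  proof (rule Bochner_Integration.integrable_bound)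
    define C where "C = s powr (- real DIM('a) / \<alpha>) * stable_kernel \<alpha> 1 (0::'a)"
    show "integrable lborel (\<lambda>y::'a. C * stable_kernel \<alpha> t y)"
      by (intro integrable_mult_right stable_kernel_transform \<alpha> t)
    have "stable_kernel \<alpha> s y \<le> C" for y :: 'a unfolding C_def by (rule stable_kernel_le[OF \<alpha> s])
    then show "AE y in lborel. norm (?g y) \<le> norm (C * stable_kernel \<alpha> t y)"
      using nn[OF s] nn[OF t] order_trans[OF nn[OF s]]
      by (auto simp: abs_mult intro!: AE_I2 mult_right_mono intro: order_trans)
  qed measurable
  have "nn_heat \<alpha> s (\<lambda>y. ennreal (stable_kernel \<alpha> t y)) x = (\<integral>\<^sup>+y. ennreal (?g y) \<partial>lborel)"
    unfolding nn_heat_def using nn s t by (intro nn_integral_cong) (simp add: ennreal_mult)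
  also have "\<dots> = ennreal (integral\<^sup>L lborel ?g)"
    using nn s t by (intro nn_integral_eq_integral int) auto
  finally show ?thesis by (simp add: stable_kernel_semigroup[OF \<alpha> s t])
qed

text \<open>The kernel is even, so the semigroup is symmetric and can be moved onto K(t), which it
  carries to K(s + t).\<close>

lemma kernel_pairing_nn_heat:
  fixes \<psi> :: "'a::euclidean_space \<Rightarrow> ennreal"
  assumes s: "0 < s" and t: "0 < t" and [measurable]: "\<psi> \<in> borel_measurable borel"
  shows "(\<integral>\<^sup>+x. ennreal (stable_kernel \<alpha> t x) * nn_heat \<alpha> s \<psi> x \<partial>lborel)
    = (\<integral>\<^sup>+y. ennreal (stable_kernel \<alpha> (s + t) y) * \<psi> y \<partial>lborel)"
proof -
  have "(\<integral>\<^sup>+x. ennreal (stable_kernel \<alpha> t x) * nn_heat \<alpha> s \<psi> x \<partial>lborel)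
    = (\<integral>\<^sup>+x. \<integral>\<^sup>+y. ennreal (stable_kernel \<alpha> t x) * (ennreal (stable_kernel \<alpha> s (x - y)) * \<psi> y) \<partial>lborel \<partial>lborel)"
    unfolding nn_heat_def by (subst nn_integral_cmult) auto
  also have "\<dots> = (\<integral>\<^sup>+y. \<integral>\<^sup>+x. ennreal (stable_kernel \<alpha> t x) * (ennreal (stable_kernel \<alpha> s (x - y)) * \<psi> y) \<partial>lborel \<partial>lborel)"
    by (rule lborel_pair.Fubini') measurable
  also have "\<dots> = (\<integral>\<^sup>+y. nn_heat \<alpha> s (\<lambda>x. ennreal (stable_kernel \<alpha> t x)) y * \<psi> y \<partial>lborel)"
  proof (intro nn_integral_cong)
    fix y
    have "(\<integral>\<^sup>+x. ennreal (stable_kernel \<alpha> t x) * (ennreal (stable_kernel \<alpha> s (x - y)) * \<psi> y) \<partial>lborel)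
      = (\<integral>\<^sup>+x. (ennreal (stable_kernel \<alpha> s (y - x)) * ennreal (stable_kernel \<alpha> t x)) * \<psi> y \<partial>lborel)"
      using stable_kernel_uminus[OF \<alpha>, of s "y - x" for x] by (intro nn_integral_cong) (simp add: mult_ac)
    also have "\<dots> = nn_heat \<alpha> s (\<lambda>x. ennreal (stable_kernel \<alpha> t x)) y * \<psi> y"
      unfolding nn_heat_def by (rule nn_integral_multc) measurable
    finally show "(\<integral>\<^sup>+x. ennreal (stable_kernel \<alpha> t x) * (ennreal (stable_kernel \<alpha> s (x - y)) * \<psi> y) \<partial>lborel)
      = nn_heat \<alpha> s (\<lambda>x. ennreal (stable_kernel \<alpha> t x)) y * \<psi> y" .
  qed
  finally show ?thesis by (simp add: nn_kernel_semigroup[OF s t])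
qed

lemma nn_heat_const:
  assumes "0 < t"
  shows "nn_heat \<alpha> t (\<lambda>_. c) (x :: 'a::euclidean_space) = c"
proof -
  have "nn_heat \<alpha> t (\<lambda>_. c) x = (\<integral>\<^sup>+y. ennreal (stable_kernel \<alpha> t (x - y)) \<partial>lborel) * c"
    unfolding nn_heat_def by (rule nn_integral_multc) measurable
  also have "(\<integral>\<^sup>+y. ennreal (stable_kernel \<alpha> t (x - y)) \<partial>lborel) = 1"
    using nn_integral_eq_integral[OF kernel_integrable_shift(1)[OF assms, of x]] kernel_integrable_shift(2)[OF assms, of x]
    by (simp add: stable_kernel_nonneg[OF \<alpha> assms])
  finally show ?thesis by simp
qed

lemma heat_semigroup_eq_nn_heat:
  fixes \<phi> :: "real^'n \<Rightarrow> real"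
  assumes t: "0 < t" and [measurable]: "\<phi> \<in> borel_measurable borel" and \<phi>: "\<And>y. 0 \<le> \<phi> y" "\<And>y. \<phi> y \<le> C"
  shows "ennreal (heat_semigroup \<alpha> t \<phi> x) = nn_heat \<alpha> t (\<lambda>y. ennreal (\<phi> y)) x"
    and "heat_semigroup \<alpha> t \<phi> x = enn2real (nn_heat \<alpha> t (\<lambda>y. ennreal (\<phi> y)) x)"
    and "nn_heat \<alpha> t (\<lambda>y. ennreal (\<phi> y)) x \<le> ennreal C"
proof -
  let ?g = "\<lambda>y. stable_kernel \<alpha> t (x - y) * \<phi> y"
  have nn: "0 \<le> stable_kernel \<alpha> t y" for y :: "real^'n" by (rule stable_kernel_nonneg[OF \<alpha> t])
  have int: "integrable lborel ?g"
  proof (rule Bochner_Integration.integrable_bound)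
    show "integrable lborel (\<lambda>y. C * stable_kernel \<alpha> t (x - y))"
      by (intro integrable_mult_right kernel_integrable_shift t)
    show "AE y in lborel. norm (?g y) \<le> norm (C * stable_kernel \<alpha> t (x - y))"
      using nn \<phi> order_trans[OF \<phi>(1) \<phi>(2)]
      by (auto simp: abs_mult mult.commute intro!: AE_I2 mult_mono)
  qed measurable
  have "heat_semigroup \<alpha> t \<phi> x = (\<integral>y. ?g y \<partial>lborel)"
    unfolding heat_semigroup_def heat_kernel_eq_stable_kernel[OF \<alpha> t] using t
    by (simp, intro integral_completion) measurable
  also have "ennreal \<dots> = (\<integral>\<^sup>+y. ennreal (?g y) \<partial>lborel)"
    using nn \<phi> by (intro nn_integral_eq_integral[symmetric] int) auto
  also have "\<dots> = nn_heat \<alpha> t (\<lambda>y. ennreal (\<phi> y)) x"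
    unfolding nn_heat_def using nn \<phi> by (intro nn_integral_cong) (simp add: ennreal_mult)
  finally show eq: "ennreal (heat_semigroup \<alpha> t \<phi> x) = nn_heat \<alpha> t (\<lambda>y. ennreal (\<phi> y)) x" .
  have "0 \<le> heat_semigroup \<alpha> t \<phi> x"
    unfolding heat_semigroup_def heat_kernel_eq_stable_kernel[OF \<alpha> t] using t nn \<phi>
    by (auto intro!: Bochner_Integration.integral_nonneg)
  then show "heat_semigroup \<alpha> t \<phi> x = enn2real (nn_heat \<alpha> t (\<lambda>y. ennreal (\<phi> y)) x)"
    by (simp flip: eq)
  have "nn_heat \<alpha> t (\<lambda>y. ennreal (\<phi> y)) x \<le> nn_heat \<alpha> t (\<lambda>y. ennreal C) x"
    using \<phi> by (intro nn_heat_mono ennreal_leI)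
  then show "nn_heat \<alpha> t (\<lambda>y. ennreal (\<phi> y)) x \<le> ennreal C" by (simp add: nn_heat_const[OF t])
qed

text \<open>Translates the Bochner integral of the mild formula into one for Tonelli. At s = t the
  semigroup is the identity by the case distinction in its definition, which \<open>nn_heat\<close>
  at time 0 does not represent; hence the half-open interval, different from the closed one by a
  null set.\<close>

lemma duhamel_eq_nn_integral:
  fixes w :: "real \<Rightarrow> real^'n \<Rightarrow> real"
  assumes [measurable]: "(\<lambda>(s, y). w s y) \<in> borel_measurable (borel \<Otimes>\<^sub>M borel)"
    and w: "\<And>s y. s \<in> {0..t} \<Longrightarrow> 0 \<le> w s y" "\<And>s y. s \<in> {0..t} \<Longrightarrow> w s y \<le> C"
  shows "ennreal (LINT s:{0..t}|lebesgue. heat_semigroup \<alpha> (t - s) (w s) x)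
    = (\<integral>\<^sup>+s\<in>{0..<t}. nn_heat \<alpha> (t - s) (\<lambda>y. ennreal (w s y)) x \<partial>lborel)"
    and "0 \<le> (LINT s:{0..t}|lebesgue. heat_semigroup \<alpha> (t - s) (w s) x)"
proof -
  define N where "N s = indicator {0..<t} s * enn2real (nn_heat \<alpha> (t - s) (\<lambda>y. ennreal (w s y)) x)" for s
  have hs: "heat_semigroup \<alpha> (t - s) (w s) x = enn2real (nn_heat \<alpha> (t - s) (\<lambda>y. ennreal (w s y)) x)"
    "nn_heat \<alpha> (t - s) (\<lambda>y. ennreal (w s y)) x \<le> ennreal C" if s: "s \<in> {0..<t}" for s
  proof -
    have [measurable]: "w s \<in> borel_measurable borel" by measurable
    show "heat_semigroup \<alpha> (t - s) (w s) x = enn2real (nn_heat \<alpha> (t - s) (\<lambda>y. ennreal (w s y)) x)"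
      using s w[of s] by (intro heat_semigroup_eq_nn_heat(2)[where C = C]) auto
    show "nn_heat \<alpha> (t - s) (\<lambda>y. ennreal (w s y)) x \<le> ennreal C"
      using s w[of s] by (intro heat_semigroup_eq_nn_heat(3)) auto
  qed
  have [measurable]: "N \<in> borel_measurable borel" unfolding N_def by measurable
  have Nn: "0 \<le> N s" for s by (simp add: N_def)
  have int: "integrable lborel N"
  proof (rule Bochner_Integration.integrable_bound)
    show "integrable lborel (\<lambda>s. \<bar>C\<bar> * indicator {0..t} s :: real)"
      by (intro integrable_mult_right integrable_real_indicator) (auto simp: emeasure_lborel_Icc_eq)
    have "N s \<le> \<bar>C\<bar> * indicator {0..t} s" for s
    proof (cases "s \<in> {0..<t}")
      case True
      have "enn2real (nn_heat \<alpha> (t - s) (\<lambda>y. ennreal (w s y)) x) \<le> \<bar>C\<bar>"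
        by (rule enn2real_leI) (use order_trans[OF hs(2)[OF True], of "ennreal \<bar>C\<bar>"] in \<open>auto intro: ennreal_leI\<close>)
      then show ?thesis using True by (simp add: N_def)
    qed (auto simp: N_def)
    then show "AE s in lborel. norm (N s) \<le> norm (\<bar>C\<bar> * indicator {0..t} s :: real)"
      using Nn by (auto intro!: AE_I2 simp: abs_mult)
  qed measurable
  have "(LINT s:{0..t}|lebesgue. heat_semigroup \<alpha> (t - s) (w s) x) = (\<integral>s. N s \<partial>lebesgue)"
    unfolding set_lebesgue_integral_def
  proof (rule integral_cong_AE)
    have ae: "AE s in lebesgue. indicator {0..t} s *\<^sub>R heat_semigroup \<alpha> (t - s) (w s) x = N s"
    proof (rule AE_completion)
      show "AE s in lborel. indicator {0..t} s *\<^sub>R heat_semigroup \<alpha> (t - s) (w s) x = N s"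
        using AE_lborel_singleton[of t]
      proof eventually_elim
        case (elim s)
        then show ?case using hs(1)[of s] by (auto simp: N_def split: split_indicator)
      qed
    qed
    show N: "N \<in> borel_measurable lebesgue" by (rule measurable_completion) simp
    show "(\<lambda>s. indicator {0..t} s *\<^sub>R heat_semigroup \<alpha> (t - s) (w s) x) \<in> borel_measurable lebesgue"
    proof (rule measurable_completion)
      have "(\<lambda>s. indicator {0..t} s *\<^sub>R heat_semigroup \<alpha> (t - s) (w s) x)
        = (\<lambda>s. if s = t \<and> 0 \<le> t then heat_semigroup \<alpha> 0 (w t) x else N s)"
        using hs(1) by (auto simp: N_def fun_eq_iff split: split_indicator)
      also have "\<dots> \<in> borel_measurable lborel" by measurable
      finally show "(\<lambda>s. indicator {0..t} s *\<^sub>R heat_semigroup \<alpha> (t - s) (w s) x) \<in> borel_measurable lborel" .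
    qed
    show "AE s in lebesgue. indicator {0..t} s *\<^sub>R heat_semigroup \<alpha> (t - s) (w s) x = N s" by (rule ae)
  qed
  also have "\<dots> = (\<integral>s. N s \<partial>lborel)" by (rule integral_completion) simp
  finally have eq: "(LINT s:{0..t}|lebesgue. heat_semigroup \<alpha> (t - s) (w s) x) = (\<integral>s. N s \<partial>lborel)" .
  show "0 \<le> (LINT s:{0..t}|lebesgue. heat_semigroup \<alpha> (t - s) (w s) x)"
    unfolding eq using Nn by simp
  have "ennreal (\<integral>s. N s \<partial>lborel) = (\<integral>\<^sup>+s. ennreal (N s) \<partial>lborel)"
    using Nn int by (intro nn_integral_eq_integral[symmetric]) auto
  also have "\<dots> = (\<integral>\<^sup>+s\<in>{0..<t}. nn_heat \<alpha> (t - s) (\<lambda>y. ennreal (w s y)) x \<partial>lborel)"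
  proof (intro nn_integral_cong)
    fix s
    show "ennreal (N s) = nn_heat \<alpha> (t - s) (\<lambda>y. ennreal (w s y)) x * indicator {0..<t} s"
    proof (cases "s \<in> {0..<t}")
      case True
      have "nn_heat \<alpha> (t - s) (\<lambda>y. ennreal (w s y)) x < \<infinity>"
        using hs(2)[OF True] by (simp add: le_less_trans)
      then show ?thesis using True by (simp add: N_def)
    qed (simp add: N_def)
  qed
  finally show "ennreal (LINT s:{0..t}|lebesgue. heat_semigroup \<alpha> (t - s) (w s) x)
    = (\<integral>\<^sup>+s\<in>{0..<t}. nn_heat \<alpha> (t - s) (\<lambda>y. ennreal (w s y)) x \<partial>lborel)"
    unfolding eq .
qed

end

context stable
begin

lemma kernel_average:
  fixes v :: "'a::euclidean_space \<Rightarrow> real"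
  assumes s: "0 < s" and [measurable]: "v \<in> borel_measurable borel" and v: "\<And>y. 0 \<le> v y" "\<And>y. v y \<le> M"
  shows "integrable lborel (\<lambda>y. stable_kernel \<alpha> s y * v y)"
    and "ennreal (\<integral>y. stable_kernel \<alpha> s y * v y \<partial>lborel) = (\<integral>\<^sup>+y. ennreal (stable_kernel \<alpha> s y) * ennreal (v y) \<partial>lborel)"
    and "0 \<le> (\<integral>y. stable_kernel \<alpha> s y * v y \<partial>lborel)"
    and "(\<integral>y. stable_kernel \<alpha> s y * v y \<partial>lborel) \<le> M"
proof -
  have nn: "0 \<le> stable_kernel \<alpha> s y" for y :: 'a by (rule stable_kernel_nonneg[OF \<alpha> s])
  have M: "integrable lborel (\<lambda>y::'a. stable_kernel \<alpha> s y * M)"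
    by (intro integrable_mult_left stable_kernel_transform \<alpha> s)
  show int: "integrable lborel (\<lambda>y. stable_kernel \<alpha> s y * v y)"
    by (rule Bochner_Integration.integrable_bound[OF M])
      (use nn v order_trans[OF v(1) v(2)] in \<open>auto simp: abs_mult intro!: mult_left_mono\<close>)
  show "ennreal (\<integral>y. stable_kernel \<alpha> s y * v y \<partial>lborel) = (\<integral>\<^sup>+y. ennreal (stable_kernel \<alpha> s y) * ennreal (v y) \<partial>lborel)"
    using nn v by (subst nn_integral_eq_integral[OF int, symmetric]) (auto simp: ennreal_mult)
  show "0 \<le> (\<integral>y. stable_kernel \<alpha> s y * v y \<partial>lborel)" using nn v by simp
  have "(\<integral>y. stable_kernel \<alpha> s y * v y \<partial>lborel) \<le> (\<integral>y. stable_kernel \<alpha> s (y::'a) * M \<partial>lborel)"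
    using nn v by (intro integral_mono int M mult_left_mono)
  also have "\<dots> = M" using stable_kernel_integral[OF \<alpha> s, where 'a = 'a] by simp
  finally show "(\<integral>y. stable_kernel \<alpha> s y * v y \<partial>lborel) \<le> M" .
qed

end

section \<open>The mean of a mild solution against the kernel\<close>

locale fujita_pde = convex_source f p + stable \<alpha> for f p \<alpha>
begin

text \<open>K(s) is a probability density, so integrating a supporting line of f at the mean m
  against it gives f(m) on the left.\<close>

lemma jensen:
  fixes v :: "'a::euclidean_space \<Rightarrow> real"
  assumes s: "0 < s" and [measurable]: "v \<in> borel_measurable borel" and v: "\<And>y. 0 \<le> v y" "\<And>y. v y \<le> M"
  shows "ennreal (f (\<integral>y. stable_kernel \<alpha> s y * v y \<partial>lborel)) \<le> (\<integral>\<^sup>+y. ennreal (stable_kernel \<alpha> s y) * ennreal (f (v y)) \<partial>lborel)"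
proof -
  define m where "m = (\<integral>y. stable_kernel \<alpha> s y * v y \<partial>lborel)"
  have m0: "0 \<le> m" unfolding m_def using assms by (rule kernel_average(3))
  have fv: "(\<lambda>y. f (v y)) \<in> borel_measurable borel"
    using measurable_compose[OF assms(2) f_clamp_measurable] v(1) by (simp add: max_absorb2)
  note favg = kernel_average[OF s fv f_nonneg[OF v(1)] f_mono[OF v(1) v(2)]]
  have int: "integrable lborel (\<lambda>y::'a. stable_kernel \<alpha> s y)" by (rule stable_kernel_transform(1)[OF \<alpha> s])
  note vint = kernel_average(1)[OF assms]
  have "f m \<le> (\<integral>y. stable_kernel \<alpha> s y * f (v y) \<partial>lborel)"
  \<comment> \<open>A mean of 0 is a boundary point of the domain, out of reach of
    \<open>supporting_line\<close>; there f m = 0.\<close>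
  proof (cases "m = 0")
    case True
    then show ?thesis using favg(3) f_0 by simp
  next
    case False
    then obtain c where c: "\<And>u. 0 \<le> u \<Longrightarrow> f m + c * (u - m) \<le> f u"
      using supporting_line[of m] m0 by auto
    have "f m = (\<integral>y. (f m - c * m) * stable_kernel \<alpha> s (y::'a) + c * (stable_kernel \<alpha> s y * v y) \<partial>lborel)"
      by (subst Bochner_Integration.integral_add)
        (simp_all add: int vint stable_kernel_integral[OF \<alpha> s] m_def[symmetric])
    also have "\<dots> \<le> (\<integral>y. stable_kernel \<alpha> s y * f (v y) \<partial>lborel)"
    proof (intro integral_mono favg)
      show "integrable lborel (\<lambda>y. (f m - c * m) * stable_kernel \<alpha> s (y::'a) + c * (stable_kernel \<alpha> s y * v y))"
        by (intro Bochner_Integration.integrable_add integrable_mult_right int vint)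
      fix y
      have "stable_kernel \<alpha> s y * (f m + c * (v y - m)) \<le> stable_kernel \<alpha> s y * f (v y)"
        by (intro mult_left_mono c v stable_kernel_nonneg \<alpha> s)
      then show "(f m - c * m) * stable_kernel \<alpha> s y + c * (stable_kernel \<alpha> s y * v y) \<le> stable_kernel \<alpha> s y * f (v y)"
        by (simp add: algebra_simps)
    qed
    finally show ?thesis .
  qed
  then show ?thesis unfolding favg(2)[symmetric] m_def[symmetric] by (rule ennreal_leI)
qed

text \<open>Extension by 0 outside [0,T) makes the solution jointly Borel on the whole product,
  ready for Tonelli.\<close>

definition extended :: "ereal \<Rightarrow> (real \<Rightarrow> 'a::euclidean_space \<Rightarrow> real) \<Rightarrow> real \<Rightarrow> 'a \<Rightarrow> real" where
  "extended T u s y = (if 0 \<le> s \<and> ereal s < T then u s y else 0)"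

text \<open>The weight carries the same time s as the solution: pairing at time t lets the source
  from time s see K(2t - s), which is comparable with the weight K(s) of the mean at time s.\<close>

definition kernel_mean :: "ereal \<Rightarrow> (real \<Rightarrow> 'a::euclidean_space \<Rightarrow> real) \<Rightarrow> real \<Rightarrow> real" where
  "kernel_mean T u s = (\<integral>y. stable_kernel \<alpha> s y * extended T u s y \<partial>lborel)"

lemma extended_measurable [measurable]:
  assumes "mild_solution \<alpha> f \<phi> T u"
  shows "(\<lambda>(s, y). extended T u s y) \<in> borel_measurable (borel \<Otimes>\<^sub>M borel)"
proof -
  let ?\<Omega> = "{t. 0 \<le> t \<and> ereal t < T} \<times> (UNIV :: (real^'n) set)"
  have "?\<Omega> \<in> sets borel"
    unfolding borel_prod[symmetric] by (intro pair_measureI) auto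
  then have "(\<lambda>z. if z \<in> ?\<Omega> then (case z of (t, x) \<Rightarrow> u t x) else 0) \<in> borel_measurable borel"
    using assms unfolding mild_solution_def
    by (subst (asm) measurable_restrict_space_iff[where c = 0]) auto
  moreover have "(\<lambda>z. if z \<in> ?\<Omega> then (case z of (t, x) \<Rightarrow> u t x) else 0) = (\<lambda>(s, y). extended T u s y)"
    by (auto simp: extended_def fun_eq_iff)
  ultimately show ?thesis by (simp add: borel_prod)
qed

lemma extended_bounded:
  assumes u: "mild_solution \<alpha> f \<phi> T u" and t: "0 < t" "ereal t < T"
  obtains M where "\<And>s y. s \<in> {0..t} \<Longrightarrow> extended T u s y \<le> M" "\<And>s y. 0 \<le> extended T u s y"
proof -
  have "bounded ((\<lambda>(t, x). u t x) ` ({0..t} \<times> UNIV))"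
    using u t by (simp add: mild_solution_def)
  then obtain M where "\<forall>s\<in>{0..t}. \<forall>y. \<bar>u s y\<bar> \<le> M"
    by (auto simp: bounded_iff)
  then have M: "\<bar>u s y\<bar> \<le> M" if "s \<in> {0..t}" for s y using that by blast
  have lt: "ereal s < T" if "s \<le> t" for s using that t(2) by (meson ereal_less_eq(3) le_less_trans)
  show ?thesis
  proof (rule that)
    show "extended T u s y \<le> M" if "s \<in> {0..t}" for s y
      using M[OF that, of y] lt that by (auto simp: extended_def)
    show "0 \<le> extended T u s y" for s y
      using u by (auto simp: extended_def mild_solution_def)
  qed
qed

text \<open>The mild formula is paired with K(t). The datum then sees K(2t), the source at time s
  sees K(2t - s) >= (s/2t)^p K(s), and Jensen's inequality moves the mean inside f. Here
  \<open>\<psi>\<close> is a bounded nonnegative Borel version of the datum.\<close>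

lemma kernel_mean_lower_bound:
  fixes \<phi> \<psi> :: "real^'n \<Rightarrow> real"
  assumes p_eq: "p = real CARD('n) / \<alpha>" and u: "mild_solution \<alpha> f \<phi> T u"
    and [measurable]: "\<phi> \<in> borel_measurable lebesgue" "\<psi> \<in> borel_measurable borel"
    and \<psi>: "\<And>y. 0 \<le> \<psi> y" "\<And>y. \<psi> y \<le> C" "AE y in lebesgue. \<phi> y = \<psi> y"
    and t: "0 < t" "ereal t < T"
  shows "(\<integral>\<^sup>+y. ennreal (stable_kernel \<alpha> (2 * t) y) * ennreal (\<psi> y) \<partial>lborel)
      + (\<integral>\<^sup>+s\<in>{0<..<t}. ennreal ((s / (2 * t)) powr p * f (kernel_mean T u s)) \<partial>lborel)
    \<le> ennreal (kernel_mean T u t)"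
proof -
  let ?u = "extended T u"
  note um [measurable] = extended_measurable[OF u]
  obtain M where M: "\<And>s y. s \<in> {0..t} \<Longrightarrow> ?u s y \<le> M" and u0: "\<And>s y. 0 \<le> ?u s y"
    using extended_bounded[OF u t] by blast
  have us [measurable]: "?u s \<in> borel_measurable borel" for s by measurable
  have u_eq: "?u s y = u s y" if "s \<in> {0..t}" for s y
  proof -
    have "ereal s < T" using that t(2) by (meson atLeastAtMost_iff ereal_less_eq(3) le_less_trans)
    then show ?thesis using that by (simp add: extended_def)
  qed
  define w where "w s y = (if s \<in> {0..t} then f (?u s y) else 0)" for s y
  have wm [measurable]: "(\<lambda>(s, y). w s y) \<in> borel_measurable (borel \<Otimes>\<^sub>M borel)"
  proof -
    have "(\<lambda>z. f (max 0 (case z of (s, y) \<Rightarrow> ?u s y))) \<in> borel_measurable (borel \<Otimes>\<^sub>M borel)"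
      by (rule measurable_compose[OF um f_clamp_measurable])
    then have [measurable]: "(\<lambda>z. f (?u (fst z) (snd z))) \<in> borel_measurable (borel \<Otimes>\<^sub>M borel)"
      using u0 by (simp add: max_absorb2 case_prod_unfold)
    show ?thesis unfolding w_def case_prod_unfold by measurable
  qed
  have ws [measurable]: "w s \<in> borel_measurable borel" for s by measurable
  have w: "0 \<le> w s y" "s \<in> {0..t} \<Longrightarrow> w s y \<le> f M" for s y
    using u0[of s y] M[of s y] by (auto simp: w_def intro!: f_nonneg f_mono)
  have ae: "AE x in lborel. ennreal (?u t x) = nn_heat \<alpha> t (\<lambda>y. ennreal (\<psi> y)) x
      + (\<integral>\<^sup>+s\<in>{0..<t}. nn_heat \<alpha> (t - s) (\<lambda>y. ennreal (w s y)) x \<partial>lborel)"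
  proof -
    have "AE x in lebesgue. u t x = heat_semigroup \<alpha> t \<phi> x
        + (LINT s:{0..t}|lebesgue. heat_semigroup \<alpha> (t - s) (\<lambda>y. f (u s y)) x)"
      using u t by (simp add: mild_solution_def)
    then have "AE x in lborel. u t x = heat_semigroup \<alpha> t \<phi> x
        + (LINT s:{0..t}|lebesgue. heat_semigroup \<alpha> (t - s) (\<lambda>y. f (u s y)) x)"
      by (simp only: AE_completion_iff)
    then show ?thesis
    proof eventually_elim
      case (elim x)
      have "heat_semigroup \<alpha> t \<phi> x = heat_semigroup \<alpha> t \<psi> x"
      proof -
        have [measurable]: "(\<lambda>y. stable_kernel \<alpha> t (x - y)) \<in> borel_measurable lebesgue" "\<psi> \<in> borel_measurable lebesgue"
          by (rule measurable_completion, measurable)+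
        have "(LINT y|lebesgue. stable_kernel \<alpha> t (x - y) * \<phi> y) = (LINT y|lebesgue. stable_kernel \<alpha> t (x - y) * \<psi> y)"
        proof (rule integral_cong_AE)
          show "AE y in lebesgue. stable_kernel \<alpha> t (x - y) * \<phi> y = stable_kernel \<alpha> t (x - y) * \<psi> y"
            using \<psi>(3) by eventually_elim simp
        qed measurable
        then show ?thesis using t by (simp add: heat_semigroup_def heat_kernel_eq_stable_kernel[OF \<alpha>])
      qed
      moreover have "(LINT s:{0..t}|lebesgue. heat_semigroup \<alpha> (t - s) (\<lambda>y. f (u s y)) x)
         = (LINT s:{0..t}|lebesgue. heat_semigroup \<alpha> (t - s) (w s) x)"
        using u_eq by (intro set_lebesgue_integral_cong) (auto simp: w_def[abs_def])
      ultimately have "?u t x = heat_semigroup \<alpha> t \<psi> x + (LINT s:{0..t}|lebesgue. heat_semigroup \<alpha> (t - s) (w s) x)"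
        using elim t u_eq by simp
      moreover have "0 \<le> heat_semigroup \<alpha> t \<psi> x"
        using heat_semigroup_eq_nn_heat(2)[OF t(1) _ \<psi>(1,2), where x = x] by simp
      ultimately show ?case
        using duhamel_eq_nn_integral[OF wm w(1,2), of t x] heat_semigroup_eq_nn_heat(1)[OF t(1) _ \<psi>(1,2), where x = x]
        by (simp add: ennreal_plus)
    qed
  qed
  have mean: "ennreal (kernel_mean T u s) = (\<integral>\<^sup>+y. ennreal (stable_kernel \<alpha> s y) * ennreal (?u s y) \<partial>lborel)"
    if "0 < s" "s \<le> t" for s
    unfolding kernel_mean_def using that M u0 by (intro kernel_average(2)[where M = M]) auto
  have "ennreal (kernel_mean T u t) = (\<integral>\<^sup>+x. ennreal (stable_kernel \<alpha> t x) * nn_heat \<alpha> t (\<lambda>y. ennreal (\<psi> y)) x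
      + ennreal (stable_kernel \<alpha> t x) * (\<integral>\<^sup>+s\<in>{0..<t}. nn_heat \<alpha> (t - s) (\<lambda>y. ennreal (w s y)) x \<partial>lborel) \<partial>lborel)"
    unfolding mean[OF t(1) order_refl]
    using ae by (intro nn_integral_cong_AE) (auto simp: distrib_left elim!: eventually_mono)
  also have "\<dots> = (\<integral>\<^sup>+x. ennreal (stable_kernel \<alpha> t x) * nn_heat \<alpha> t (\<lambda>y. ennreal (\<psi> y)) x \<partial>lborel)
      + (\<integral>\<^sup>+x. ennreal (stable_kernel \<alpha> t x) * (\<integral>\<^sup>+s\<in>{0..<t}. nn_heat \<alpha> (t - s) (\<lambda>y. ennreal (w s y)) x \<partial>lborel) \<partial>lborel)"
    by (rule nn_integral_add) measurable
  also have "(\<integral>\<^sup>+x. ennreal (stable_kernel \<alpha> t x) * nn_heat \<alpha> t (\<lambda>y. ennreal (\<psi> y)) x \<partial>lborel)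
      = (\<integral>\<^sup>+y. ennreal (stable_kernel \<alpha> (2 * t) y) * ennreal (\<psi> y) \<partial>lborel)"
    unfolding mult_2 by (rule kernel_pairing_nn_heat[OF t(1) t(1)]) measurable
  also have "(\<integral>\<^sup>+x. ennreal (stable_kernel \<alpha> t x) * (\<integral>\<^sup>+s\<in>{0..<t}. nn_heat \<alpha> (t - s) (\<lambda>y. ennreal (w s y)) x \<partial>lborel) \<partial>lborel)
      = (\<integral>\<^sup>+s. \<integral>\<^sup>+x. ennreal (stable_kernel \<alpha> t x) * (nn_heat \<alpha> (t - s) (\<lambda>y. ennreal (w s y)) x * indicator {0..<t} s) \<partial>lborel \<partial>lborel)"
  proof -
    have "(\<integral>\<^sup>+x. ennreal (stable_kernel \<alpha> t x) * (\<integral>\<^sup>+s\<in>{0..<t}. nn_heat \<alpha> (t - s) (\<lambda>y. ennreal (w s y)) x \<partial>lborel) \<partial>lborel)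
      = (\<integral>\<^sup>+x. \<integral>\<^sup>+s. ennreal (stable_kernel \<alpha> t x) * (nn_heat \<alpha> (t - s) (\<lambda>y. ennreal (w s y)) x * indicator {0..<t} s) \<partial>lborel \<partial>lborel)"
      by (intro nn_integral_cong nn_integral_cmult[symmetric]) measurable
    also have "\<dots> = (\<integral>\<^sup>+s. \<integral>\<^sup>+x. ennreal (stable_kernel \<alpha> t x) * (nn_heat \<alpha> (t - s) (\<lambda>y. ennreal (w s y)) x * indicator {0..<t} s) \<partial>lborel \<partial>lborel)"
      by (rule lborel_pair.Fubini') measurable
    finally show ?thesis .
  qed
  finally have eq: "ennreal (kernel_mean T u t) = (\<integral>\<^sup>+y. ennreal (stable_kernel \<alpha> (2 * t) y) * ennreal (\<psi> y) \<partial>lborel)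
     + (\<integral>\<^sup>+s. \<integral>\<^sup>+x. ennreal (stable_kernel \<alpha> t x) * (nn_heat \<alpha> (t - s) (\<lambda>y. ennreal (w s y)) x * indicator {0..<t} s) \<partial>lborel \<partial>lborel)" .
  have "(\<integral>\<^sup>+s\<in>{0<..<t}. ennreal ((s / (2 * t)) powr p * f (kernel_mean T u s)) \<partial>lborel)
     \<le> (\<integral>\<^sup>+s. \<integral>\<^sup>+x. ennreal (stable_kernel \<alpha> t x) * (nn_heat \<alpha> (t - s) (\<lambda>y. ennreal (w s y)) x * indicator {0..<t} s) \<partial>lborel \<partial>lborel)"
  proof (intro nn_integral_mono)
    fix s
    show "ennreal ((s / (2 * t)) powr p * f (kernel_mean T u s)) * indicator {0<..<t} s
      \<le> (\<integral>\<^sup>+x. ennreal (stable_kernel \<alpha> t x) * (nn_heat \<alpha> (t - s) (\<lambda>y. ennreal (w s y)) x * indicator {0..<t} s) \<partial>lborel)"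
    proof (cases "s \<in> {0<..<t}")
      case True
      then have s: "0 < s" "s < t" "s \<in> {0..t}" by auto
      have wf: "w s y = f (?u s y)" for y using s by (simp add: w_def)
      have "ennreal (f (kernel_mean T u s)) \<le> (\<integral>\<^sup>+y. ennreal (stable_kernel \<alpha> s y) * ennreal (f (?u s y)) \<partial>lborel)"
        unfolding kernel_mean_def using s M u0 by (intro jensen[where M = M]) auto
      then have "ennreal ((s / (2 * t)) powr p) * ennreal (f (kernel_mean T u s))
        \<le> ennreal ((s / (2 * t)) powr p) * (\<integral>\<^sup>+y. ennreal (stable_kernel \<alpha> s y) * ennreal (w s y) \<partial>lborel)"
        unfolding wf by (rule mult_left_mono) simp
      also have "\<dots> = (\<integral>\<^sup>+y. ennreal ((s / (2 * t)) powr p) * (ennreal (stable_kernel \<alpha> s y) * ennreal (w s y)) \<partial>lborel)"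
        by (rule nn_integral_cmult[symmetric]) measurable
      also have "\<dots> \<le> (\<integral>\<^sup>+y. ennreal (stable_kernel \<alpha> (t - s + t) y) * ennreal (w s y) \<partial>lborel)"
      proof (intro nn_integral_mono)
        fix y :: "real^'n"
        \<comment> \<open>The time 2t - s is replaced by 2t so that the factor splits into s^p and a
          power of t.\<close>
        have "(s / (2 * t)) powr p * stable_kernel \<alpha> s y \<le> (s / (t - s + t)) powr p * stable_kernel \<alpha> s y"
          using s p by (intro mult_right_mono powr_mono2 frac_le stable_kernel_nonneg \<alpha>) auto
        also have "\<dots> \<le> stable_kernel \<alpha> (t - s + t) y"
          using stable_kernel_time_mono[OF \<alpha>, of s "t - s + t" y] s by (simp add: p_eq)
        finally have "ennreal ((s / (2 * t)) powr p) * ennreal (stable_kernel \<alpha> s y) \<le> ennreal (stable_kernel \<alpha> (t - s + t) y)"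
          using s by (simp add: ennreal_leI flip: ennreal_mult')
        then show "ennreal ((s / (2 * t)) powr p) * (ennreal (stable_kernel \<alpha> s y) * ennreal (w s y))
          \<le> ennreal (stable_kernel \<alpha> (t - s + t) y) * ennreal (w s y)"
          unfolding mult.assoc[symmetric] by (rule mult_right_mono) simp
      qed
      also have "\<dots> = (\<integral>\<^sup>+x. ennreal (stable_kernel \<alpha> t x) * nn_heat \<alpha> (t - s) (\<lambda>y. ennreal (w s y)) x \<partial>lborel)"
        using s by (subst kernel_pairing_nn_heat) auto
      finally show ?thesis using True s by (simp add: ennreal_mult')
    qed simp
  qed
  then show ?thesis unfolding eq by (rule add_left_mono)
qed

text \<open>For each y, scaling and positivity of K(1) at the origin give positivity of the kernel
  at y for late times. If the pairings at the countably many times 2k all vanished, then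
  \<open>\<psi>\<close> would vanish almost everywhere.\<close>

lemma kernel_pairing_positive:
  fixes \<psi> :: "real^'n \<Rightarrow> real"
  assumes [measurable]: "\<psi> \<in> borel_measurable borel" and \<psi>: "\<And>y. 0 \<le> \<psi> y" and nontrivial: "\<not> (AE y in lborel. \<psi> y = 0)"
  obtains (pos) t where "0 < t" "0 < (\<integral>\<^sup>+y. ennreal (stable_kernel \<alpha> (2 * t) y) * ennreal (\<psi> y) \<partial>lborel)"
proof (rule ccontr)
  assume "\<not> thesis"
  then have zero: "(\<integral>\<^sup>+y. ennreal (stable_kernel \<alpha> (2 * t) y) * ennreal (\<psi> y) \<partial>lborel) = 0" if "0 < t" for t
    using \<open>\<not> thesis\<close> pos[of t] that by (auto simp: zero_less_iff_neq_zero)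
  have "AE y in lborel. \<forall>k. ennreal (stable_kernel \<alpha> (2 * real (Suc k)) y) * ennreal (\<psi> y) = 0"
    unfolding AE_all_countable
  proof
    fix k
    show "AE y in lborel. ennreal (stable_kernel \<alpha> (2 * real (Suc k)) y) * ennreal (\<psi> y) = 0"
      using zero[of "real (Suc k)"] by (subst nn_integral_0_iff_AE[symmetric]) auto
  qed
  then have "AE y in lborel. \<psi> y = 0"
  proof eventually_elim
    case (elim y)
    have lim: "(\<lambda>k. stable_kernel \<alpha> 1 ((2 * real (Suc k)) powr (- 1 / \<alpha>) *\<^sub>R y)) \<longlonglongrightarrow> stable_kernel \<alpha> 1 (0 *\<^sub>R y)"
    proof (rule isCont_tendsto_compose[where g = "stable_kernel \<alpha> 1"])
      show "isCont (stable_kernel \<alpha> 1) (0 *\<^sub>R y)"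
        using stable_kernel_continuous[OF \<alpha>, of 1, where 'a = "real^'n"] by (simp add: continuous_on_eq_continuous_at)
      have "(\<lambda>k. (2 * real (Suc k)) powr (- 1 / \<alpha>)) \<longlonglongrightarrow> 0"
        using \<alpha> by real_asymp
      then show "(\<lambda>k. (2 * real (Suc k)) powr (- 1 / \<alpha>) *\<^sub>R y) \<longlonglongrightarrow> 0 *\<^sub>R y"
        by (intro tendsto_scaleR tendsto_const)
    qed
    have "eventually (\<lambda>k. 0 < stable_kernel \<alpha> 1 ((2 * real (Suc k)) powr (- 1 / \<alpha>) *\<^sub>R y)) sequentially"
      using stable_kernel_0_pos[OF \<alpha>, where 'a = "real^'n"] by (intro order_tendstoD[OF lim]) simp
    then obtain k where k: "0 < stable_kernel \<alpha> 1 ((2 * real (Suc k)) powr (- 1 / \<alpha>) *\<^sub>R y)"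
      by (auto simp: eventually_sequentially)
    have "0 < stable_kernel \<alpha> (2 * real (Suc k)) y"
      using k stable_kernel_scaling[OF \<alpha>, of "2 * real (Suc k)" y] by (simp del: of_nat_Suc)
    then show ?case using elim[rule_format, of k] \<psi>[of y] by (simp add: ennreal_mult_eq_top_iff not_le ennreal_eq_0_iff del: of_nat_Suc)
  qed
  then show False using nontrivial by simp
qed

lemma max_existence_time_finite:
  fixes \<phi> :: "real^'n \<Rightarrow> real"
  assumes p_eq: "p = real CARD('n) / \<alpha>"
    and div: "\<And>\<delta>. 0 < \<delta> \<Longrightarrow> fujita_integral f p \<delta> = \<infinity>" and "condB f" "condS f"
    and \<phi>: "\<phi> \<in> Linfty" "AE x in lebesgue. 0 \<le> \<phi> x" "\<not> (AE x in lebesgue. \<phi> x = 0)"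
  shows "max_existence_time \<alpha> f \<phi> < \<infinity>"
proof -
  have \<phi>m: "\<phi> \<in> borel_measurable lebesgue" using \<phi>(1) by (simp add: Linfty_def)
  obtain C where C: "AE x in lebesgue. \<bar>\<phi> x\<bar> \<le> C" using \<phi>(1) by (auto simp: Linfty_def)
  obtain \<phi>' where \<phi>': "\<phi>' \<in> borel_measurable lborel" "AE x in lborel. \<phi> x = \<phi>' x"
    using completion_ex_borel_measurable_real[OF \<phi>m] by blast
  \<comment> \<open>Clamping a Borel version of the datum into [0,|C|] makes the almost everywhere
    bounds hold everywhere.\<close>
  define \<psi> where "\<psi> x = min \<bar>C\<bar> (max 0 (\<phi>' x))" for x
  have [measurable]: "\<psi> \<in> borel_measurable borel" unfolding \<psi>_def using \<phi>'(1) by simp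
  have \<psi>: "0 \<le> \<psi> y" "\<psi> y \<le> \<bar>C\<bar>" for y by (auto simp: \<psi>_def)
  have eq: "AE y in lborel. \<phi> y = \<psi> y"
    using \<phi>'(2) C[unfolded AE_completion_iff] \<phi>(2)[unfolded AE_completion_iff]
    by eventually_elim (auto simp: \<psi>_def)
  have "\<not> (AE y in lborel. \<psi> y = 0)"
  proof
    assume "AE y in lborel. \<psi> y = 0"
    with eq have "AE y in lborel. \<phi> y = 0" by eventually_elim simp
    then show False using \<phi>(3) by (simp add: AE_completion_iff)
  qed
  then obtain t0 where t0: "0 < t0" "0 < (\<integral>\<^sup>+y. ennreal (stable_kernel \<alpha> (2 * t0) y) * ennreal (\<psi> y) \<partial>lborel)"
    using kernel_pairing_positive[of \<psi>] \<psi> by auto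
  define q where "q t = (\<integral>y. stable_kernel \<alpha> (2 * t) y * \<psi> y \<partial>lborel)" for t
  have q: "ennreal (q t) = (\<integral>\<^sup>+y. ennreal (stable_kernel \<alpha> (2 * t) y) * ennreal (\<psi> y) \<partial>lborel)"
    "integrable lborel (\<lambda>y. stable_kernel \<alpha> (2 * t) y * \<psi> y)" if "0 < t" for t
    unfolding q_def using that \<psi> kernel_average(1,2)[of "2 * t" \<psi> "\<bar>C\<bar>"] by auto
  \<comment> \<open>t^p q(t) is nondecreasing by \<open>stable_kernel_time_mono\<close>, so its
    value at t0 bounds the contribution of the datum from below at all later times.\<close>
  define c where "c = t0 powr p * q t0"
  have c: "0 < c" using t0 by (auto simp: c_def simp flip: q(1))
  have q_mono: "c \<le> t powr p * q t" if "t0 \<le> t" for t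
  proof -
    have "(t0 / t) powr p * q t0 = (\<integral>y. (2 * t0 / (2 * t)) powr p * stable_kernel \<alpha> (2 * t0) y * \<psi> y \<partial>lborel)"
      unfolding q_def using t0 by (simp add: mult.assoc)
    also have "\<dots> \<le> q t"
      unfolding q_def
    proof (rule integral_mono)
      show "integrable lborel (\<lambda>y. (2 * t0 / (2 * t)) powr p * stable_kernel \<alpha> (2 * t0) y * \<psi> y)"
        unfolding mult.assoc by (intro integrable_mult_right q t0)
      show "integrable lborel (\<lambda>y. stable_kernel \<alpha> (2 * t) y * \<psi> y)" using that t0 by (intro q) auto
      show "(2 * t0 / (2 * t)) powr p * stable_kernel \<alpha> (2 * t0) y * \<psi> y \<le> stable_kernel \<alpha> (2 * t) y * \<psi> y" for y
        using stable_kernel_time_mono[OF \<alpha>, of "2 * t0" "2 * t" y] that t0 \<psi>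
        by (intro mult_right_mono) (auto simp: p_eq)
    qed
    finally have "t powr p * ((t0 / t) powr p * q t0) \<le> t powr p * q t" by (rule mult_left_mono) simp
    then show ?thesis using t0 that by (simp add: c_def powr_divide)
  qed
  \<comment> \<open>The constant in (s/2t)^p = 2^-p s^p t^-p; the power of t cancels against the
    weight t^p of the mean.\<close>
  define \<kappa> where "\<kappa> = 2 powr - p"
  have \<kappa>: "0 < \<kappa>" by (simp add: \<kappa>_def)
  interpret monotone_rhs "similarity_rhs f p \<kappa>" t0 using t0 \<kappa> by (intro similarity_rhs_monotone) auto
  show ?thesis
  proof (cases rule: minimal_solution[of c])
    case (global y)
    then show ?thesis
      using no_global_similarity_solution[OF div superlinear \<open>condB f\<close> \<open>condS f\<close> \<kappa> t0(1) c, of y] by blast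
  next
    case (blowup T y)
    \<comment> \<open>The blow-up time T of the comparison equation bounds every existence time: a
      mild solution living past T would have a bounded mean on [t0,T], yet this mean dominates a
      function that blows up at T.\<close>
    have "T' \<le> ereal T" if u: "mild_solution \<alpha> f \<phi> T' u" for T' u
    proof (rule ccontr)
      assume "\<not> T' \<le> ereal T"
      then have TT: "ereal T < T'" by simp
      have T0: "0 < T" using blowup(1) t0 by simp
      note [measurable] = extended_measurable[OF u]
      obtain M where M: "\<And>s y. s \<in> {0..T} \<Longrightarrow> extended T' u s y \<le> M" and u0: "\<And>s y. 0 \<le> extended T' u s y"
        using extended_bounded[OF u T0 TT] by blast
      define m where "m = kernel_mean T' u"
      have m: "0 \<le> m s" "m s \<le> M" if "s \<in> {t0..T}" for s
        unfolding m_def kernel_mean_def using that t0 M u0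
        by (auto intro!: kernel_average(3,4)[where M = M])
      have [measurable]: "m \<in> borel_measurable borel" unfolding m_def kernel_mean_def[abs_def] by measurable
      define g where "g s = \<kappa> * s powr p * f (max 0 (m s))" for s
      have gm: "g \<in> borel_measurable borel"
        using measurable_compose[OF _ f_clamp_measurable, of m borel] unfolding g_def by measurable
      have g0: "0 \<le> g s" for s using \<kappa> unfolding g_def by (intro mult_nonneg_nonneg f_nonneg) auto
      have gint: "set_integrable lborel {t0..T} g"
        unfolding set_integrable_def
      proof (rule Bochner_Integration.integrable_bound)
        show "integrable lborel (\<lambda>s. (\<kappa> * T powr p * f M) * indicator {t0..T} s :: real)"
          by (intro integrable_mult_right integrable_real_indicator) (auto simp: emeasure_lborel_Icc_eq)
        show "(\<lambda>s. indicator {t0..T} s *\<^sub>R g s) \<in> borel_measurable lborel" using gm by measurable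
        have "g s \<le> \<kappa> * T powr p * f M" if "s \<in> {t0..T}" for s
          unfolding g_def using m[OF that] that t0 \<kappa> p
          by (intro mult_mono powr_mono2 f_mono mult_nonneg_nonneg f_nonneg) auto
        then show "AE s in lborel. norm (indicator {t0..T} s *\<^sub>R g s) \<le> norm ((\<kappa> * T powr p * f M) * indicator {t0..T} s)"
          using g0 by (intro AE_I2) (auto split: split_indicator intro: order_trans[OF _ abs_ge_self])
      qed
      have gint': "set_integrable lborel {t0..t} g" if "t \<le> T" for t
        using that by (intro set_integrable_subset[OF gint]) auto
      have gI: "g integrable_on {t0..t}" if "t \<le> T" for t
        using set_borel_integral_eq_integral(1)[OF gint'[OF that]] .
      \<comment> \<open>The mean m is only known to be measurable and bounded, whereas Z is
        continuous; since t^p m >= Z, monotonicity of the right-hand side makes Z a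
        supersolution.\<close>
      define Z where "Z t = c + integral {t0..t} g" for t
      have contZ: "continuous_on {t0..T} Z"
        unfolding Z_def by (intro continuous_intros indefinite_integral_continuous_1 gI) simp
      have ZY: "Z t \<le> t powr p * m t" if t: "t \<in> {t0..T}" for t
      proof -
        have t': "0 < t" "ereal t < T'" using t t0 TT by (auto intro: le_less_trans[of "ereal t" "ereal T"])
        have "ennreal (integral {t0..t} g) = (\<integral>\<^sup>+s\<in>{t0..t}. ennreal (g s) \<partial>lborel)"
          using nn_integral_set_eq_integral[OF gint' g0, of t] t by simp
        also have "\<dots> \<le> (\<integral>\<^sup>+s. ennreal (t powr p) * (ennreal ((s / (2 * t)) powr p * f (max 0 (m s))) * indicator {0<..<t} s) \<partial>lborel)"
        proof (rule nn_integral_mono_AE)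
          show "AE s in lborel. ennreal (g s) * indicator {t0..t} s
             \<le> ennreal (t powr p) * (ennreal ((s / (2 * t)) powr p * f (max 0 (m s))) * indicator {0<..<t} s)"
            using AE_lborel_singleton[of t]
          proof eventually_elim
            case (elim s)
            show ?case
            proof (cases "s \<in> {t0..t}")
              case True
              then have s: "0 < s" "s < t" using t0 elim by auto
              have "t powr p * ((s / (2 * t)) powr p * f (max 0 (m s))) = g s"
                using s t' by (simp add: g_def \<kappa>_def powr_divide powr_mult powr_minus_divide)
              then show ?thesis using True s by (simp flip: ennreal_mult')
            qed simp
          qed
        qed
        also have "\<dots> = ennreal (t powr p) * (\<integral>\<^sup>+s\<in>{0<..<t}. ennreal ((s / (2 * t)) powr p * f (max 0 (m s))) \<partial>lborel)"
          by (rule nn_integral_cmult) (use measurable_compose[OF _ f_clamp_measurable, of m borel] in measurable)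
        also have "(\<integral>\<^sup>+s\<in>{0<..<t}. ennreal ((s / (2 * t)) powr p * f (max 0 (m s))) \<partial>lborel)
           = (\<integral>\<^sup>+s\<in>{0<..<t}. ennreal ((s / (2 * t)) powr p * f (kernel_mean T' u s)) \<partial>lborel)"
        proof (intro nn_integral_cong)
          fix s
          have "0 \<le> m s" if "s \<in> {0<..<t}"
            unfolding m_def kernel_mean_def using that t M u0 by (intro kernel_average(3)[where M = M]) auto
          then show "ennreal ((s / (2 * t)) powr p * f (max 0 (m s))) * indicator {0<..<t} s
             = ennreal ((s / (2 * t)) powr p * f (kernel_mean T' u s)) * indicator {0<..<t} s"
            by (auto simp: m_def split: split_indicator)
        qed
        finally have "ennreal c + ennreal (integral {t0..t} g) \<le> ennreal (t powr p) * ennreal (q t)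
           + ennreal (t powr p) * (\<integral>\<^sup>+s\<in>{0<..<t}. ennreal ((s / (2 * t)) powr p * f (kernel_mean T' u s)) \<partial>lborel)"
          using q_mono[of t] t by (intro add_mono) (auto simp: ennreal_leI simp flip: ennreal_mult')
        also have "\<dots> \<le> ennreal (t powr p) * ennreal (m t)"
          unfolding distrib_left[symmetric] q(1)[OF t'(1)] m_def
          by (intro mult_left_mono kernel_mean_lower_bound[OF p_eq u \<phi>m _ \<psi> _ t'])
            (use eq in \<open>auto simp: AE_completion_iff\<close>)
        finally have "ennreal (Z t) \<le> ennreal (t powr p * m t)"
          using c integral_nonneg[OF gI g0, of t] t by (simp add: Z_def ennreal_plus ennreal_mult')
        then show ?thesis using m(1)[OF t] by (simp add: ennreal_le_iff)
      qed
      have super: "volterra_super (similarity_rhs f p \<kappa>) c t0 T Z"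
        unfolding volterra_super_def
      proof (intro conjI ballI contZ)
        fix t assume t: "t \<in> {t0..T}"
        have "integral {t0..t} (\<lambda>s. similarity_rhs f p \<kappa> s (Z s)) \<le> integral {t0..t} g"
        proof (rule integral_le)
          show "(\<lambda>s. similarity_rhs f p \<kappa> s (Z s)) integrable_on {t0..t}"
            using t by (intro integrable_comp continuous_on_subset[OF contZ]) auto
          show "g integrable_on {t0..t}" using t by (intro gI) simp
          fix s assume "s \<in> {t0..t}"
          then have s: "s \<in> {t0..T}" "0 < s" using t t0 by auto
          have "similarity_rhs f p \<kappa> s (Z s) \<le> similarity_rhs f p \<kappa> s (s powr p * m s)"
            using s ZY[OF s(1)] by (intro mono) auto
          also have "\<dots> = g s"
          proof -
            have "s powr - p * (s powr p * m s) = m s" using s by (simp add: powr_minus field_simps)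
            then show ?thesis unfolding similarity_rhs_def g_def by (simp only:)
          qed
          finally show "similarity_rhs f p \<kappa> s (Z s) \<le> g s" .
        qed
        then show "c + integral {t0..t} (\<lambda>s. similarity_rhs f p \<kappa> s (Z s)) \<le> Z t" by (simp add: Z_def)
      qed
      have "compact (Z ` {t0..T})" by (intro compact_continuous_image contZ) simp
      then obtain B where B: "\<And>t. t \<in> {t0..T} \<Longrightarrow> Z t \<le> B"
        using compact_imp_bounded bounded_imp_bdd_above by (metis bdd_above.unfold imageI)
      have "eventually (\<lambda>t. B < y t) (at_left T)" using blowup(3) by (simp add: filterlim_at_top_dense)
      moreover have "eventually (\<lambda>t. t \<in> {t0<..<T}) (at_left T)" by (rule eventually_at_leftI[OF _ blowup(1)])
      ultimately have "eventually (\<lambda>t. B < y t \<and> t \<in> {t0<..<T}) (at_left T)" by (rule eventually_conj)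
      from eventually_happens'[OF trivial_limit_at_left_real this]
      obtain t where t: "B < y t" "t \<in> {t0<..<T}" by auto
      then show False using blowup(4)[OF super, of t] B[of t] by auto
    qed
    then have "max_existence_time \<alpha> f \<phi> \<le> ereal T"
      unfolding max_existence_time_def by (intro Sup_least) auto
    then show ?thesis by (rule le_less_trans) simp
  qed
qed

end

section \<open>Global mild solutions\<close>

context fujita_pde
begin

text \<open>At infinity the value is f 0 = 0, as \<open>enn2real\<close> sends infinity to 0; this
  is why monotonicity is stated below infinity and continuity for bounded sequences.\<close>

definition ext_f :: "ennreal \<Rightarrow> ennreal" where
  "ext_f z = ennreal (f (enn2real z))"

lemma ext_f_mono: "z \<le> w \<Longrightarrow> w < \<infinity> \<Longrightarrow> ext_f z \<le> ext_f w"
  unfolding ext_f_def by (intro ennreal_leI f_mono enn2real_mono) auto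

lemma ext_f_measurable [measurable (raw)]: "g \<in> borel_measurable M \<Longrightarrow> (\<lambda>z. ext_f (g z)) \<in> borel_measurable M"
proof -
  assume [measurable]: "g \<in> borel_measurable M"
  have "(\<lambda>z. f (max 0 (enn2real (g z)))) \<in> borel_measurable M"
    by (rule measurable_compose[OF _ f_clamp_measurable]) measurable
  then show ?thesis unfolding ext_f_def by (simp add: max_absorb2)
qed

lemma ext_f_SUP:
  assumes inc: "incseq z" and bd: "\<And>k. z k \<le> ennreal B"
  shows "ext_f (SUP k. z k) = (SUP k. ext_f (z k))"
proof -
  have fin: "(SUP k. z k) < \<infinity>" using SUP_least[of UNIV z "ennreal B"] bd by (simp add: le_less_trans)
  have zfin: "z k < \<infinity>" for k using bd[of k] by (simp add: le_less_trans)
  have "z \<longlonglongrightarrow> (SUP k. z k)" using inc by (rule LIMSEQ_SUP)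
  then have "(\<lambda>k. enn2real (z k)) \<longlonglongrightarrow> enn2real (SUP k. z k)"
    using fin by (intro tendsto_enn2real) auto
  then have "(\<lambda>k. f (enn2real (z k))) \<longlonglongrightarrow> f (enn2real (SUP k. z k))"
    by (rule continuous_on_tendsto_compose[OF cont_f]) auto
  then have "(\<lambda>k. ext_f (z k)) \<longlonglongrightarrow> ext_f (SUP k. z k)"
    unfolding ext_f_def by (rule tendsto_ennrealI)
  moreover have "incseq (\<lambda>k. ext_f (z k))"
    using inc zfin by (auto simp: incseq_def intro!: ext_f_mono)
  then have "(\<lambda>k. ext_f (z k)) \<longlonglongrightarrow> (SUP k. ext_f (z k))" by (rule LIMSEQ_SUP)
  ultimately show ?thesis by (rule LIMSEQ_unique)
qed

text \<open>v = e K(1 + t) is the heat flow of the datum e K(1). Since f(2v) <= h(s) 2v, the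
  semigroup law bounds the Duhamel term of 2v by the integral of h times 2v; as that integral is at
  most 1/2, adding v keeps the total below 2v.\<close>

lemma global_mild_solution:
  assumes p_eq: "p = real CARD('n) / \<alpha>" and conv: "0 < \<delta>" "fujita_integral f p \<delta> < \<infinity>"
  obtains \<phi> :: "real^'n \<Rightarrow> real" and u where "\<phi> \<in> Linfty" "\<And>x. 0 \<le> \<phi> x" "\<not> (AE x in lebesgue. \<phi> x = 0)"
    "mild_solution \<alpha> f \<phi> \<infinity> u"
proof -
  let ?K = "stable_kernel \<alpha> :: real \<Rightarrow> real^'n \<Rightarrow> real"
  define k0 where "k0 = ?K 1 0"
  have k0: "0 < k0" unfolding k0_def by (rule stable_kernel_0_pos[OF \<alpha>])
  have K0: "0 \<le> ?K t x" if "0 < t" for t x by (rule stable_kernel_nonneg[OF \<alpha> that])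
  have K_le: "?K t x \<le> t powr - p * k0" if "0 < t" for t x
    using stable_kernel_le[OF \<alpha> that, of x] by (simp add: k0_def p_eq)
  obtain A where A: "0 < A" "(\<integral>\<^sup>+s\<in>{1..}. ennreal (s powr p * f (A * s powr - p)) \<partial>lborel) \<le> ennreal (1 / 2 * A)"
    using fujita_convergent[OF conv, of "1 / 2"] by auto
  \<comment> \<open>Chosen so that 2v <= A (1 + t)^-p, the argument at which f is controlled by the
    choice of A.\<close>
  define e where "e = A / (2 * k0)"
  have e: "0 < e" using A k0 by (simp add: e_def)
  \<comment> \<open>This is f(a)/a at a = A (1 + s)^-p, an upper bound for f(u)/u for all u in
    (0,a].\<close>
  define h where "h s = (1 + s) powr p * f (A * (1 + s) powr - p) / A" for s
  have h0: "0 \<le> h s" for s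
    unfolding h_def using A by (intro divide_nonneg_pos mult_nonneg_nonneg f_nonneg) auto
  have [measurable]: "h \<in> borel_measurable borel"
  proof -
    have [measurable]: "(\<lambda>s. f (A * (1 + s) powr - p)) \<in> borel_measurable borel"
      by (rule measurable_compose[OF _ profile_measurable[OF A(1)]]) measurable
    show ?thesis unfolding h_def by measurable
  qed
  have h_int: "(\<integral>\<^sup>+s\<in>{0..<t}. ennreal (h s) \<partial>lborel) \<le> ennreal (1 / 2)" for t
  proof -
    define H where "H r = ennreal (1 / A) * (ennreal (r powr p * f (A * r powr - p)) * indicator {1..} r)" for r
    note [measurable] = profile_measurable[OF A(1)]
    have "(\<integral>\<^sup>+s\<in>{0..<t}. ennreal (h s) \<partial>lborel) \<le> (\<integral>\<^sup>+s. H (1 + 1 * s) \<partial>lborel)"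
      using A by (intro nn_integral_mono)
        (auto simp: H_def h_def ennreal_mult'[symmetric] field_simps split: split_indicator)
    also have "\<dots> = (\<integral>\<^sup>+r. H r \<partial>lborel)"
    proof -
      have "H \<in> borel_measurable borel" unfolding H_def[abs_def] by measurable
      then show ?thesis by (subst (2) nn_integral_real_affine[where c = 1 and t = 1]) auto
    qed
    also have "\<dots> = ennreal (1 / A) * (\<integral>\<^sup>+s\<in>{1..}. ennreal (s powr p * f (A * s powr - p)) \<partial>lborel)"
      unfolding H_def by (rule nn_integral_cmult) measurable
    also have "\<dots> \<le> ennreal (1 / A) * ennreal (1 / 2 * A)" by (intro mult_left_mono A) simp
    also have "\<dots> = ennreal (1 / 2)" using A by (subst ennreal_mult[symmetric]) auto
    finally show ?thesis .
  qed
  define v where "v t x = e * ?K (1 + t) x" for t x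
  have v0: "0 \<le> v t x" if "0 \<le> t" for t x using e K0[of "1 + t"] that by (simp add: v_def)
  have v_le: "2 * v t x \<le> A * (1 + t) powr - p" if "0 \<le> t" for t x
  proof -
    have "2 * v t x \<le> 2 * (e * ((1 + t) powr - p * k0))"
      unfolding v_def using e K_le[of "1 + t" x] that by simp
    also have "\<dots> = A * (1 + t) powr - p" using k0 by (simp add: e_def)
    finally show ?thesis .
  qed
  have vA: "2 * v t x \<le> A" if "0 \<le> t" for t x
  proof -
    have "(1 + t) powr - p \<le> (1 + t) powr 0" using that p by (intro powr_mono) auto
    then have "A * (1 + t) powr - p \<le> A * 1" using A that by (intro mult_left_mono) auto
    then show ?thesis using v_le[OF that, of x] by simp
  qed
  have vm [measurable]: "(\<lambda>(t, x). v t x) \<in> borel_measurable (borel \<Otimes>\<^sub>M borel)"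
    unfolding v_def case_prod_unfold by measurable
  \<comment> \<open>The right-hand side of the mild formula; negative times are sent to 0 so that
    the order relations hold for all t.\<close>
  define \<Phi> where "\<Phi> U t x = (if t < 0 then 0 else ennreal (v t x)
      + (\<integral>\<^sup>+s\<in>{0..<t}. nn_heat \<alpha> (t - s) (\<lambda>y. ext_f (U s y)) x \<partial>lborel))" for U t x
  define V where "V t x = (if t < 0 then 0 else ennreal (2 * v t x))" for t x
  have V_le: "V t x \<le> ennreal A" for t x
    using vA[of t x] by (auto simp: V_def intro: ennreal_leI)
  have \<Phi>_mono: "\<Phi> U t x \<le> \<Phi> W t x"
    if UW: "\<And>s y. U s y \<le> W s y" "\<And>s y. W s y \<le> ennreal A" for U W t x
  proof -
    have "W s y < \<infinity>" for s y using UW(2)[of s y] by (simp add: le_less_trans)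
    then show ?thesis
      unfolding \<Phi>_def
      by (auto intro!: add_left_mono nn_integral_mono mult_right_mono nn_heat_mono ext_f_mono UW(1))
  qed
  have \<Phi>V: "\<Phi> V t x \<le> V t x" for t x
  proof (cases "t < 0")
    case False
    then have t: "0 \<le> t" by simp
    have fV: "ext_f (V s y) \<le> ennreal (h s) * (ennreal (2 * e) * ennreal (?K (1 + s) y))" if s: "0 \<le> s" for s y
    proof -
      have V: "V s y = ennreal (2 * v s y)" using s by (simp add: V_def)
      have "f (2 * v s y) \<le> h s * (2 * v s y)"
      proof (cases "v s y = 0")
        case True
        then show ?thesis by (simp add: f_0)
      next
        case False
        then have pos: "0 < 2 * v s y" using v0[OF s, of y] by simp
        have "f (2 * v s y) / (2 * v s y) \<le> f (A * (1 + s) powr - p) / (A * (1 + s) powr - p)"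
          by (rule superlinear[OF pos v_le[OF s]])
        also have "\<dots> = h s" using A s by (simp add: h_def powr_minus field_simps)
        finally show ?thesis using pos by (simp only: pos_divide_le_eq)
      qed
      then have "ext_f (V s y) \<le> ennreal (h s * (2 * v s y))"
        unfolding V ext_f_def using v0[OF s, of y] by (intro ennreal_leI) simp
      also have "\<dots> = ennreal (h s) * (ennreal (2 * e) * ennreal (?K (1 + s) y))"
        using h0[of s] e K0[of "1 + s" y] s by (simp add: v_def ennreal_mult mult.assoc)
      finally show ?thesis .
    qed
    have "(\<integral>\<^sup>+s\<in>{0..<t}. nn_heat \<alpha> (t - s) (\<lambda>y. ext_f (V s y)) x \<partial>lborel)
      \<le> (\<integral>\<^sup>+s. (ennreal (h s) * indicator {0..<t} s) * ennreal (2 * v t x) \<partial>lborel)"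
    proof (intro nn_integral_mono)
      fix s
      show "nn_heat \<alpha> (t - s) (\<lambda>y. ext_f (V s y)) x * indicator {0..<t} s
        \<le> (ennreal (h s) * indicator {0..<t} s) * ennreal (2 * v t x)"
      proof (cases "s \<in> {0..<t}")
        case True
        have "nn_heat \<alpha> (t - s) (\<lambda>y. ext_f (V s y)) x
          \<le> nn_heat \<alpha> (t - s) (\<lambda>y. ennreal (h s) * (ennreal (2 * e) * ennreal (?K (1 + s) y))) x"
          using True by (intro nn_heat_mono fV) simp
        also have "\<dots> = (\<integral>\<^sup>+y. (ennreal (h s) * ennreal (2 * e)) * (ennreal (?K (t - s) (x - y)) * ennreal (?K (1 + s) y)) \<partial>lborel)"
          unfolding nn_heat_def by (intro nn_integral_cong) (simp add: mult_ac)
        also have "\<dots> = (ennreal (h s) * ennreal (2 * e)) * nn_heat \<alpha> (t - s) (\<lambda>y. ennreal (?K (1 + s) y)) x"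
          unfolding nn_heat_def by (rule nn_integral_cmult) measurable
        also have "nn_heat \<alpha> (t - s) (\<lambda>y. ennreal (?K (1 + s) y)) x = ennreal (?K (t - s + (1 + s)) x)"
          using True by (intro nn_kernel_semigroup) auto
        also have "t - s + (1 + s) = 1 + t" by simp
        also have "(ennreal (h s) * ennreal (2 * e)) * ennreal (?K (1 + t) x) = ennreal (h s) * ennreal (2 * v t x)"
          using e K0[of "1 + t" x] t by (simp add: v_def mult.assoc flip: ennreal_mult)
        finally show ?thesis using True by simp
      qed simp
    qed
    also have "\<dots> = (\<integral>\<^sup>+s\<in>{0..<t}. ennreal (h s) \<partial>lborel) * ennreal (2 * v t x)"
      by (rule nn_integral_multc) measurable
    also have "\<dots> \<le> ennreal (1 / 2) * ennreal (2 * v t x)" by (intro mult_right_mono h_int) simp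
    also have "\<dots> = ennreal (v t x)" using v0[OF t, of x] by (subst ennreal_mult[symmetric]) auto
    finally have "\<Phi> V t x \<le> ennreal (v t x) + ennreal (v t x)"
      using t by (simp add: \<Phi>_def add_left_mono)
    also have "\<dots> = V t x" using v0[OF t, of x] t by (simp add: V_def flip: ennreal_plus)
    finally show ?thesis .
  qed (simp add: \<Phi>_def V_def)
  define U where "U = rec_nat (\<lambda>t x. 0) (\<lambda>_ U. \<Phi> U)"
  have U0: "U 0 = (\<lambda>t x. 0)" and US: "U (Suc k) = \<Phi> (U k)" for k by (simp_all add: U_def)
  have U_le: "U k t x \<le> V t x" for k t x
  proof (induction k arbitrary: t x)
    case (Suc k)
    have "\<Phi> (U k) t x \<le> \<Phi> V t x" by (intro \<Phi>_mono Suc V_le)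
    then show ?case unfolding US using \<Phi>V order_trans by blast
  qed (simp add: U0)
  have U_leA: "U k t x \<le> ennreal A" for k t x using U_le V_le order_trans by blast
  have U_inc: "U k t x \<le> U (Suc k) t x" for k t x
  proof (induction k arbitrary: t x)
    case (Suc k)
    have "\<Phi> (U k) t x \<le> \<Phi> (U (Suc k)) t x" by (intro \<Phi>_mono Suc U_leA)
    then show ?case by (simp add: US)
  qed (simp add: U0)
  have U_incseq: "incseq (\<lambda>k. U k t x)" for t x using U_inc by (rule incseq_SucI)
  have Um [measurable]: "(\<lambda>(t, x). U k t x) \<in> borel_measurable (borel \<Otimes>\<^sub>M borel)" for k
  proof (induction k)
    case (Suc k)
    note [measurable] = Suc
    show ?case unfolding US \<Phi>_def case_prod_unfold indicator_def of_bool_def atLeastLessThan_iff by measurable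
  qed (simp add: U0)
  define W where "W t x = (SUP k. U k t x)" for t x
  have W_leA: "W t x \<le> ennreal A" for t x unfolding W_def by (intro SUP_least U_leA)
  have Wfin: "W t x < \<infinity>" for t x using W_leA[of t x] by (simp add: le_less_trans)
  have Wm [measurable]: "(\<lambda>(t, x). W t x) \<in> borel_measurable (borel \<Otimes>\<^sub>M borel)"
    unfolding W_def case_prod_unfold by measurable
  have ext_inc: "incseq (\<lambda>k. ext_f (U k s y))" for s y
    using U_inc le_less_trans[OF U_leA ennreal_less_top] by (intro incseq_SucI ext_f_mono) auto
  have heat_SUP: "nn_heat \<alpha> \<tau> (\<lambda>y. ext_f (W s y)) x = (SUP k. nn_heat \<alpha> \<tau> (\<lambda>y. ext_f (U k s y)) x)" for \<tau> s x
  proof -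
    have "nn_heat \<alpha> \<tau> (\<lambda>y. ext_f (W s y)) x = (\<integral>\<^sup>+y. (SUP k. ennreal (?K \<tau> (x - y)) * ext_f (U k s y)) \<partial>lborel)"
      unfolding nn_heat_def W_def using ext_f_SUP[OF U_incseq U_leA] by (simp add: SUP_mult_left_ennreal)
    also have "\<dots> = (SUP k. nn_heat \<alpha> \<tau> (\<lambda>y. ext_f (U k s y)) x)"
      unfolding nn_heat_def using ext_inc
      by (intro nn_integral_monotone_convergence_SUP) (auto simp: incseq_def le_fun_def intro!: mult_left_mono)
    finally show ?thesis .
  qed
  \<comment> \<open>Monotone convergence, under the heat integral by \<open>heat_SUP\<close> and
    then under the time integral; \<open>ext_f\<close> commutes with the supremum because all
    iterates stay below A.\<close>
  have W_fix: "W t x = \<Phi> W t x" if t: "0 \<le> t" for t x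
  proof -
    let ?D = "\<lambda>k. \<integral>\<^sup>+s\<in>{0..<t}. nn_heat \<alpha> (t - s) (\<lambda>y. ext_f (U k s y)) x \<partial>lborel"
    have "(\<integral>\<^sup>+s\<in>{0..<t}. nn_heat \<alpha> (t - s) (\<lambda>y. ext_f (W s y)) x \<partial>lborel)
      = (\<integral>\<^sup>+s. (SUP k. nn_heat \<alpha> (t - s) (\<lambda>y. ext_f (U k s y)) x * indicator {0..<t} s) \<partial>lborel)"
      unfolding heat_SUP by (simp add: SUP_mult_right_ennreal)
    also have "\<dots> = (SUP k. ?D k)"
      using ext_inc
      by (intro nn_integral_monotone_convergence_SUP)
        (auto simp: incseq_def le_fun_def intro!: mult_right_mono nn_heat_mono)
    finally have "\<Phi> W t x = ennreal (v t x) + (SUP k. ?D k)" using t by (simp add: \<Phi>_def)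
    also have "\<dots> = (SUP k. ennreal (v t x) + ?D k)" by (simp add: ennreal_SUP_add_right)
    also have "\<dots> = (SUP k. U (Suc k) t x)" using t by (simp add: US \<Phi>_def)
    also have "\<dots> = W t x"
    proof (rule LIMSEQ_unique)
      show "(\<lambda>k. U (Suc k) t x) \<longlonglongrightarrow> (SUP k. U (Suc k) t x)"
        using U_incseq[of t x] by (intro LIMSEQ_SUP) (auto simp: incseq_def)
      show "(\<lambda>k. U (Suc k) t x) \<longlonglongrightarrow> W t x"
        unfolding W_def using LIMSEQ_SUP[OF U_incseq] by (rule LIMSEQ_Suc)
    qed
    finally show ?thesis ..
  qed
  define u where "u t x = enn2real (W t x)" for t x
  have u0: "0 \<le> u t x" for t x by (simp add: u_def)
  have uA: "u t x \<le> A" for t x unfolding u_def using W_leA A by (intro enn2real_leI) auto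
  have um [measurable]: "(\<lambda>(t, x). u t x) \<in> borel_measurable (borel \<Otimes>\<^sub>M borel)"
    unfolding u_def case_prod_unfold by measurable
  define w where "w s y = f (u s y)" for s y
  have wm: "(\<lambda>(s, y). w s y) \<in> borel_measurable (borel \<Otimes>\<^sub>M borel)"
    using measurable_compose[OF um f_clamp_measurable] u0 by (simp add: w_def case_prod_unfold max_absorb2)
  have w: "0 \<le> w s y" "w s y \<le> f A" for s y
    unfolding w_def using u0 uA by (auto intro: f_nonneg f_mono)
  have ext_w: "ext_f (W s y) = ennreal (w s y)" for s y by (simp add: ext_f_def w_def u_def)
  define \<phi> where "\<phi> x = v 0 x" for x
  have \<phi>0: "0 \<le> \<phi> x" for x unfolding \<phi>_def by (intro v0) simp
  have \<phi>A: "\<phi> x \<le> A" for x using vA[of 0 x] \<phi>0[of x] by (simp add: \<phi>_def)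
  have \<phi>m [measurable]: "\<phi> \<in> borel_measurable borel" unfolding \<phi>_def by measurable
  have heat: "heat_semigroup \<alpha> t \<phi> x = v t x" if t: "0 \<le> t" for t x
  proof (cases "t = 0")
    case True
    then show ?thesis by (simp add: heat_semigroup_def \<phi>_def)
  next
    case False
    then have t': "0 < t" using t by simp
    have "nn_heat \<alpha> t (\<lambda>y. ennreal (\<phi> y)) x = (\<integral>\<^sup>+y. ennreal e * (ennreal (?K t (x - y)) * ennreal (?K 1 y)) \<partial>lborel)"
      unfolding nn_heat_def using e by (intro nn_integral_cong) (simp add: \<phi>_def v_def ennreal_mult' mult_ac)
    also have "\<dots> = ennreal e * nn_heat \<alpha> t (\<lambda>y. ennreal (?K 1 y)) x"
      unfolding nn_heat_def by (rule nn_integral_cmult) measurable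
    also have "\<dots> = ennreal (v t x)"
      using nn_kernel_semigroup[OF t' zero_less_one, of x] e by (simp add: v_def add.commute ennreal_mult')
    finally show ?thesis
      using heat_semigroup_eq_nn_heat(2)[OF t' \<phi>m \<phi>0 \<phi>A, where x = x] v0[OF t, of x] by simp
  qed
  have eq: "u t x = heat_semigroup \<alpha> t \<phi> x + (LINT s:{0..t}|lebesgue. heat_semigroup \<alpha> (t - s) (\<lambda>y. f (u s y)) x)"
    if t: "0 \<le> t" for t x
  proof -
    let ?L = "LINT s:{0..t}|lebesgue. heat_semigroup \<alpha> (t - s) (w s) x"
    note duh = duhamel_eq_nn_integral[OF wm w, where t = t and x = x]
    have "W t x = ennreal (v t x) + ennreal ?L"
      unfolding W_fix[OF t] duh(1) using t by (simp add: \<Phi>_def ext_w)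
    also have "\<dots> = ennreal (v t x + ?L)" using v0[OF t] duh(2) by (simp add: ennreal_plus)
    finally have "u t x = v t x + ?L" using v0[OF t, of x] duh(2) by (simp add: u_def del: ennreal_plus)
    then show ?thesis using heat[OF t] by (simp add: w_def[abs_def])
  qed
  show ?thesis
  proof (rule that)
    show "\<phi> \<in> Linfty"
      unfolding Linfty_def using \<phi>0 \<phi>A measurable_completion[of \<phi> lborel borel]
      by (auto intro!: exI[of _ A] AE_I2)
    show "0 \<le> \<phi> x" for x by (rule \<phi>0)
    show "\<not> (AE x in lebesgue. \<phi> x = 0)"
    proof
      assume "AE x in lebesgue. \<phi> x = 0"
      then have "(\<integral>x. \<phi> x \<partial>lborel) = (\<integral>x. 0 \<partial>(lborel :: (real^'n) measure))"
        unfolding AE_completion_iff by (intro integral_cong_AE) auto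
      moreover have "(\<integral>x. \<phi> x \<partial>lborel) = e"
        using stable_kernel_integral[OF \<alpha> zero_less_one, where 'a = "real^'n"] by (simp add: \<phi>_def v_def)
      ultimately show False using e by simp
    qed
    show "mild_solution \<alpha> f \<phi> \<infinity> u"
      unfolding mild_solution_def
    proof (intro conjI allI impI)
      show "(\<lambda>(t, x). u t x) \<in> borel_measurable (restrict_space borel ({t. 0 \<le> t \<and> ereal t < \<infinity>} \<times> UNIV))"
        using um by (intro measurable_restrict_space1) (simp add: borel_prod)
      show "0 \<le> u t x" for t x by (rule u0)
      show "bounded ((\<lambda>(t, x). u t x) ` ({0..T'} \<times> UNIV))" for T'
        using u0 uA by (auto simp: bounded_iff intro!: exI[of _ A])
      show "AE x in lebesgue. u t x = heat_semigroup \<alpha> t \<phi> x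
          + (LINT s:{0..t}|lebesgue. heat_semigroup \<alpha> (t - s) (\<lambda>y. f (u s y)) x)"
        if "0 \<le> t \<and> ereal t < \<infinity>" for t
        using that eq by (intro AE_I2) auto
    qed
  qed
qed

lemma pde_blowup_iff_divergent:
  assumes p_eq: "p = real CARD('n::finite) / \<alpha>" and "condB f" "condS f"
  shows "pde_blowup_property TYPE('n) \<alpha> f \<longleftrightarrow> (\<forall>\<delta>>0. fujita_integral f p \<delta> = \<infinity>)"
proof
  assume "\<forall>\<delta>>0. fujita_integral f p \<delta> = \<infinity>"
  then show "pde_blowup_property TYPE('n) \<alpha> f"
    unfolding pde_blowup_property_def using max_existence_time_finite[OF p_eq] assms by blast
next
  assume blowup: "pde_blowup_property TYPE('n) \<alpha> f"
  show "\<forall>\<delta>>0. fujita_integral f p \<delta> = \<infinity>"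
  proof (rule ccontr)
    assume "\<not> ?thesis"
    then obtain \<delta> where \<delta>: "0 < \<delta>" "fujita_integral f p \<delta> < \<infinity>" by (auto simp: less_top)
    obtain \<phi> :: "real^'n \<Rightarrow> real" and u where \<phi>: "\<phi> \<in> Linfty" "\<And>x. 0 \<le> \<phi> x" "\<not> (AE x in lebesgue. \<phi> x = 0)"
      and u: "mild_solution \<alpha> f \<phi> \<infinity> u"
      using global_mild_solution[OF p_eq \<delta>] by blast
    have "\<infinity> \<le> max_existence_time \<alpha> f \<phi>"
      unfolding max_existence_time_def using u by (intro Sup_upper) auto
    moreover have "max_existence_time \<alpha> f \<phi> < \<infinity>"
      using blowup \<phi> unfolding pde_blowup_property_def by auto
    ultimately show False by simp
  qed
qed

end

theorem theorem5p2:
  fixes f :: "real \<Rightarrow> real" and \<alpha> :: real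
  assumes "0 < \<alpha>" and "\<alpha> \<le> 2"
    and "\<forall>u\<ge>0. 0 \<le> f u"
    and "condM f"
    and "convex_on {0<..} f"
    and "condB f"
    and "condS f"
  shows "(pde_blowup_property TYPE('n::finite) \<alpha> f \<longleftrightarrow> ode_blowup_property CARD('n) \<alpha> f) \<and>
         (ode_blowup_property CARD('n) \<alpha> f \<longleftrightarrow>
           (\<forall>\<^sub>F \<delta> in at_right 0.
              (\<integral>\<^sup>+u\<in>{0<..<\<delta>}. ennreal (f u / u powr (2 + \<alpha> / real CARD('n))) \<partial>lborel) = \<infinity>))"
proof -
  define p where "p = real CARD('n) / \<alpha>"
  have p: "0 < p" using assms(1) by (simp add: p_def)
  interpret source f p using assms(4) p by (rule condM_source)
  interpret fujita_pde f p \<alpha> by unfold_locales (use assms in auto)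
  have "\<alpha> / real CARD('n) = 1 / p" by (simp add: p_def)
  then have "(\<forall>\<^sub>F \<delta> in at_right 0. (\<integral>\<^sup>+u\<in>{0<..<\<delta>}. ennreal (f u / u powr (2 + \<alpha> / real CARD('n))) \<partial>lborel) = \<infinity>)
    \<longleftrightarrow> (\<forall>\<delta>>0. fujita_integral f p \<delta> = \<infinity>)"
    using eventually_fujita_integral_iff[of f p] by (simp add: fujita_integral_def)
  then show ?thesis
    using pde_blowup_iff_divergent[OF p_def assms(6,7)] ode_blowup_iff_divergent[OF p_def assms(1,6,7)] by simp
qed

end
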